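(* Consider density estimation on $[0,1]$ with true density $f_0$, and let $\alpha_n\in(0,1]$ with $n\alpha_n\to\infty$. Let $\psi$ be a linear functional of the density with $\psi(f)-\psi(f_0)=\int\tilde\psi f$, where $\tilde\psi=\tilde\psi_{f_0}:[0,1]\to\mathbb R$ is bounded measurable with $\int\tilde\psi f_0=0$. Let $K_n\to\infty$ be integers and let $\Pi=\Pi_n$ be the random histogram prior with $K_n$ bins and positive weights $(\delta_{1,n},\dots,\delta_{K_n,n})$ satisfying $\sum_{i=1}^{K_n}\delta_{i,n}=o(\sqrt{n\alpha_n})$. Suppose $f_0$ is bounded and $$\Pi_{\alpha_n}\big(\|f-f_{0,[K_n]}\|_1\le\varepsilon_n\mid Y^n\big)=1+o_P(1)$$ for a sequence $\varepsilon_n\to0$. Suppose additionally that $$\sqrt{n\alpha_n}\,(\hat\psi_{[K_n]}-\hat\psi)=o_P(1),$$ where $\hat\psi=\psi(f_0)+\frac1n\sum_{i=1}^n\tilde\psi(Y_i)$ and $\hat\psi_{[K_n]}=\psi(f_0)+\frac1n\sum_{i=1}^n\tilde\psi_{[K_n]}(Y_i)$. Then the $\alpha_n$-posterior distribution of $\sqrt{n\alpha_n}(\psi(f)-\hat\psi)$ converges weakly in $P_0$-probability to a Gaussian distribution with mean $0$ and variance $V_0=\int f_0\tilde\psi^2$.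
   Context: Density estimation: one observes $Y^n=(Y_1,\dots,Y_n)$ i.i.d. from a density $f$ on $[0,1]$; $\ell_n(f)=\sum_i\log f(Y_i)$; $P_0$ is the law under $f_0$ and $o_P(1)$ is in $P_0$-probability. The $\alpha_n$-posterior is $\Pi_{\alpha_n}(B\mid Y^n)=\int_Be^{\alpha_n\ell_n}d\Pi/\int e^{\alpha_n\ell_n}d\Pi$. Random histogram prior with $k$ bins and weights $(\delta_1,\dots,\delta_k)$: the law of $f=k\sum_{j=1}^k\omega_j1_{I_j}$, $I_j=[(j-1)/k,j/k]$, where $(\omega_1,\dots,\omega_k)$ has the Dirichlet distribution with parameters $(\delta_1,\dots,\delta_k)$ on the unit simplex. For $h\in L^2[0,1]$, $h_{[k]}=k\sum_{j=1}^k\big(\int_{I_j}h\big)1_{I_j}$, and $f_{0,[k]}=(f_0)_{[k]}$. A data-dependent law $Q_Y$ on $\mathbb R$ converges weakly in $P_0$-probability to $\mathcal N(0,V)$ if $d_{BL}(Q_Y,\mathcal N(0,V))\to0$ in $P_0$-probability, with $d_{BL}$ the bounded Lipschitz distance; the $\alpha_n$-posterior distribution of a function of $f$ is the push-forward of $\Pi_{\alpha_n}(\cdot\mid Y^n)$ by that function. *)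

theory Defs
  imports "HOL-Probability.Probability" "HOL-Library.Landau_Symbols"
begin

text \<open>Functions on \<open>[0,1]\<close> are represented by functions on the reals whose values outside
  \<open>[0,1]\<close> are never constrained or used.\<close>

definition is_density01 :: "(real \<Rightarrow> real) \<Rightarrow> bool" where
  "is_density01 f \<longleftrightarrow> set_borel_measurable borel {0..1} f \<and> (\<forall>x\<in>{0..1}. 0 \<le> f x) \<and>
     set_integrable lborel {0..1} f \<and> (LINT x:{0..1}|lborel. f x) = 1"

definition linear_functional01 :: "((real \<Rightarrow> real) \<Rightarrow> real) \<Rightarrow> bool" where
  "linear_functional01 \<psi> \<longleftrightarrow>
     (\<forall>f g a b. set_integrable lborel {0..1} f \<longrightarrow> set_integrable lborel {0..1} g \<longrightarrow>
        \<psi> (\<lambda>x. a * f x + b * g x) = a * \<psi> f + b * \<psi> g)"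

definition L1_dist01 :: "(real \<Rightarrow> real) \<Rightarrow> (real \<Rightarrow> real) \<Rightarrow> real" where
  "L1_dist01 f g = (LINT x:{0..1}|lborel. \<bar>f x - g x\<bar>)"

text \<open>Bins are closed, so neighbouring bins share an endpoint and the sums below count both bins
  there; this affects only a null set.\<close>

definition bin :: "nat \<Rightarrow> nat \<Rightarrow> real set" where
  "bin k j = {(real j - 1) / real k .. real j / real k}"

definition histogram :: "nat \<Rightarrow> (nat \<Rightarrow> real) \<Rightarrow> real \<Rightarrow> real" where
  "histogram k \<omega> x = real k * (\<Sum>j=1..k. \<omega> j * indicator (bin k j) x)"

definition bin_proj :: "nat \<Rightarrow> (real \<Rightarrow> real) \<Rightarrow> real \<Rightarrow> real" where
  "bin_proj k h x =
     real k * (\<Sum>j=1..k. (LINT u:bin k j|lborel. h u) * indicator (bin k j) x)"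

definition unit_simplex :: "nat \<Rightarrow> (nat \<Rightarrow> real) set" where
  "unit_simplex k = {\<omega> \<in> extensional {1..k}. (\<forall>j\<in>{1..k}. 0 \<le> \<omega> j) \<and> (\<Sum>j=1..k. \<omega> j) = 1}"

text \<open>The Dirichlet density with respect to Lebesgue measure in the first \<open>k - 1\<close> coordinates.\<close>

definition dirichlet_density :: "nat \<Rightarrow> (nat \<Rightarrow> real) \<Rightarrow> (nat \<Rightarrow> real) \<Rightarrow> real" where
  "dirichlet_density k \<delta> w =
     (if (\<forall>j\<in>{1..<k}. 0 < w j) \<and> (\<Sum>j=1..<k. w j) < 1
      then Gamma (\<Sum>j=1..k. \<delta> j) / (\<Prod>j=1..k. Gamma (\<delta> j)) *
           (\<Prod>j=1..<k. w j powr (\<delta> j - 1)) * (1 - (\<Sum>j=1..<k. w j)) powr (\<delta> k - 1)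
      else 0)"

text \<open>The last weight is determined by the others. For \<open>k = 1\<close> the Lebesgue measure below is the
  point mass on the empty tuple, and the law is the point mass at \<open>\<omega>\<^sub>1 = 1\<close>.\<close>

definition dirichlet :: "nat \<Rightarrow> (nat \<Rightarrow> real) \<Rightarrow> (nat \<Rightarrow> real) measure" where
  "dirichlet k \<delta> =
     restrict_space
       (distr (density (\<Pi>\<^sub>M j\<in>{1..<k}. lborel) (\<lambda>w. ennreal (dirichlet_density k \<delta> w)))
          (\<Pi>\<^sub>M j\<in>{1..k}. borel)
          (\<lambda>w. \<lambda>j\<in>{1..k}. if j < k then w j else 1 - (\<Sum>i=1..<k. w i)))
       (unit_simplex k)"

text \<open>The law of the random histogram is the image of the Dirichlet law on the function space,
  which is given the largest \<open>\<sigma>\<close>-algebra making \<open>\<omega> \<mapsto> histogram k \<omega>\<close> measurable on the simplex: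
  a set of functions, or a real function of \<open>f\<close>, is measurable iff it is so in terms of the
  weights.\<close>

definition random_histogram :: "nat \<Rightarrow> (nat \<Rightarrow> real) \<Rightarrow> (real \<Rightarrow> real) measure" where
  "random_histogram k \<delta> =
     distr (dirichlet k \<delta>)
       (sigma UNIV {B. histogram k -` B \<inter> space (dirichlet k \<delta>) \<in> sets (dirichlet k \<delta>)})
       (histogram k)"

text \<open>\<open>exp (a * \<ell>\<^sub>n f)\<close> written as a product of powers: unlike \<open>ln\<close>, which satisfies \<open>ln 0 = 0\<close>,
  this gives the value \<open>0\<close> as soon as the density vanishes at an observation.\<close>

definition tempered_likelihood :: "real \<Rightarrow> nat \<Rightarrow> (nat \<Rightarrow> real) \<Rightarrow> (real \<Rightarrow> real) \<Rightarrow> real" where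
  "tempered_likelihood a n y f = (\<Prod>i=1..n. f (y i) powr a)"

definition posterior ::
    "real \<Rightarrow> (real \<Rightarrow> real) measure \<Rightarrow> nat \<Rightarrow> (nat \<Rightarrow> real) \<Rightarrow> (real \<Rightarrow> real) measure" where
  "posterior a P n y =
     density P (\<lambda>f. ennreal (tempered_likelihood a n y f) /
                    (\<integral>\<^sup>+g. ennreal (tempered_likelihood a n y g) \<partial>P))"

text \<open>With \<open>h\<close> the influence function \<open>\<psi>\<close>-tilde this is the efficient estimator, with \<open>h\<close> its
  projection on histograms the projected one.\<close>

definition linear_estimator :: "real \<Rightarrow> (real \<Rightarrow> real) \<Rightarrow> nat \<Rightarrow> (nat \<Rightarrow> real) \<Rightarrow> real" where
  "linear_estimator c h n y = c + (1 / real n) * (\<Sum>i=1..n. h (y i))"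

text \<open>Outer probability makes the notion meaningful without a measurability side condition; for
  measurable \<open>X n\<close> it is convergence to \<open>0\<close> in probability.\<close>

definition is_o_P1 :: "'w measure \<Rightarrow> (nat \<Rightarrow> 'w \<Rightarrow> real) \<Rightarrow> bool" where
  "is_o_P1 M X \<longleftrightarrow>
     (\<forall>e>0. (\<lambda>n. outer_measure_of M {w \<in> space M. e < \<bar>X n w\<bar>}) \<longlonglongrightarrow> 0)"

text \<open>The unit ball of test functions is that of the norm \<open>max (sup-norm) (Lipschitz constant)\<close>; the
  convention with the sum of the two gives an equivalent distance.\<close>

definition d_BL :: "real measure \<Rightarrow> real measure \<Rightarrow> real" where
  "d_BL P Q =
     (SUP g\<in>{g :: real \<Rightarrow> real. (\<forall>x. \<bar>g x\<bar> \<le> 1) \<and> 1-lipschitz_on UNIV g}.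
        \<bar>(\<integral>x. g x \<partial>P) - (\<integral>x. g x \<partial>Q)\<bar>)"

text \<open>Parametrised by the variance, with the degenerate law at variance \<open>0\<close>; the library density
  \<open>normal_density m 0\<close> is identically \<open>0\<close>.\<close>

definition gaussian :: "real \<Rightarrow> real \<Rightarrow> real measure" where
  "gaussian m v =
     (if v = 0 then return borel m else density lborel (\<lambda>x. ennreal (normal_density m (sqrt v) x)))"

definition weakly_converges_in_prob ::
    "'w measure \<Rightarrow> (nat \<Rightarrow> 'w \<Rightarrow> real measure) \<Rightarrow> real measure \<Rightarrow> bool" where
  "weakly_converges_in_prob M Q N \<longleftrightarrow> is_o_P1 M (\<lambda>n w. d_BL (Q n w) N)"

end

(* The likelihood of a histogram is a monomial in the bin weights, so by conjugacy the posterior of the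
   weights is again a Dirichlet law, with parameters a_j = delta_j + alpha * N_j, N_j the number of
   observations in bin j. A Dirichlet vector is a normalized vector of independent gamma variables G_j,
   hence the posterior probability that sqrt (n * alpha) * (psi f - psi_hat) is at most x equals the
   probability that a linear combination sum_j c_j * G_j is nonpositive. The characteristic function of
   this combination is prod_j (1 - i t c_j) powr (-a_j), and a second-order expansion of the logarithm
   gives the limit exp (-i t x - t^2 V / 2) as soon as sum_j a_j / (n * alpha), and the first and second
   weighted moments of the bin averages of psi-tilde, converge. These three conditions hold in probability by
   the assumption on the weights, the no-bias assumption, Hoeffding's inequality and the convergence in L1
   of projections on histograms. *)

theory Submission
  imports Defs
begin

text \<open>The half-line event passes from the Dirichlet vector to the gamma vector because it can
  be made homogeneous. On the simplex the threshold x equals x times the sum of the weights, so it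
  is absorbed into the coefficients, \<open>c_j = d_j / sqrt \<nu> - x / \<nu>\<close> with
  \<open>\<nu> = n * \<alpha>\<close>, and the resulting half space is a cone that ignores the total
  of the gamma variables. The price is that c depends on x: every point x needs its own limit, a
  Gaussian law centred at -x whose cdf is read off at 0. The data enter through the Dirichlet
  parameters and the centring, and the moment conditions hold only in probability. The limit theorem
  for deterministic sequences is therefore recast, by contradiction, as a bound for each single
  Dirichlet law whose moments are within \<rho> of their limits, with \<rho> independent of the
  number of bins. It then applies outcome by outcome outside exceptional sets of vanishing outer
  probability. Observations on a boundary shared by two closed bins are excluded by a null set,
  since there the likelihood is no monomial in the weights.\<close>

declare One_nat_def [simp del]

section \<open>Gamma densities, their Fourier transform and the logarithm near 1\<close>

text \<open>The gamma law with shape \<open>a\<close> and rate 1. The value 0 on the closed negative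
  half line matches the strict inequalities in \<open>dirichlet_density\<close>, so that the two
  densities can be compared at every point and not only almost everywhere.\<close>

definition gamma_density :: "real \<Rightarrow> real \<Rightarrow> real" where
  "gamma_density a x = (if 0 < x then x powr (a - 1) * exp (- x) / Gamma a else 0)"

lemma borel_measurable_gamma_density [measurable]: "gamma_density a \<in> borel_measurable borel"
  unfolding gamma_density_def by measurable

lemma gamma_density_nonneg [simp]: "0 < a \<Longrightarrow> 0 \<le> gamma_density a x"
  by (simp add: gamma_density_def Gamma_real_pos less_imp_le)

lemma nn_integral_gamma_density:
  assumes "0 < a"
  shows "(\<integral>\<^sup>+x. ennreal (gamma_density a x) \<partial>lborel) = 1"
proof -
  from nn_integral_has_integral_lebesgue'[OF _ has_integral_divide[OF Gamma_integral_real[OF assms], of "Gamma a"]]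
  have *: "(\<integral>\<^sup>+t. ennreal (t powr (a - 1) / exp t / Gamma a) * indicator {0..} t \<partial>lborel) = ennreal (Gamma a / Gamma a)"
    using assms by (simp add: Gamma_real_pos less_imp_le)
  have "(\<integral>\<^sup>+x. ennreal (gamma_density a x) \<partial>lborel) =
      (\<integral>\<^sup>+t. ennreal (t powr (a - 1) / exp t / Gamma a) * indicator {0..} t \<partial>lborel)"
  proof (intro nn_integral_cong)
    fix x :: real
    show "ennreal (gamma_density a x) = ennreal (x powr (a - 1) / exp x / Gamma a) * indicator {0..} x"
      by (cases x "0 :: real" rule: linorder_cases) (simp_all add: gamma_density_def exp_minus divide_inverse)
  qed
  also have "\<dots> = 1"
    using * Gamma_real_pos[OF assms] by simp
  finally show ?thesis .
qed

text \<open>A factor x^m only shifts the shape parameter, and the ratio of the normalizing constants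
  is a rising factorial. All moments thus follow from the total mass being 1.\<close>

lemma power_times_gamma_density:
  assumes "0 < a"
  shows "x ^ m * gamma_density a x = pochhammer a m * gamma_density (a + real m) x"
proof -
  have "a \<notin> \<int>\<^sub>\<le>\<^sub>0" using assms nonpos_Ints_nonpos[of a] by linarith
  then have "pochhammer a m = Gamma (a + real m) / Gamma a" by (rule pochhammer_Gamma)
  then have "Gamma (a + real m) = pochhammer a m * Gamma a"
    using Gamma_real_pos[OF assms] by (simp add: field_simps)
  moreover have "Gamma a \<noteq> 0" "pochhammer a m \<noteq> 0"
    using Gamma_real_pos[OF assms] pochhammer_pos[OF assms, of m] by simp_all
  moreover have "x ^ m * x powr (a - 1) = x powr (a + real m - 1)" if "0 < x"
  proof -
    have "x ^ m * x powr (a - 1) = x powr (real m + (a - 1))"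
      by (simp only: powr_add powr_realpow[OF that])
    then show ?thesis by (simp add: algebra_simps)
  qed
  ultimately show ?thesis
    by (simp add: gamma_density_def flip: mult.assoc)
qed

lemma has_bochner_integral_gamma_moment:
  assumes "0 < a"
  shows "has_bochner_integral lborel (\<lambda>x. x ^ m * gamma_density a x) (pochhammer a m)"
proof (rule has_bochner_integral_nn_integral)
  show "AE x in lborel. 0 \<le> x ^ m * gamma_density a x"
    using assms by (auto simp: gamma_density_def Gamma_real_pos less_imp_le)
  show "0 \<le> pochhammer a m"
    using pochhammer_pos[OF assms] by (simp add: less_imp_le)
  then show "(\<integral>\<^sup>+x. ennreal (x ^ m * gamma_density a x) \<partial>lborel) = ennreal (pochhammer a m)"
    using nn_integral_gamma_density[of "a + real m"] assms
    by (simp add: power_times_gamma_density ennreal_mult' nn_integral_cmult)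
qed measurable

text \<open>The bridge between two series: the right-hand side is the m-th term of the exponential
  series integrated against the gamma law, the left-hand side the m-th term of the binomial series
  of \<open>(1 - z) powr (- a)\<close>.\<close>

lemma minus_gchoose_times_power:
  fixes a z :: "'a::field_char_0"
  shows "((- a) gchoose m) * (- z) ^ m = z ^ m / fact m * pochhammer a m"
proof -
  have "((- a) gchoose m) * (- z) ^ m = ((-1) ^ m * (-1) ^ m) * (z ^ m / fact m * pochhammer a m)"
    by (simp add: gbinomial_pochhammer power_minus[of z])
  also have "(-1 :: 'a) ^ m * (-1) ^ m = 1"
    by (simp flip: power_mult_distrib)
  finally show ?thesis by simp
qed

lemma summable_pochhammer_series:
  fixes a t :: real
  assumes "\<bar>t\<bar> < 1"
  shows "summable (\<lambda>m. \<bar>t\<bar> ^ m / fact m * pochhammer a m)"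
  using gen_binomial_real[of "-\<bar>t\<bar>" "-a"] assms
  by (simp add: minus_gchoose_times_power sums_iff)

text \<open>The exponential series is integrated term by term and recognized as a binomial series,
  which converges for \<open>\<bar>t\<bar> < 1\<close>. This range suffices, because the arguments
  inserted later are of order \<open>1 / sqrt \<nu>\<close>.\<close>

lemma gamma_fourier:
  assumes a: "0 < a" and t: "\<bar>t\<bar> < 1"
  shows "integrable lborel (\<lambda>x. iexp (t * x) * of_real (gamma_density a x))"
    and "(LINT x|lborel. iexp (t * x) * of_real (gamma_density a x)) = (1 - \<i> * of_real t) powr (- of_real a)"
proof -
  let ?g = "gamma_density a"
  have int0: "integrable lborel ?g"
    using has_bochner_integral_gamma_moment[OF a, of 0] by (simp add: has_bochner_integral_iff)
  show "integrable lborel (\<lambda>x. iexp (t * x) * of_real (?g x))"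
    by (rule Bochner_Integration.integrable_bound[OF int0]) (auto simp: norm_mult)
  define f :: "nat \<Rightarrow> real \<Rightarrow> complex"
    where "f m x = (\<i> * of_real t) ^ m / fact m * of_real (x ^ m * ?g x)" for m x
  have m: "integrable lborel (\<lambda>x. x ^ m * ?g x)" "(LINT x|lborel. x ^ m * ?g x) = pochhammer a m" for m
    using has_bochner_integral_gamma_moment[OF a, of m] by (simp_all add: has_bochner_integral_iff)
  have fint: "integrable lborel (f m)" for m
    unfolding f_def using m by (intro integrable_mult_right integrable_of_real) auto
  have nonneg: "0 \<le> x ^ m * ?g x" for m x
    using a by (simp add: gamma_density_def Gamma_real_pos less_imp_le)
  have nf: "norm (f m x) = \<bar>t\<bar> ^ m / fact m * (x ^ m * ?g x)" for m x
    using nonneg[of x m] by (simp only: f_def norm_mult norm_divide norm_power norm_of_real norm_ii norm_fact) simp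
  have fsums: "(\<lambda>m. f m x) sums (iexp (t * x) * of_real (?g x))" for x
  proof -
    have "(\<lambda>m. (\<i> * of_real (t * x)) ^ m /\<^sub>R fact m * of_real (?g x)) sums (iexp (t * x) * of_real (?g x))"
      by (intro sums_mult2 exp_converges)
    also have "(\<lambda>m. (\<i> * of_real (t * x)) ^ m /\<^sub>R fact m * of_real (?g x)) = (\<lambda>m. f m x)"
      by (intro ext) (simp add: f_def scaleR_conv_of_real power_mult_distrib divide_inverse mult_ac)
    finally show ?thesis .
  qed
  have nsum: "summable (\<lambda>m. norm (f m x))" for x
  proof -
    have "summable (\<lambda>m. \<bar>?g x\<bar> * norm ((t * x) ^ m /\<^sub>R fact m))"
      by (intro summable_mult summable_norm_exp)
    also have "(\<lambda>m. \<bar>?g x\<bar> * norm ((t * x) ^ m /\<^sub>R fact m)) = (\<lambda>m. norm (f m x))"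
    proof
      fix m
      have "x ^ m * ?g x = \<bar>x\<bar> ^ m * \<bar>?g x\<bar>"
        using abs_of_nonneg[OF nonneg[of x m]] by (simp add: abs_mult power_abs)
      then show "\<bar>?g x\<bar> * norm ((t * x) ^ m /\<^sub>R fact m) = norm (f m x)"
        unfolding nf by (simp add: power_mult_distrib abs_mult power_abs divide_inverse)
    qed
    finally show ?thesis .
  qed
  \<comment> \<open>The integrals of the norms are the terms of the binomial series of
    \<open>(1 - \<bar>t\<bar>) powr (- a)\<close>; this is what permits the exchange of sum and
    integral.\<close>
  have isum: "summable (\<lambda>m. LINT x|lborel. norm (f m x))"
    unfolding nf using summable_pochhammer_series[OF t, of a] m by simp
  have "(\<lambda>m. LINT x|lborel. f m x) sums (LINT x|lborel. (\<Sum>m. f m x))"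
    using fint nsum isum by (intro sums_integral AE_I2)
  moreover have "(\<Sum>m. f m x) = iexp (t * x) * of_real (?g x)" for x
    using fsums sums_unique by metis
  ultimately have 1: "(\<lambda>m. LINT x|lborel. f m x) sums (LINT x|lborel. iexp (t * x) * of_real (?g x))"
    by (simp only:)
  have "(LINT x|lborel. f m x) = (\<i> * of_real t) ^ m / fact m * of_real (pochhammer a m)" for m
    by (simp only: f_def integral_mult_right_zero integral_complex_of_real m(2))
  then have 2: "(LINT x|lborel. f m x) = ((- of_real a) gchoose m) * (- (\<i> * of_real t)) ^ m" for m
    by (simp only: minus_gchoose_times_power pochhammer_of_real)
  have "(\<lambda>m. ((- of_real a) gchoose m) * (- (\<i> * of_real t)) ^ m) sums (1 + - (\<i> * of_real t)) powr (- of_real a)"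
    using t by (intro gen_binomial_complex) (simp add: norm_mult)
  then have "(\<lambda>m. LINT x|lborel. f m x) sums (1 - \<i> * of_real t) powr (- of_real a)"
    by (simp only: 2 diff_conv_add_uminus)
  with 1 show "(LINT x|lborel. iexp (t * x) * of_real (?g x)) = (1 - \<i> * of_real t) powr (- of_real a)"
    by (rule sums_unique2)
qed

text \<open>The remainder of the logarithmic series from the cubic term on is dominated by a
  geometric series of ratio 1/2, whose sum is the constant 2.\<close>

lemma norm_Ln_quadratic:
  fixes z :: complex
  assumes "norm z \<le> 1 / 2"
  shows "norm (Ln (1 + z) - z + z\<^sup>2 / 2) \<le> 2 * norm z ^ 3"
proof -
  have z1: "norm z < 1" using assms by simp
  have s: "(\<lambda>n. - ((-z)^n) / of_nat n) sums ln (1 + z)"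
    by (rule Ln_series'[OF z1])
  \<comment> \<open>Three terms are split off to remove the linear and the quadratic one: the term
    of index 0 is a division by 0 and hence equal to 0.\<close>
  have "(\<lambda>n. - ((-z)^(n + 3)) / of_nat (n + 3)) sums (ln (1 + z) - (\<Sum>i<3. - ((-z)^i) / of_nat i))"
    using sums_split_initial_segment[OF s, of 3] by simp
  moreover have "ln (1 + z) - (\<Sum>i<3. - ((-z)^i) / of_nat i) = Ln (1 + z) - z + z\<^sup>2 / 2"
    by (simp add: eval_nat_numeral One_nat_def)
  ultimately have s3: "(\<lambda>n. - ((-z)^(n + 3)) / of_nat (n + 3)) sums (Ln (1 + z) - z + z\<^sup>2 / 2)"
    by (simp only:)
  have g: "(\<lambda>n. norm z ^ 3 * (1/2) ^ n) sums (norm z ^ 3 * (1 / (1 - 1/2)))"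
    by (intro sums_mult geometric_sums) simp
  have b: "norm (- ((-z)^(n + 3)) / of_nat (n + 3)) \<le> norm z ^ 3 * (1/2) ^ n" for n
  proof -
    have "norm (- ((-z)^(n + 3)) / of_nat (n + 3)) = norm z ^ 3 * norm z ^ n / real (n + 3)"
      by (simp add: norm_divide norm_power norm_mult power_add del: of_nat_add)
    also have "\<dots> \<le> norm z ^ 3 * norm z ^ n / 1"
      by (intro divide_left_mono) auto
    also have "\<dots> \<le> norm z ^ 3 * (1/2) ^ n"
      using assms by (simp add: mult_left_mono power_mono)
    finally show ?thesis .
  qed
  have "norm (Ln (1 + z) - z + z\<^sup>2 / 2) = norm (\<Sum>n. - ((-z)^(n + 3)) / of_nat (n + 3))"
    using s3 by (simp add: sums_iff)
  also have "\<dots> \<le> (\<Sum>n. norm z ^ 3 * (1/2) ^ n)"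
    using b g by (intro norm_suminf_le) (auto simp: sums_iff)
  also have "\<dots> = 2 * norm z ^ 3"
    using g by (simp add: sums_iff)
  finally show ?thesis .
qed

section \<open>Dirichlet laws as laws of normalized gamma vectors\<close>

lemma borel_measurable_sum_coordinates [measurable]:
  "(\<lambda>x. sum x {1..<k}) \<in> borel_measurable (PiM {1..<k} (\<lambda>_. lborel :: real measure))"
  by (intro borel_measurable_sum) (auto simp: measurable_component_singleton)

text \<open>The Jacobian is collected one coordinate at a time: Tonelli isolates a coordinate, and
  the affine substitution on the line contributes one factor \<open>s\<close>.\<close>

lemma nn_integral_PiM_lborel_scale:
  assumes "finite I" and s: "0 < (s::real)"
    and "f \<in> borel_measurable (PiM I (\<lambda>_. lborel))"
  shows "(\<integral>\<^sup>+x. f x \<partial>PiM I (\<lambda>_. lborel)) =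
    ennreal (s ^ card I) * (\<integral>\<^sup>+x. f (\<lambda>i\<in>I. s * x i) \<partial>PiM I (\<lambda>_. lborel))"
  using assms(1,3)
proof (induction I arbitrary: f rule: finite_induct)
  case empty
  then show ?case
    by (simp add: PiM_empty nn_integral_count_space_finite)
next
  case (insert i I)
  interpret product_sigma_finite "\<lambda>_. lborel :: real measure" ..
  note [measurable] = insert.prems
  have fi [measurable]: "(\<lambda>x. f (x(i := y))) \<in> borel_measurable (PiM I (\<lambda>_. lborel))" for y
    by (rule measurable_compose[OF measurable_fun_upd insert.prems]) auto
  have joint [measurable]: "(\<lambda>(y, x). f ((\<lambda>j\<in>I. s * x j)(i := y))) \<in>
      borel_measurable (borel \<Otimes>\<^sub>M PiM I (\<lambda>_. lborel))"
    unfolding case_prod_beta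
    by (rule measurable_compose[OF measurable_fun_upd insert.prems, where J1 = I]) (auto intro!: measurable_restrict)
  have m: "(\<lambda>y. \<integral>\<^sup>+x. f ((\<lambda>j\<in>I. s * x j)(i := y)) \<partial>PiM I (\<lambda>_. lborel)) \<in> borel_measurable borel"
    using sigma_finite_measure.borel_measurable_nn_integral[OF sigma_finite[OF insert.hyps(1)] joint] .
  have upd: "(\<lambda>j\<in>insert i I. s * (x(i := y)) j) = (\<lambda>j\<in>I. s * x j)(i := s * y)"
    for x :: "'a \<Rightarrow> real" and y
    using insert.hyps by (auto simp: fun_eq_iff)
  have "(\<integral>\<^sup>+x. f x \<partial>PiM (insert i I) (\<lambda>_. lborel)) =
      (\<integral>\<^sup>+y. \<integral>\<^sup>+x. f (x(i := y)) \<partial>PiM I (\<lambda>_. lborel) \<partial>lborel)"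
    by (rule product_nn_integral_insert_rev[OF insert.hyps insert.prems])
  also have "\<dots> = (\<integral>\<^sup>+y. ennreal (s ^ card I) * (\<integral>\<^sup>+x. f ((\<lambda>j\<in>I. s * x j)(i := y)) \<partial>PiM I (\<lambda>_. lborel)) \<partial>lborel)"
    by (intro nn_integral_cong insert.IH fi)
  also have "\<dots> = ennreal (s ^ card I) * (\<integral>\<^sup>+y. (\<integral>\<^sup>+x. f ((\<lambda>j\<in>I. s * x j)(i := y)) \<partial>PiM I (\<lambda>_. lborel)) \<partial>lborel)"
    using m by (intro nn_integral_cmult) simp
  also have "(\<integral>\<^sup>+y. (\<integral>\<^sup>+x. f ((\<lambda>j\<in>I. s * x j)(i := y)) \<partial>PiM I (\<lambda>_. lborel)) \<partial>lborel) =
     ennreal s * (\<integral>\<^sup>+y. (\<integral>\<^sup>+x. f ((\<lambda>j\<in>I. s * x j)(i := s * y)) \<partial>PiM I (\<lambda>_. lborel)) \<partial>lborel)"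
    using s by (subst nn_integral_real_affine[where c = s and t = 0, OF m]) simp_all
  also have "(\<integral>\<^sup>+y. (\<integral>\<^sup>+x. f ((\<lambda>j\<in>I. s * x j)(i := s * y)) \<partial>PiM I (\<lambda>_. lborel)) \<partial>lborel) =
      (\<integral>\<^sup>+x. f (\<lambda>j\<in>insert i I. s * x j) \<partial>PiM (insert i I) (\<lambda>_. lborel))"
  proof -
    have "(\<lambda>x. \<lambda>j\<in>insert i I. s * x j) \<in> PiM (insert i I) (\<lambda>_. lborel) \<rightarrow>\<^sub>M PiM (insert i I) (\<lambda>_. lborel)"
      by (rule measurable_restrict) simp
    from product_nn_integral_insert_rev[OF insert.hyps measurable_compose[OF this insert.prems]]
    show ?thesis by (simp only: upd)
  qed
  moreover have "ennreal (s ^ card (insert i I)) = ennreal (s ^ card I) * ennreal s"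
    using insert.hyps s by (simp add: ennreal_mult' mult.commute)
  ultimately show ?case
    by (simp only: mult.assoc)
qed

lemma borel_measurable_dirichlet_density [measurable]:
  "dirichlet_density k a \<in> borel_measurable (PiM {1..<k} (\<lambda>_. lborel))"
proof -
  have *: "dirichlet_density k a = (\<lambda>w. indicator {w. (\<forall>j\<in>{1..<k}. 0 < w j) \<and> (\<Sum>j=1..<k. w j) < 1} w *
     (Gamma (\<Sum>j=1..k. a j) / (\<Prod>j=1..k. Gamma (a j)) *
           (\<Prod>j=1..<k. w j powr (a j - 1)) * (1 - (\<Sum>j=1..<k. w j)) powr (a k - 1)))"
    by (auto simp: dirichlet_density_def fun_eq_iff)
  have "{w \<in> space (PiM {1..<k} (\<lambda>_. lborel)). (\<forall>j\<in>{1..<k}. 0 < w j) \<and> (\<Sum>j=1..<k. w j) < (1::real)}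
      \<in> sets (PiM {1..<k} (\<lambda>_. lborel))"
    by (intro sets.sets_Collect_conj sets.sets_Collect_finite_All) measurable
  also have "{w \<in> space (PiM {1..<k} (\<lambda>_. lborel)). (\<forall>j\<in>{1..<k}. 0 < w j) \<and> (\<Sum>j=1..<k. w j) < (1::real)} =
      {w. (\<forall>j\<in>{1..<k}. 0 < w j) \<and> (\<Sum>j=1..<k. w j) < 1} \<inter> space (PiM {1..<k} (\<lambda>_. lborel))"
    by blast
  finally have [measurable]: "indicator {w. (\<forall>j\<in>{1..<k}. 0 < w j) \<and> (\<Sum>j=1..<k. w j) < (1::real)}
      \<in> (borel_measurable (PiM {1..<k} (\<lambda>_. lborel)) :: ((nat \<Rightarrow> real) \<Rightarrow> real) set)"
    unfolding borel_measurable_indicator_iff .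
  show ?thesis
    unfolding * by measurable
qed

lemma dirichlet_density_nonneg:
  assumes k: "1 \<le> k" and a: "\<And>j. j \<in> {1..k} \<Longrightarrow> 0 < a j"
  shows "0 \<le> dirichlet_density k a w"
proof -
  have "0 < (\<Sum>j=1..k. a j)" using a k by (intro sum_pos) auto
  then have "0 \<le> Gamma (\<Sum>j=1..k. a j)" by (rule Gamma_real_nonneg)
  moreover have "0 \<le> (\<Prod>j=1..k. Gamma (a j))" using a by (intro prod_nonneg ballI Gamma_real_nonneg)
  moreover have "0 \<le> (\<Prod>j=1..<k. w j powr (a j - 1))" by (intro prod_nonneg) simp
  ultimately show ?thesis
    unfolding dirichlet_density_def by simp
qed

text \<open>Names the map under which \<open>dirichlet\<close> is an image measure, so that
  Dirichlet integrals become Lebesgue integrals over the first \<open>k - 1\<close>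
  coordinates.\<close>

definition complete_weights :: "nat \<Rightarrow> (nat \<Rightarrow> real) \<Rightarrow> nat \<Rightarrow> real" where
  "complete_weights k w = (\<lambda>j\<in>{1..k}. if j < k then w j else 1 - (\<Sum>i=1..<k. w i))"

lemma measurable_complete_weights [measurable]:
  "complete_weights k \<in> PiM {1..<k} (\<lambda>_. lborel) \<rightarrow>\<^sub>M PiM {1..k} (\<lambda>_. borel)"
  unfolding complete_weights_def
proof (rule measurable_restrict)
  fix j assume "j \<in> {1..k}"
  then show "(\<lambda>w. if j < k then w j else 1 - (\<Sum>i=1..<k. w i)) \<in> borel_measurable (PiM {1..<k} (\<lambda>_. lborel))"
    by (cases "j < k") (simp_all add: measurable_component_singleton)
qed

lemma sum_complete_weights:
  assumes "1 \<le> k"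
  shows "(\<Sum>j=1..k. g j * complete_weights k w j) = (\<Sum>j=1..<k. g j * w j) + g k * (1 - (\<Sum>j=1..<k. w j))"
proof -
  have "{1..k} = insert k {1..<k}" using assms by auto
  then show ?thesis by (simp add: complete_weights_def)
qed

lemma complete_weights_pos:
  assumes "dirichlet_density k a w \<noteq> 0" "j \<in> {1..k}"
  shows "0 < complete_weights k w j"
  using assms by (auto simp: dirichlet_density_def complete_weights_def split: if_splits)

lemma complete_weights_in_simplex:
  assumes "dirichlet_density k a w \<noteq> 0" "1 \<le> k"
  shows "complete_weights k w \<in> unit_simplex k"
  using complete_weights_pos[OF assms(1)] sum_complete_weights[OF assms(2), of "\<lambda>_. 1" w]
  by (auto simp: unit_simplex_def less_imp_le) (simp add: complete_weights_def)

lemma unit_simplex_sets [measurable]: "unit_simplex k \<in> sets (PiM {1..k} (\<lambda>_. borel))"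
proof -
  have "unit_simplex k = {\<omega> \<in> space (PiM {1..k} (\<lambda>_. borel)). (\<forall>j\<in>{1..k}. 0 \<le> \<omega> j) \<and> (\<Sum>j=1..k. \<omega> j) = 1}"
    by (simp add: unit_simplex_def space_PiM PiE_def)
  also have "\<dots> \<in> sets (PiM {1..k} (\<lambda>_. borel))" by measurable
  finally show ?thesis .
qed

lemma space_dirichlet: "space (dirichlet k a) = unit_simplex k"
  unfolding dirichlet_def space_restrict_space space_distr space_PiM unit_simplex_def PiE_def by auto

lemma sets_dirichlet: "sets (dirichlet k a) = sets (restrict_space (PiM {1..k} (\<lambda>_. borel)) (unit_simplex k))"
  unfolding dirichlet_def by (rule sets_restrict_space_cong) simp

lemma measurable_dirichletI:
  "g \<in> PiM {1..k} (\<lambda>_. borel) \<rightarrow>\<^sub>M N \<Longrightarrow> g \<in> dirichlet k a \<rightarrow>\<^sub>M N"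
  by (subst measurable_cong_sets[OF sets_dirichlet refl]) (rule measurable_restrict_space1)

text \<open>Restricting to the simplex changes no integral: the density vanishes at every
  \<open>w\<close> whose completion falls outside it.\<close>

lemma nn_integral_dirichlet:
  assumes "1 \<le> k" and [measurable]: "g \<in> borel_measurable (PiM {1..k} (\<lambda>_. borel))"
  shows "(\<integral>\<^sup>+\<omega>. g \<omega> \<partial>dirichlet k a) =
    (\<integral>\<^sup>+w. ennreal (dirichlet_density k a w) * g (complete_weights k w) \<partial>PiM {1..<k} (\<lambda>_. lborel))"
proof -
  have s: "unit_simplex k \<inter> space (PiM {1..k} (\<lambda>_. borel)) = unit_simplex k"
    unfolding unit_simplex_def space_PiM PiE_def by auto
  have "(\<integral>\<^sup>+\<omega>. g \<omega> \<partial>dirichlet k a) = (\<integral>\<^sup>+w. ennreal (dirichlet_density k a w) *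
      (g (complete_weights k w) * indicator (unit_simplex k) (complete_weights k w)) \<partial>PiM {1..<k} (\<lambda>_. lborel))"
    unfolding dirichlet_def complete_weights_def[symmetric]
    by (subst nn_integral_restrict_space) (simp_all add: s nn_integral_distr nn_integral_density)
  also have "\<dots> = (\<integral>\<^sup>+w. ennreal (dirichlet_density k a w) * g (complete_weights k w) \<partial>PiM {1..<k} (\<lambda>_. lborel))"
  proof (intro nn_integral_cong)
    fix w
    show "ennreal (dirichlet_density k a w) * (g (complete_weights k w) * indicator (unit_simplex k) (complete_weights k w)) =
      ennreal (dirichlet_density k a w) * g (complete_weights k w)"
      using complete_weights_in_simplex[of k a w] assms(1)
      by (cases "dirichlet_density k a w = 0") auto
  qed
  finally show ?thesis .
qed

text \<open>The source of the independence of the total and the normalized vector. Under x = s w the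
  exponentials multiply to exp(-s), and the powers of s together with the Jacobian
  \<open>s ^ (k - 1)\<close> give the power in the gamma density of the total. Outside the open
  simplex both sides are 0.\<close>

lemma dirichlet_gamma_factorization:
  assumes k: "1 \<le> k" and a: "\<And>j. j \<in> {1..k} \<Longrightarrow> 0 < a j" and s: "0 < s"
  shows "s ^ (k - 1) * ((\<Prod>j=1..<k. gamma_density (a j) (s * w j)) * gamma_density (a k) (s * (1 - (\<Sum>j=1..<k. w j)))) =
    gamma_density (\<Sum>j=1..k. a j) s * dirichlet_density k a w"
proof (cases "(\<forall>j\<in>{1..<k}. 0 < w j) \<and> (\<Sum>j=1..<k. w j) < 1")
  case False
  then have "(\<Prod>j=1..<k. gamma_density (a j) (s * w j)) * gamma_density (a k) (s * (1 - (\<Sum>j=1..<k. w j))) = 0"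
  proof (cases "\<forall>j\<in>{1..<k}. 0 < w j")
    case True
    with False have "\<not> 0 < s * (1 - (\<Sum>j=1..<k. w j))"
      using s by (simp add: zero_less_mult_iff)
    then show ?thesis by (simp only: gamma_density_def if_False mult_zero_right)
  next
    case False
    then obtain j where j: "j \<in> {1..<k}" "\<not> 0 < w j" by blast
    then have "\<not> 0 < s * w j"
      using s by (simp add: zero_less_mult_iff)
    then have "gamma_density (a j) (s * w j) = 0" by (simp only: gamma_density_def if_False)
    with j(1) have "(\<Prod>j=1..<k. gamma_density (a j) (s * w j)) = 0"
      by (intro prod_zero) auto
    then show ?thesis by simp
  qed
  then show ?thesis using False by (auto simp: dirichlet_density_def)
next
  case True
  define v where "v = 1 - (\<Sum>j=1..<k. w j)"
  have v: "0 < v" using True by (simp add: v_def)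
  have ins: "{1..k} = insert k {1..<k}" using k by auto
  have "(\<Prod>j=1..<k. gamma_density (a j) (s * w j)) =
      (\<Prod>j=1..<k. s powr (a j - 1) * exp (- (s * w j)) * (w j powr (a j - 1) / Gamma (a j)))"
    using True s by (intro prod.cong refl) (simp add: gamma_density_def powr_mult)
  also have "\<dots> = s powr (\<Sum>j=1..<k. a j - 1) * exp (\<Sum>j=1..<k. - (s * w j)) *
      ((\<Prod>j=1..<k. w j powr (a j - 1)) / (\<Prod>j=1..<k. Gamma (a j)))"
    using s by (simp add: prod.distrib prod_dividef powr_sum exp_sum)
  finally have 1: "(\<Prod>j=1..<k. gamma_density (a j) (s * w j)) = \<dots>" .
  have 2: "gamma_density (a k) (s * v) = s powr (a k - 1) * exp (- (s * v)) * (v powr (a k - 1) / Gamma (a k))"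
    using v s by (simp add: gamma_density_def powr_mult)
  have 3: "s ^ (k - 1) * (s powr (\<Sum>j=1..<k. a j - 1) * s powr (a k - 1)) = s powr ((\<Sum>j=1..k. a j) - 1)"
  proof -
    have "s ^ (k - 1) = s powr (real k - 1)"
      using powr_realpow[OF s, of "k - 1"] k by (simp add: of_nat_diff)
    moreover have "real k - 1 + ((\<Sum>j=1..<k. a j - 1) + (a k - 1)) = (\<Sum>j=1..k. a j) - 1"
      using k by (simp add: ins sum_subtractf of_nat_diff)
    ultimately show ?thesis
      by (simp only: powr_add[symmetric])
  qed
  have 4: "exp (\<Sum>j=1..<k. - (s * w j)) * exp (- (s * v)) = exp (- s)"
  proof -
    have "(\<Sum>j=1..<k. - (s * w j)) + - (s * v) = - s"
      by (simp add: v_def sum_negf right_diff_distrib sum_distrib_left[symmetric])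
    then show ?thesis by (simp only: exp_add[symmetric])
  qed
  have "s ^ (k - 1) * ((\<Prod>j=1..<k. gamma_density (a j) (s * w j)) * gamma_density (a k) (s * v)) =
      (s ^ (k - 1) * (s powr (\<Sum>j=1..<k. a j - 1) * s powr (a k - 1))) *
      (exp (\<Sum>j=1..<k. - (s * w j)) * exp (- (s * v))) *
      ((\<Prod>j=1..<k. w j powr (a j - 1)) * v powr (a k - 1) / ((\<Prod>j=1..<k. Gamma (a j)) * Gamma (a k)))"
    unfolding 1 2 times_divide_times_eq[symmetric] by (simp only: mult.assoc mult.left_commute)
  also have "\<dots> = s powr ((\<Sum>j=1..k. a j) - 1) * exp (- s) *
      ((\<Prod>j=1..<k. w j powr (a j - 1)) * v powr (a k - 1) / (\<Prod>j=1..k. Gamma (a j)))"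
    unfolding 3 4 ins by (simp add: mult.commute)
  also have "\<dots> = gamma_density (\<Sum>j=1..k. a j) s * dirichlet_density k a w"
  proof -
    have "0 < (\<Sum>j=1..k. a j)" using a k by (intro sum_pos) auto
    then have "Gamma (\<Sum>j=1..k. a j) \<noteq> 0" using Gamma_real_pos[of "\<Sum>j=1..k. a j"] by linarith
    then show ?thesis
      unfolding gamma_density_def dirichlet_density_def v_def[symmetric] if_P[OF True] if_P[OF s]
      by simp
  qed
  finally show ?thesis unfolding v_def .
qed

definition gamma_joint :: "nat \<Rightarrow> (nat \<Rightarrow> real) \<Rightarrow> (nat \<Rightarrow> real) measure" where
  "gamma_joint k a = density (PiM {1..k} (\<lambda>_. lborel)) (\<lambda>x. ennreal (\<Prod>j=1..k. gamma_density (a j) (x j)))"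

text \<open>The normalization \<open>G / sum G\<close> of a vector of independent gamma variables has the Dirichlet law:
  substitute \<open>x\<^sub>k = s - (x\<^sub>1 + \<dots> + x\<^sub>k\<^sub>-\<^sub>1)\<close> and then \<open>x = s w\<close>.\<close>

lemma dirichlet_halfspace_eq_gamma:
  assumes k: "1 \<le> k" and a: "\<And>j. j \<in> {1..k} \<Longrightarrow> 0 < a j"
  shows "emeasure (dirichlet k a) {\<omega> \<in> space (dirichlet k a). (\<Sum>j=1..k. c j * \<omega> j) \<le> 0} =
    emeasure (gamma_joint k a) {x \<in> space (gamma_joint k a). (\<Sum>j=1..k. c j * x j) \<le> 0}"
proof -
  interpret product_sigma_finite "\<lambda>_. lborel :: real measure" ..
  let ?L = "PiM {1..<k} (\<lambda>_. lborel :: real measure)"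
  have ins: "{1..k} = insert k {1..<k}" using k by auto
  define A where "A = (\<Sum>j=1..k. a j)"
  have A: "0 < A" unfolding A_def using a k by (intro sum_pos) auto
  define I :: "real \<Rightarrow> ennreal" where "I u = indicator {..0} u" for u
  have I_meas [measurable]: "I \<in> borel_measurable borel" unfolding I_def by measurable
  \<comment> \<open>A homogeneous half space is a cone, so its indicator does not see the radius
    \<open>s\<close>. This is why the inequality must have 0 on its right-hand side.\<close>
  have I_scale: "I (s * u) = I u" if "0 < s" for s u
    using that by (simp add: I_def indicator_def mult_le_0_iff)
  define F where "F x y = ennreal ((\<Prod>j=1..<k. gamma_density (a j) (x j)) * gamma_density (a k) y) *
      I ((\<Sum>j=1..<k. c j * x j) + c k * y)" for x y
  have F_meas [measurable]: "case_prod F \<in> borel_measurable (?L \<Otimes>\<^sub>M lborel)"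
    unfolding F_def by measurable
  have [measurable]: "(\<lambda>(x, s). F x (s - (\<Sum>j=1..<k. x j))) \<in> borel_measurable (?L \<Otimes>\<^sub>M lborel)"
    unfolding F_def by measurable
  have [measurable]: "(\<lambda>y. F x y) \<in> borel_measurable borel" for x
    unfolding F_def by measurable
  have [measurable]: "(\<lambda>x. F x (s - (\<Sum>j=1..<k. x j))) \<in> borel_measurable ?L" for s
    unfolding F_def by measurable
  have "emeasure (gamma_joint k a) {x \<in> space (gamma_joint k a). (\<Sum>j=1..k. c j * x j) \<le> 0} =
      (\<integral>\<^sup>+x. ennreal (\<Prod>j=1..k. gamma_density (a j) (x j)) * I (\<Sum>j=1..k. c j * x j) \<partial>PiM {1..k} (\<lambda>_. lborel))"
    unfolding gamma_joint_def
    by (subst emeasure_density) (auto intro!: nn_integral_cong simp: I_def indicator_def)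
  also have "\<dots> = (\<integral>\<^sup>+x. \<integral>\<^sup>+y. F x y \<partial>lborel \<partial>?L)"
  proof -
    have m: "(\<lambda>x. ennreal (\<Prod>j=1..k. gamma_density (a j) (x j)) * I (\<Sum>j=1..k. c j * x j))
        \<in> borel_measurable (PiM {1..k} (\<lambda>_. lborel))"
      by measurable
    have "ennreal (\<Prod>j\<in>insert k {1..<k}. gamma_density (a j) ((x(k := y)) j)) * I (\<Sum>j\<in>insert k {1..<k}. c j * (x(k := y)) j) = F x y"
      for x y
    proof -
      have "(\<Prod>j=1..<k. gamma_density (a j) ((x(k := y)) j)) = (\<Prod>j=1..<k. gamma_density (a j) (x j))"
        "(\<Sum>j=1..<k. c j * (x(k := y)) j) = (\<Sum>j=1..<k. c j * x j)"
        by (auto intro!: prod.cong sum.cong)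
      then show ?thesis by (simp add: F_def mult.commute add.commute)
    qed
    then show ?thesis
      using product_nn_integral_insert[OF _ _ m[unfolded ins]] by (simp add: ins)
  qed
  also have "\<dots> = (\<integral>\<^sup>+x. \<integral>\<^sup>+s. F x (s - (\<Sum>j=1..<k. x j)) \<partial>lborel \<partial>?L)"
  proof (rule nn_integral_cong)
    fix x
    show "(\<integral>\<^sup>+y. F x y \<partial>lborel) = (\<integral>\<^sup>+s. F x (s - (\<Sum>j=1..<k. x j)) \<partial>lborel)"
      using nn_integral_real_affine[of "F x" 1 "- (\<Sum>j=1..<k. x j)"] by simp
  qed
  also have "\<dots> = (\<integral>\<^sup>+s. \<integral>\<^sup>+x. F x (s - (\<Sum>j=1..<k. x j)) \<partial>?L \<partial>lborel)"
    by (rule pair_sigma_finite.Fubini'[symmetric])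
       (auto intro!: pair_sigma_finite.intro sigma_finite lborel.sigma_finite_measure_axioms)
  also have "\<dots> = (\<integral>\<^sup>+s. ennreal (gamma_density A s) *
      (\<integral>\<^sup>+w. ennreal (dirichlet_density k a w) * I (\<Sum>j=1..k. c j * complete_weights k w j) \<partial>?L) \<partial>lborel)"
  proof (rule nn_integral_cong)
    fix s :: real
    show "(\<integral>\<^sup>+x. F x (s - (\<Sum>j=1..<k. x j)) \<partial>?L) = ennreal (gamma_density A s) *
      (\<integral>\<^sup>+w. ennreal (dirichlet_density k a w) * I (\<Sum>j=1..k. c j * complete_weights k w j) \<partial>?L)"
    proof (cases "0 < s")
      \<comment> \<open>For a nonpositive total both sides vanish: if the first \<open>k - 1\<close>
        coordinates are positive, the last one is \<open>s\<close> minus their sum and hence not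
        positive.\<close>
      case False
      have "F x (s - (\<Sum>j=1..<k. x j)) = 0" for x
      proof (cases "\<forall>j\<in>{1..<k}. 0 < x j")
        case True
        then have "0 \<le> (\<Sum>j=1..<k. x j)" by (intro sum_nonneg) (auto simp: less_imp_le)
        with False show ?thesis by (simp add: F_def gamma_density_def)
      next
        case False
        then have "(\<Prod>j=1..<k. gamma_density (a j) (x j)) = 0"
          by (intro prod_zero) (auto simp: gamma_density_def)
        then show ?thesis by (simp only: F_def mult_zero_left ennreal_0)
      qed
      with False show ?thesis by (simp add: gamma_density_def)
    next
      case True
      have "(\<integral>\<^sup>+x. F x (s - (\<Sum>j=1..<k. x j)) \<partial>?L) =
          ennreal (s ^ (k - 1)) * (\<integral>\<^sup>+w. F (\<lambda>j\<in>{1..<k}. s * w j) (s - (\<Sum>j=1..<k. (\<lambda>j\<in>{1..<k}. s * w j) j)) \<partial>?L)"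
        using True by (subst nn_integral_PiM_lborel_scale[where s = s]) auto
      also have "\<dots> = (\<integral>\<^sup>+w. ennreal (s ^ (k - 1)) * F (\<lambda>j\<in>{1..<k}. s * w j) (s - (\<Sum>j=1..<k. (\<lambda>j\<in>{1..<k}. s * w j) j)) \<partial>?L)"
        by (rule nn_integral_cmult[symmetric]) (simp add: F_def)
      also have "\<dots> = (\<integral>\<^sup>+w. ennreal (gamma_density A s) * (ennreal (dirichlet_density k a w) * I (\<Sum>j=1..k. c j * complete_weights k w j)) \<partial>?L)"
      proof (rule nn_integral_cong)
        fix w
        have d: "s - (\<Sum>j=1..<k. s * w j) = s * (1 - (\<Sum>j=1..<k. w j))"
          by (simp add: algebra_simps sum_distrib_left)
        have e: "(\<Sum>j=1..<k. c j * (s * w j)) + c k * (s * (1 - (\<Sum>j=1..<k. w j))) = s * (\<Sum>j=1..k. c j * complete_weights k w j)"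
          unfolding sum_complete_weights[OF k] by (simp add: algebra_simps sum_distrib_left)
        have "ennreal (s ^ (k - 1)) * F (\<lambda>j\<in>{1..<k}. s * w j) (s - (\<Sum>j=1..<k. (\<lambda>j\<in>{1..<k}. s * w j) j)) =
          ennreal (s ^ (k - 1)) * ennreal ((\<Prod>j=1..<k. gamma_density (a j) (s * w j)) * gamma_density (a k) (s * (1 - (\<Sum>j=1..<k. w j)))) *
            I (s * (\<Sum>j=1..k. c j * complete_weights k w j))"
          by (simp add: F_def d e mult.assoc)
        also have "\<dots> = ennreal (gamma_density A s * dirichlet_density k a w) * I (s * (\<Sum>j=1..k. c j * complete_weights k w j))"
        proof -
          have "ennreal (s ^ (k - 1)) * ennreal ((\<Prod>j=1..<k. gamma_density (a j) (s * w j)) * gamma_density (a k) (s * (1 - (\<Sum>j=1..<k. w j)))) =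
              ennreal (gamma_density A s * dirichlet_density k a w)"
            using dirichlet_gamma_factorization[where a = a and w = w, OF k a True] True unfolding A_def
            by (simp only: ennreal_mult'[OF zero_le_power[OF less_imp_le[OF True]], symmetric])
          then show ?thesis by (simp only:)
        qed
        finally show "ennreal (s ^ (k - 1)) * F (\<lambda>j\<in>{1..<k}. s * w j) (s - (\<Sum>j=1..<k. (\<lambda>j\<in>{1..<k}. s * w j) j)) =
          ennreal (gamma_density A s) * (ennreal (dirichlet_density k a w) * I (\<Sum>j=1..k. c j * complete_weights k w j))"
          using A by (simp add: I_scale[OF True] ennreal_mult' mult.assoc)
      qed
      also have "\<dots> = ennreal (gamma_density A s) * (\<integral>\<^sup>+w. ennreal (dirichlet_density k a w) * I (\<Sum>j=1..k. c j * complete_weights k w j) \<partial>?L)"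
        by (rule nn_integral_cmult) measurable
      finally show ?thesis .
    qed
  qed
  \<comment> \<open>The inner integral is free of \<open>s\<close>, and the gamma density of the
    total has mass 1.\<close>
  also have "\<dots> = (\<integral>\<^sup>+w. ennreal (dirichlet_density k a w) * I (\<Sum>j=1..k. c j * complete_weights k w j) \<partial>?L)"
    using A by (simp add: nn_integral_multc nn_integral_gamma_density)
  also have "\<dots> = (\<integral>\<^sup>+\<omega>. I (\<Sum>j=1..k. c j * \<omega> j) \<partial>dirichlet k a)"
    by (subst nn_integral_dirichlet[OF k]) auto
  also have "\<dots> = (\<integral>\<^sup>+\<omega>. indicator {\<omega> \<in> space (dirichlet k a). (\<Sum>j=1..k. c j * \<omega> j) \<le> 0} \<omega> \<partial>dirichlet k a)"
    by (intro nn_integral_cong) (auto simp: I_def indicator_def)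
  also have "\<dots> = emeasure (dirichlet k a) {\<omega> \<in> space (dirichlet k a). (\<Sum>j=1..k. c j * \<omega> j) \<le> 0}"
  proof (rule nn_integral_indicator)
    have [measurable]: "(\<lambda>\<omega>. \<Sum>j=1..k. c j * \<omega> j) \<in> borel_measurable (dirichlet k a)"
      by (rule measurable_dirichletI) measurable
    show "{\<omega> \<in> space (dirichlet k a). (\<Sum>j=1..k. c j * \<omega> j) \<le> 0} \<in> sets (dirichlet k a)"
      by measurable
  qed
  finally show ?thesis by simp
qed

section \<open>Characteristic functions of linear combinations of gamma variables\<close>

lemma prob_space_gamma_joint:
  assumes a: "\<And>j. j \<in> {1..k} \<Longrightarrow> 0 < a j"
  shows "prob_space (gamma_joint k a)"
proof
  interpret product_sigma_finite "\<lambda>_. lborel :: real measure" ..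
  have "emeasure (gamma_joint k a) (space (gamma_joint k a)) =
      (\<integral>\<^sup>+x. ennreal (\<Prod>j=1..k. gamma_density (a j) (x j)) \<partial>PiM {1..k} (\<lambda>_. lborel))"
    unfolding gamma_joint_def by (subst emeasure_density) (auto intro!: nn_integral_cong)
  also have "\<dots> = (\<integral>\<^sup>+x. (\<Prod>j=1..k. ennreal (gamma_density (a j) (x j))) \<partial>PiM {1..k} (\<lambda>_. lborel))"
    using a by (intro nn_integral_cong, subst prod_ennreal) auto
  also have "\<dots> = (\<Prod>j=1..k. \<integral>\<^sup>+x. ennreal (gamma_density (a j) x) \<partial>lborel)"
    by (rule product_nn_integral_prod) auto
  also have "\<dots> = 1"
    using a by (intro prod.neutral) (auto simp: nn_integral_gamma_density)
  finally show "emeasure (gamma_joint k a) (space (gamma_joint k a)) = 1" .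
qed

text \<open>With all coefficients 0 the half space is the whole space, so the total mass is
  inherited from the gamma vector and the Dirichlet integral is never evaluated.\<close>

lemma prob_space_dirichlet:
  assumes k: "1 \<le> k" and a: "\<And>j. j \<in> {1..k} \<Longrightarrow> 0 < a j"
  shows "prob_space (dirichlet k a)"
proof
  interpret G: prob_space "gamma_joint k a" using prob_space_gamma_joint[OF a] .
  show "emeasure (dirichlet k a) (space (dirichlet k a)) = 1"
    using dirichlet_halfspace_eq_gamma[where a = a and c = "\<lambda>_. 0", OF k a] G.emeasure_space_1 by simp
qed

lemma char_gamma_joint:
  assumes a: "\<And>j. j \<in> {1..k} \<Longrightarrow> 0 < a j" and t: "\<And>j. j \<in> {1..k} \<Longrightarrow> \<bar>t * c j\<bar> < 1"
  shows "char (distr (gamma_joint k a) borel (\<lambda>x. \<Sum>j=1..k. c j * x j)) t =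
    (\<Prod>j=1..k. (1 - \<i> * of_real (t * c j)) powr (- of_real (a j)))"
proof -
  interpret product_sigma_finite "\<lambda>_. lborel :: real measure" ..
  have "char (distr (gamma_joint k a) borel (\<lambda>x. \<Sum>j=1..k. c j * x j)) t =
      (CLINT x|gamma_joint k a. iexp (t * (\<Sum>j=1..k. c j * x j)))"
    unfolding char_def by (rule integral_distr) (auto simp: gamma_joint_def)
  also have "\<dots> = (CLINT x|PiM {1..k} (\<lambda>_. lborel). (\<Prod>j=1..k. gamma_density (a j) (x j)) *\<^sub>R iexp (t * (\<Sum>j=1..k. c j * x j)))"
    unfolding gamma_joint_def using a
    by (intro integral_density) (auto intro!: AE_I2 prod_nonneg)
  also have "\<dots> = (CLINT x|PiM {1..k} (\<lambda>_. lborel). (\<Prod>j=1..k. iexp (t * c j * x j) * of_real (gamma_density (a j) (x j))))"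
    by (intro Bochner_Integration.integral_cong refl)
       (simp add: prod.distrib exp_sum sum_distrib_left scaleR_conv_of_real mult_ac)
  also have "\<dots> = (\<Prod>j=1..k. CLINT x|lborel. iexp (t * c j * x) * of_real (gamma_density (a j) x))"
    using gamma_fourier(1)[OF a t] by (intro product_integral_prod) auto
  also have "\<dots> = (\<Prod>j=1..k. (1 - \<i> * of_real (t * c j)) powr (- of_real (a j)))"
    using gamma_fourier(2)[OF a t] by (intro prod.cong) auto
  finally show ?thesis .
qed

text \<open>Since the weights sum to 1, the threshold \<open>x\<close> may be multiplied by their
  sum and moved to the left, which makes the inequality homogeneous. The division by \<nu> does not
  change the event; it brings the coefficients to the scale \<open>1 / sqrt \<nu>\<close> at which
  the combination has a nontrivial limit.\<close>

lemma dirichlet_half_line_eq_gamma: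
  assumes k: "1 \<le> k" and a: "\<And>j. j \<in> {1..k} \<Longrightarrow> 0 < a j" and \<nu>: "0 < \<nu>"
  shows "cdf (distr (dirichlet k a) borel (\<lambda>\<omega>. sqrt \<nu> * (\<Sum>j=1..k. d j * \<omega> j))) x =
    cdf (distr (gamma_joint k a) borel (\<lambda>y. \<Sum>j=1..k. (d j / sqrt \<nu> - x / \<nu>) * y j)) 0"
proof -
  have m1: "(\<lambda>\<omega>. sqrt \<nu> * (\<Sum>j=1..k. d j * \<omega> j)) \<in> borel_measurable (dirichlet k a)"
    by (rule measurable_dirichletI) measurable
  have m2: "(\<lambda>y. \<Sum>j=1..k. (d j / sqrt \<nu> - x / \<nu>) * y j) \<in> borel_measurable (gamma_joint k a)"
    by (simp add: gamma_joint_def)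
  have eq: "sqrt \<nu> * (\<Sum>j=1..k. d j * \<omega> j) \<le> x \<longleftrightarrow> (\<Sum>j=1..k. (d j / sqrt \<nu> - x / \<nu>) * \<omega> j) \<le> 0"
    if "\<omega> \<in> unit_simplex k" for \<omega>
  proof -
    have "(\<Sum>j=1..k. (d j / sqrt \<nu> - x / \<nu>) * \<omega> j) = (\<Sum>j=1..k. d j * \<omega> j) / sqrt \<nu> - x / \<nu> * (\<Sum>j=1..k. \<omega> j)"
      by (simp only: sum_subtractf left_diff_distrib sum_divide_distrib sum_distrib_left times_divide_eq_left)
    also have "\<dots> = (sqrt \<nu> * (\<Sum>j=1..k. d j * \<omega> j) - x) / \<nu>"
    proof -
      have "sqrt \<nu> * (\<Sum>j=1..k. d j * \<omega> j) / \<nu> = (\<Sum>j=1..k. d j * \<omega> j) * (sqrt \<nu> / \<nu>)" by simp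
      also have "sqrt \<nu> / \<nu> = 1 / sqrt \<nu>"
        using \<nu> by (simp add: field_simps)
      finally show ?thesis using that by (simp add: unit_simplex_def diff_divide_distrib)
    qed
    finally show ?thesis using \<nu> by (simp add: divide_le_0_iff)
  qed
  have "cdf (distr (dirichlet k a) borel (\<lambda>\<omega>. sqrt \<nu> * (\<Sum>j=1..k. d j * \<omega> j))) x =
      measure (dirichlet k a) {\<omega> \<in> space (dirichlet k a). (\<Sum>j=1..k. (d j / sqrt \<nu> - x / \<nu>) * \<omega> j) \<le> 0}"
    unfolding cdf_def using m1 eq
    by (subst measure_distr) (auto intro!: arg_cong[where f = "measure _"] simp: space_dirichlet)
  also have "\<dots> = measure (gamma_joint k a) {y \<in> space (gamma_joint k a). (\<Sum>j=1..k. (d j / sqrt \<nu> - x / \<nu>) * y j) \<le> 0}"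
    unfolding measure_def using dirichlet_halfspace_eq_gamma[where a = a, OF k a] by simp
  also have "\<dots> = cdf (distr (gamma_joint k a) borel (\<lambda>y. \<Sum>j=1..k. (d j / sqrt \<nu> - x / \<nu>) * y j)) 0"
    unfolding cdf_def using m2
    by (subst measure_distr) (auto intro!: arg_cong[where f = "measure _"])
  finally show ?thesis .
qed

lemma norm_Ln_gamma_exponent:
  assumes "0 < a" "\<bar>u\<bar> \<le> 1 / 2"
  shows "norm (- of_real a * Ln (1 - \<i> * of_real u) - (\<i> * of_real (a * u) - of_real (a * u\<^sup>2 / 2))) \<le> 2 * a * \<bar>u\<bar> ^ 3"
proof -
  let ?z = "- (\<i> * complex_of_real u)"
  have z: "norm ?z = \<bar>u\<bar>" by (simp add: norm_mult)
  have "- of_real a * Ln (1 - \<i> * of_real u) - (\<i> * of_real (a * u) - of_real (a * u\<^sup>2 / 2)) =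
      - of_real a * (Ln (1 + ?z) - ?z + ?z\<^sup>2 / 2)"
    by (simp add: power_mult_distrib algebra_simps)
  then have "norm (- of_real a * Ln (1 - \<i> * of_real u) - (\<i> * of_real (a * u) - of_real (a * u\<^sup>2 / 2))) =
      a * norm (Ln (1 + ?z) - ?z + ?z\<^sup>2 / 2)"
    using assms(1) by (simp add: norm_mult)
  also have "\<dots> \<le> a * (2 * norm ?z ^ 3)"
    using assms z by (intro mult_left_mono norm_Ln_quadratic) simp_all
  finally show ?thesis unfolding z by simp
qed

text \<open>One factor of each cubic remainder is bounded by the uniform bound \<open>r\<close>, so
  the error is \<open>r\<close> times the same quadratic sum that gives the variance. No condition
  on third moments or on single shape parameters arises, and the number of bins does not
  enter.\<close>

lemma char_gamma_joint_exp:
  assumes a: "\<And>j. j \<in> {1..k} \<Longrightarrow> 0 < a j" and t: "\<And>j. j \<in> {1..k} \<Longrightarrow> \<bar>t * c j\<bar> \<le> r" and r: "r \<le> 1 / 2"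
  obtains E where "norm E \<le> 2 * r * t\<^sup>2 * (\<Sum>j=1..k. a j * (c j)\<^sup>2)"
    and "char (distr (gamma_joint k a) borel (\<lambda>x. \<Sum>j=1..k. c j * x j)) t =
      exp (\<i> * of_real (t * (\<Sum>j=1..k. a j * c j)) - of_real (t\<^sup>2 * (\<Sum>j=1..k. a j * (c j)\<^sup>2) / 2) + E)"
proof
  define e where "e j = - of_real (a j) * Ln (1 - \<i> * of_real (t * c j)) -
      (\<i> * of_real (a j * (t * c j)) - of_real (a j * (t * c j)\<^sup>2 / 2))" for j
  have "norm (\<Sum>j=1..k. e j) \<le> (\<Sum>j=1..k. 2 * r * t\<^sup>2 * (a j * (c j)\<^sup>2))"
  proof (rule sum_norm_le)
    fix j assume j: "j \<in> {1..k}"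
    have "norm (e j) \<le> 2 * a j * \<bar>t * c j\<bar> ^ 3"
      unfolding e_def using a[OF j] t[OF j] r by (intro norm_Ln_gamma_exponent) simp_all
    also have "\<dots> = 2 * a j * (\<bar>t * c j\<bar> * (t * c j)\<^sup>2)"
      by (simp add: power3_eq_cube power2_eq_square abs_mult_self_eq mult.assoc)
    also have "\<dots> \<le> 2 * a j * (r * (t * c j)\<^sup>2)"
      using a[OF j] t[OF j] by (intro mult_left_mono mult_right_mono) simp_all
    also have "\<dots> = 2 * r * t\<^sup>2 * (a j * (c j)\<^sup>2)"
      by (simp add: power_mult_distrib)
    finally show "norm (e j) \<le> 2 * r * t\<^sup>2 * (a j * (c j)\<^sup>2)" .
  qed
  then show "norm (\<Sum>j=1..k. e j) \<le> 2 * r * t\<^sup>2 * (\<Sum>j=1..k. a j * (c j)\<^sup>2)"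
    by (simp only: sum_distrib_left)
  have nz: "1 - \<i> * complex_of_real u \<noteq> 0" for u
    by (simp add: complex_eq_iff)
  have "char (distr (gamma_joint k a) borel (\<lambda>x. \<Sum>j=1..k. c j * x j)) t =
      (\<Prod>j=1..k. (1 - \<i> * of_real (t * c j)) powr (- of_real (a j)))"
  proof (rule char_gamma_joint[OF a])
    fix j assume "j \<in> {1..k}"
    then show "\<bar>t * c j\<bar> < 1" using t[of j] r by linarith
  qed
  also have "\<dots> = (\<Prod>j=1..k. exp (- of_real (a j) * Ln (1 - \<i> * of_real (t * c j))))"
    using nz by (intro prod.cong refl) (simp add: powr_def)
  also have "\<dots> = exp (\<Sum>j=1..k. - of_real (a j) * Ln (1 - \<i> * of_real (t * c j)))"
    by (simp add: exp_sum)
  also have "(\<Sum>j=1..k. - of_real (a j) * Ln (1 - \<i> * of_real (t * c j))) =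
      (\<Sum>j=1..k. (\<i> * of_real (a j * (t * c j)) - of_real (a j * (t * c j)\<^sup>2 / 2)) + e j)"
    by (simp add: e_def)
  also have "\<dots> = (\<Sum>j=1..k. \<i> * of_real (a j * (t * c j))) - (\<Sum>j=1..k. of_real (a j * (t * c j)\<^sup>2 / 2)) + (\<Sum>j=1..k. e j)"
    by (simp only: sum.distrib sum_subtractf)
  also have "(\<Sum>j=1..k. \<i> * complex_of_real (a j * (t * c j))) = \<i> * of_real (t * (\<Sum>j=1..k. a j * c j))"
    by (simp add: sum_distrib_left mult_ac)
  also have "(\<Sum>j=1..k. complex_of_real (a j * (t * c j)\<^sup>2 / 2)) = of_real (t\<^sup>2 * (\<Sum>j=1..k. a j * (c j)\<^sup>2) / 2)"
    by (simp add: sum_distrib_left sum_divide_distrib power_mult_distrib mult_ac)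
  finally show "char (distr (gamma_joint k a) borel (\<lambda>x. \<Sum>j=1..k. c j * x j)) t =
      exp (\<i> * of_real (t * (\<Sum>j=1..k. a j * c j)) - of_real (t\<^sup>2 * (\<Sum>j=1..k. a j * (c j)\<^sup>2) / 2) + (\<Sum>j=1..k. e j))" .
qed

section \<open>Gaussian limits of linear functionals of Dirichlet vectors\<close>

lemma gaussian_eq_distr:
  assumes "0 < v"
  shows "gaussian 0 v = distr std_normal_distribution borel (\<lambda>x. sqrt v * x)"
proof -
  interpret prob_space std_normal_distribution by (rule prob_space_normal_density) simp
  have "distributed std_normal_distribution lborel (\<lambda>x. x) (normal_density 0 1)"
    unfolding distributed_def by (auto simp: distr_id2 sets_eq_imp_space_eq)
  from normal_density_affine[OF this, of "sqrt v" 0]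
  have "distributed std_normal_distribution lborel (\<lambda>x. sqrt v * x) (normal_density 0 (sqrt v))"
    using assms by simp
  then have "distr std_normal_distribution lborel (\<lambda>x. sqrt v * x) = density lborel (normal_density 0 (sqrt v))"
    by (rule distributed_distr_eq_density)
  moreover have "distr std_normal_distribution borel (\<lambda>x. sqrt v * x) = distr std_normal_distribution lborel (\<lambda>x. sqrt v * x)"
    by (rule distr_cong) simp_all
  ultimately show ?thesis using assms by (simp add: gaussian_def)
qed

lemma real_distribution_gaussian: "0 \<le> v \<Longrightarrow> real_distribution (gaussian 0 v)"
proof (cases "v = 0")
  case True
  then show ?thesis
    by (simp add: gaussian_def real_distribution_def real_distribution_axioms_def prob_space_return)
next
  case False
  assume "0 \<le> v"
  with False have "0 < v" by simp
  interpret prob_space std_normal_distribution by (rule prob_space_normal_density) simp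
  show ?thesis unfolding gaussian_eq_distr[OF \<open>0 < v\<close>] by (rule real_distribution_distr) simp
qed

lemma char_gaussian:
  assumes "0 \<le> v"
  shows "char (gaussian 0 v) t = of_real (exp (- (t\<^sup>2 * v / 2)))"
proof (cases "v = 0")
  case True
  then show ?thesis by (simp add: gaussian_def char_def integral_return)
next
  case False
  with assms have v: "0 < v" by simp
  have "char (gaussian 0 v) t = char std_normal_distribution (t * sqrt v)"
    unfolding gaussian_eq_distr[OF v] char_def by (subst integral_distr) (simp_all add: mult.assoc)
  also have "\<dots> = of_real (exp (- (t\<^sup>2 * v / 2)))"
    using v by (simp add: char_std_normal_distribution power_mult_distrib)
  finally show ?thesis .
qed

text \<open>Levy continuity is applied separately for each continuity point \<open>x\<close> of the
  limit, because the coefficients \<open>c\<close> depend on it. The gamma combination converges to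
  the Gaussian law shifted by \<open>- x\<close>, and the cdf of that law at 0 is the wanted value
  at \<open>x\<close>. Asking only for continuity points lets the degenerate case
  \<open>v = 0\<close> through, where the cdf jumps at 0.\<close>

lemma weak_conv_dirichlet_linear:
  fixes k :: "nat \<Rightarrow> nat" and a d :: "nat \<Rightarrow> nat \<Rightarrow> real" and \<nu> :: "nat \<Rightarrow> real"
  assumes k: "\<And>m. 1 \<le> k m" and a: "\<And>m j. j \<in> {1..k m} \<Longrightarrow> 0 < a m j"
    and d: "\<And>m j. j \<in> {1..k m} \<Longrightarrow> \<bar>d m j\<bar> \<le> B"
    and \<nu>: "\<And>m. 0 < \<nu> m" and \<nu>_lim: "filterlim \<nu> at_top sequentially"
    and s0: "(\<lambda>m. (\<Sum>j=1..k m. a m j) / \<nu> m) \<longlonglongrightarrow> 1"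
    and s1: "(\<lambda>m. (\<Sum>j=1..k m. a m j * d m j) / sqrt (\<nu> m)) \<longlonglongrightarrow> 0"
    and s2: "(\<lambda>m. (\<Sum>j=1..k m. a m j * (d m j)\<^sup>2) / \<nu> m) \<longlonglongrightarrow> v"
    and v: "0 \<le> v"
  shows "weak_conv_m (\<lambda>m. distr (dirichlet (k m) (a m)) borel (\<lambda>\<omega>. sqrt (\<nu> m) * (\<Sum>j=1..k m. d m j * \<omega> j))) (gaussian 0 v)"
  unfolding weak_conv_m_def weak_conv_def
proof (intro allI impI)
  fix x assume cont: "isCont (cdf (gaussian 0 v)) x"
  interpret G: real_distribution "gaussian 0 v" by (rule real_distribution_gaussian[OF v])
  define c where "c m j = d m j / sqrt (\<nu> m) - x / \<nu> m" for m j
  define Z where "Z m = distr (gamma_joint (k m) (a m)) borel (\<lambda>y. \<Sum>j=1..k m. c m j * y j)" for m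
  define Z' where "Z' = distr (gaussian 0 v) borel (\<lambda>z. z - x)"
  have rd: "real_distribution (Z m)" for m
  proof -
    interpret prob_space "gamma_joint (k m) (a m)" by (rule prob_space_gamma_joint[OF a])
    show ?thesis unfolding Z_def by (rule real_distribution_distr) (simp add: gamma_joint_def)
  qed
  have rd': "real_distribution Z'"
    unfolding Z'_def by (rule G.real_distribution_distr) simp
  have inv0: "(\<lambda>m. 1 / \<nu> m) \<longlonglongrightarrow> 0"
    by (rule real_tendsto_divide_at_top[OF tendsto_const \<nu>_lim])
  have sqrt_lim: "filterlim (\<lambda>m. sqrt (\<nu> m)) at_top sequentially"
    by (rule filterlim_compose[OF sqrt_at_top \<nu>_lim])
  have invs0: "(\<lambda>m. 1 / sqrt (\<nu> m)) \<longlonglongrightarrow> 0"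
    by (rule real_tendsto_divide_at_top[OF tendsto_const sqrt_lim])
  have S1: "(\<lambda>m. \<Sum>j=1..k m. a m j * c m j) \<longlonglongrightarrow> - x"
  proof -
    have "(\<lambda>m. (\<Sum>j=1..k m. a m j * d m j) / sqrt (\<nu> m) - x * ((\<Sum>j=1..k m. a m j) / \<nu> m)) \<longlonglongrightarrow> 0 - x * 1"
      by (intro tendsto_intros s0 s1)
    moreover have "(\<Sum>j=1..k m. a m j * c m j) =
        (\<Sum>j=1..k m. a m j * d m j) / sqrt (\<nu> m) - x * ((\<Sum>j=1..k m. a m j) / \<nu> m)" for m
      by (simp add: c_def right_diff_distrib sum_subtractf sum_divide_distrib sum_distrib_left mult_ac)
    ultimately show ?thesis by simp
  qed
  \<comment> \<open>In the expanded square the mixed term and the term with \<open>x\<^sup>2\<close>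
    carry an extra factor \<open>1 / \<nu> m\<close>, so the shift by \<open>x\<close> influences
    the first moment only.\<close>
  have S2: "(\<lambda>m. \<Sum>j=1..k m. a m j * (c m j)\<^sup>2) \<longlonglongrightarrow> v"
  proof -
    have "(\<lambda>m. (\<Sum>j=1..k m. a m j * (d m j)\<^sup>2) / \<nu> m
        - 2 * x * ((\<Sum>j=1..k m. a m j * d m j) / sqrt (\<nu> m)) * (1 / \<nu> m)
        + x\<^sup>2 * ((\<Sum>j=1..k m. a m j) / \<nu> m) * (1 / \<nu> m)) \<longlonglongrightarrow> v - 2 * x * 0 * 0 + x\<^sup>2 * 1 * 0"
      by (intro tendsto_intros s0 s1 s2 inv0)
    moreover have "(\<Sum>j=1..k m. a m j * (c m j)\<^sup>2) = (\<Sum>j=1..k m. a m j * (d m j)\<^sup>2) / \<nu> m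
        - 2 * x * ((\<Sum>j=1..k m. a m j * d m j) / sqrt (\<nu> m)) * (1 / \<nu> m)
        + x\<^sup>2 * ((\<Sum>j=1..k m. a m j) / \<nu> m) * (1 / \<nu> m)" for m
    proof -
      have "a m j * (c m j)\<^sup>2 = a m j * (d m j)\<^sup>2 / \<nu> m
          - (2 * x * (1 / \<nu> m) / sqrt (\<nu> m)) * (a m j * d m j) + (x\<^sup>2 * (1 / \<nu> m) / \<nu> m) * a m j" for j
      proof -
        have "(c m j)\<^sup>2 = (d m j)\<^sup>2 / \<nu> m - 2 * (d m j / sqrt (\<nu> m)) * (x / \<nu> m) + (x / \<nu> m)\<^sup>2"
          using \<nu>[of m] by (simp add: c_def power2_diff power_divide)
        then show ?thesis by (simp add: power2_eq_square distrib_left right_diff_distrib mult_ac)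
      qed
      then show ?thesis
        by (simp only: sum.distrib sum_subtractf sum_divide_distrib[symmetric] sum_distrib_left[symmetric]) simp
    qed
    ultimately show ?thesis by simp
  qed
  have char_conv: "(\<lambda>m. char (Z m) t) \<longlonglongrightarrow> char Z' t" for t
  proof -
    define r where "r m = \<bar>t\<bar> * (B * (1 / sqrt (\<nu> m)) + \<bar>x\<bar> * (1 / \<nu> m))" for m
    have r0: "r \<longlonglongrightarrow> 0"
    proof -
      have "(\<lambda>m. \<bar>t\<bar> * (B * (1 / sqrt (\<nu> m)) + \<bar>x\<bar> * (1 / \<nu> m))) \<longlonglongrightarrow> \<bar>t\<bar> * (B * 0 + \<bar>x\<bar> * 0)"
        by (intro tendsto_intros inv0 invs0)
      then show ?thesis by (simp add: r_def[abs_def])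
    qed
    have rb: "\<bar>t * c m j\<bar> \<le> r m" if "j \<in> {1..k m}" for m j
    proof -
      have "\<bar>c m j\<bar> \<le> \<bar>d m j\<bar> / sqrt (\<nu> m) + \<bar>x\<bar> / \<nu> m"
        using abs_triangle_ineq4[of "d m j / sqrt (\<nu> m)" "x / \<nu> m"] \<nu>[of m] by (simp add: c_def)
      also have "\<dots> \<le> B / sqrt (\<nu> m) + \<bar>x\<bar> / \<nu> m"
        using d[OF that] \<nu>[of m] by (intro add_right_mono divide_right_mono) simp_all
      finally show ?thesis
        unfolding r_def abs_mult by (intro mult_left_mono) simp_all
    qed
    define L where "L m = \<i> * of_real (t * (\<Sum>j=1..k m. a m j * c m j)) - of_real (t\<^sup>2 * (\<Sum>j=1..k m. a m j * (c m j)\<^sup>2) / 2)" for m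
    \<comment> \<open>The expansion is available only once \<open>r m\<close> is at most 1/2, which
      holds eventually. The guard inside the existential allows one sequence \<open>E\<close> to be
      chosen for all \<open>m\<close>.\<close>
    have "\<exists>E. r m \<le> 1 / 2 \<longrightarrow> norm E \<le> 2 * r m * t\<^sup>2 * (\<Sum>j=1..k m. a m j * (c m j)\<^sup>2) \<and> char (Z m) t = exp (L m + E)" for m
    proof (cases "r m \<le> 1 / 2")
      case True
      obtain F where "norm F \<le> 2 * r m * t\<^sup>2 * (\<Sum>j=1..k m. a m j * (c m j)\<^sup>2)" "char (Z m) t = exp (L m + F)"
        unfolding Z_def L_def
        by (rule char_gamma_joint_exp[where k = "k m" and a = "a m" and c = "c m" and t = t and r = "r m", OF a rb True])
      then show ?thesis by blast
    qed simp
    then obtain E where E: "\<And>m. r m \<le> 1 / 2 \<Longrightarrow> norm (E m) \<le> 2 * r m * t\<^sup>2 * (\<Sum>j=1..k m. a m j * (c m j)\<^sup>2)"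
      "\<And>m. r m \<le> 1 / 2 \<Longrightarrow> char (Z m) t = exp (L m + E m)"
      by metis
    have ev: "eventually (\<lambda>m. r m \<le> 1 / 2) sequentially"
      using order_tendstoD(2)[OF r0, of "1/2"] by (auto elim: eventually_mono)
    have "(\<lambda>m. 2 * r m * t\<^sup>2 * (\<Sum>j=1..k m. a m j * (c m j)\<^sup>2)) \<longlonglongrightarrow> 2 * 0 * t\<^sup>2 * v"
      by (intro tendsto_intros r0 S2)
    then have E0: "E \<longlonglongrightarrow> 0"
      using E(1) ev by (intro Lim_null_comparison[where f = E]) (auto elim: eventually_mono)
    have "(\<lambda>m. exp (L m + E m)) \<longlonglongrightarrow> exp (\<i> * of_real (t * - x) - of_real (t\<^sup>2 * v / 2) + 0)"
      unfolding L_def by (intro tendsto_intros S1 S2 E0) simp_all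
    moreover have "char Z' t = exp (\<i> * of_real (t * - x) - of_real (t\<^sup>2 * v / 2) + 0)"
    proof -
      have "char Z' t = (CLINT z|gaussian 0 v. iexp (t * - x) * iexp (t * z))"
        unfolding Z'_def char_def by (subst integral_distr) (simp_all add: algebra_simps flip: exp_add)
      also have "\<dots> = iexp (t * - x) * char (gaussian 0 v) t"
        unfolding char_def by (rule integral_mult_right_zero)
      also have "\<dots> = exp (\<i> * of_real (t * - x) - of_real (t\<^sup>2 * v / 2) + 0)"
        unfolding char_gaussian[OF v] exp_of_real[symmetric] exp_add[symmetric] by simp
      finally show ?thesis .
    qed
    ultimately have "(\<lambda>m. exp (L m + E m)) \<longlonglongrightarrow> char Z' t" by simp
    then show ?thesis
      by (rule Lim_transform_eventually) (use ev E(2) in \<open>auto elim: eventually_mono\<close>)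
  qed
  have "weak_conv_m Z Z'"
    by (rule levy_continuity[OF rd rd' char_conv])
  then have "isCont (cdf Z') 0 \<Longrightarrow> (\<lambda>m. cdf (Z m) 0) \<longlonglongrightarrow> cdf Z' 0"
    unfolding weak_conv_m_def weak_conv_def by blast
  moreover have cdf': "cdf Z' y = cdf (gaussian 0 v) (y + x)" for y
  proof -
    have "(\<lambda>z. z - x) -` {..y} = {..y + x}" by auto
    then show ?thesis
      unfolding Z'_def cdf_def by (subst measure_distr) simp_all
  qed
  moreover have "isCont (cdf Z') 0"
  proof -
    have "isCont (\<lambda>y. cdf (gaussian 0 v) (y + x)) 0"
      by (rule isCont_o2[where g = "cdf (gaussian 0 v)"]) (use cont in simp_all)
    moreover have "cdf Z' = (\<lambda>y. cdf (gaussian 0 v) (y + x))"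
      by (rule ext) (rule cdf')
    ultimately show ?thesis by (simp only:)
  qed
  ultimately have "(\<lambda>m. cdf (Z m) 0) \<longlonglongrightarrow> cdf (gaussian 0 v) x"
    using cdf'[of 0] by simp
  then show "(\<lambda>m. cdf (distr (dirichlet (k m) (a m)) borel (\<lambda>\<omega>. sqrt (\<nu> m) * (\<Sum>j=1..k m. d m j * \<omega> j))) x)
      \<longlonglongrightarrow> cdf (gaussian 0 v) x"
    unfolding Z_def c_def using dirichlet_half_line_eq_gamma[OF k a \<nu>] by simp
qed

section \<open>The bounded Lipschitz distance and uniformity over Dirichlet parameters\<close>

text \<open>A real supremum can be compared with its members only over a set bounded above. The
  uniform bound \<open>e\<close> supplies this, and the zero test function then gives
  nonnegativity.\<close>

lemma d_BL_bounds:
  assumes "\<And>g :: real \<Rightarrow> real. (\<And>x. \<bar>g x\<bar> \<le> 1) \<Longrightarrow> 1-lipschitz_on UNIV g \<Longrightarrow> \<bar>(\<integral>x. g x \<partial>P) - (\<integral>x. g x \<partial>Q)\<bar> \<le> e"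
  shows "0 \<le> d_BL P Q" "d_BL P Q \<le> e"
proof -
  let ?F = "{g :: real \<Rightarrow> real. (\<forall>x. \<bar>g x\<bar> \<le> 1) \<and> 1-lipschitz_on UNIV g}"
  have zero: "(\<lambda>_. 0) \<in> ?F" by (simp add: lipschitz_on_def)
  have "bdd_above ((\<lambda>g. \<bar>(\<integral>x. g x \<partial>P) - (\<integral>x. g x \<partial>Q)\<bar>) ` ?F)"
    using assms by (intro bdd_aboveI2[of _ _ e]) simp
  from cSUP_upper[OF zero this] show "0 \<le> d_BL P Q"
    unfolding d_BL_def by simp
  show "d_BL P Q \<le> e"
    unfolding d_BL_def
  proof (rule cSUP_least)
    show "?F \<noteq> {}" using zero by (metis empty_iff)
  qed (simp add: assms)
qed

text \<open>The Skorohod coupling gives a bound uniform over all test functions: each changes by at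
  most \<open>min 2 \<bar>Yn n x - Y x\<bar>\<close>, which is free of \<open>g\<close> and whose
  integral tends to 0 by dominated convergence.\<close>

lemma weak_conv_imp_d_BL:
  assumes \<mu>: "\<And>n. real_distribution (\<mu> n)" and N: "real_distribution N" and conv: "weak_conv_m \<mu> N"
  shows "(\<lambda>n. d_BL (\<mu> n) N) \<longlonglongrightarrow> 0"
proof -
  from Skorohod[OF assms] obtain \<Omega> :: "real measure" and Yn :: "nat \<Rightarrow> real \<Rightarrow> real" and Y
    where \<Omega>: "prob_space \<Omega>" and Yn: "\<And>n. Yn n \<in> measurable \<Omega> borel" "\<And>n. distr \<Omega> borel (Yn n) = \<mu> n"
      and Y': "Y \<in> measurable \<Omega> lborel" and dY: "distr \<Omega> borel Y = N"
      and lim: "\<And>x. x \<in> space \<Omega> \<Longrightarrow> (\<lambda>n. Yn n x) \<longlonglongrightarrow> Y x"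
    by blast
  interpret prob_space \<Omega> by fact
  have Y: "Y \<in> borel_measurable \<Omega>" using Y' by simp
  note [measurable] = Yn(1) Y
  define e where "e n = (\<integral>x. min 2 \<bar>Yn n x - Y x\<bar> \<partial>\<Omega>)" for n
  have "e \<longlonglongrightarrow> (\<integral>x. 0 \<partial>\<Omega>)"
    unfolding e_def
  proof (rule integral_dominated_convergence[where w = "\<lambda>_. 2"])
    show "AE x in \<Omega>. (\<lambda>n. min 2 \<bar>Yn n x - Y x\<bar>) \<longlonglongrightarrow> 0"
    proof (rule AE_I2)
      fix x assume "x \<in> space \<Omega>"
      then have "(\<lambda>n. min 2 \<bar>Yn n x - Y x\<bar>) \<longlonglongrightarrow> min 2 \<bar>Y x - Y x\<bar>"
        by (intro tendsto_intros lim)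
      then show "(\<lambda>n. min 2 \<bar>Yn n x - Y x\<bar>) \<longlonglongrightarrow> 0" by simp
    qed
  qed auto
  then have e0: "e \<longlonglongrightarrow> 0" by simp
  have bound: "\<bar>(\<integral>x. g x \<partial>\<mu> n) - (\<integral>x. g x \<partial>N)\<bar> \<le> e n"
    if g: "\<And>x. \<bar>g x\<bar> \<le> 1" "1-lipschitz_on UNIV g" for g :: "real \<Rightarrow> real" and n
  proof -
    have gm [measurable]: "g \<in> borel_measurable borel"
      using lipschitz_on_continuous_on[OF g(2)] by (rule borel_measurable_continuous_onI)
    have int: "integrable \<Omega> (\<lambda>x. g (Z x))" if [measurable]: "Z \<in> borel_measurable \<Omega>" for Z
      using g(1) by (intro integrable_const_bound[where B = 1]) auto
    have "(\<integral>x. g x \<partial>\<mu> n) - (\<integral>x. g x \<partial>N) = (\<integral>x. g (Yn n x) - g (Y x) \<partial>\<Omega>)"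
      unfolding Yn(2)[symmetric] dY[symmetric]
      by (simp add: integral_distr Bochner_Integration.integral_diff int)
    also have "\<bar>\<dots>\<bar> \<le> (\<integral>x. \<bar>g (Yn n x) - g (Y x)\<bar> \<partial>\<Omega>)"
      by (rule integral_abs_bound)
    also have "\<dots> \<le> e n"
      unfolding e_def
    proof (rule integral_mono)
      show "integrable \<Omega> (\<lambda>x. \<bar>g (Yn n x) - g (Y x)\<bar>)"
        by (intro integrable_abs Bochner_Integration.integrable_diff int) auto
      show "integrable \<Omega> (\<lambda>x. min 2 \<bar>Yn n x - Y x\<bar>)"
        by (intro integrable_const_bound[where B = 2]) auto
      show "\<bar>g (Yn n x) - g (Y x)\<bar> \<le> min 2 \<bar>Yn n x - Y x\<bar>" for x
        using g(1)[of "Yn n x"] g(1)[of "Y x"] lipschitz_onD[OF g(2), of "Yn n x" "Y x"]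
        by (auto simp: dist_real_def)
    qed
    finally show ?thesis .
  qed
  show ?thesis
  proof (rule tendsto_sandwich[OF _ _ tendsto_const e0])
    show "eventually (\<lambda>n. 0 \<le> d_BL (\<mu> n) N) sequentially"
      using d_BL_bounds(1)[OF bound] by simp
    show "eventually (\<lambda>n. d_BL (\<mu> n) N \<le> e n) sequentially"
      using d_BL_bounds(2)[OF bound] by simp
  qed
qed

text \<open>Convergence in probability is stated for absolute values, so an upper bound on the
  distance has to be accompanied by this lower one.\<close>

lemma d_BL_nonneg:
  assumes "real_distribution P" "real_distribution Q"
  shows "0 \<le> d_BL P Q"
proof (rule d_BL_bounds(1)[of _ _ 2])
  interpret P: real_distribution P by fact
  interpret Q: real_distribution Q by fact
  fix g :: "real \<Rightarrow> real" assume g: "\<And>x. \<bar>g x\<bar> \<le> 1" "1-lipschitz_on UNIV g"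
  have "\<bar>\<integral>x. g x \<partial>M\<bar> \<le> 1" if "real_distribution M" for M
  proof -
    interpret M: real_distribution M by fact
    have [measurable]: "g \<in> borel_measurable borel"
      using lipschitz_on_continuous_on[OF g(2)] by (rule borel_measurable_continuous_onI)
    have int: "integrable M g"
      using g(1) by (intro M.integrable_const_bound[where B = 1]) auto
    have "\<bar>\<integral>x. g x \<partial>M\<bar> \<le> (\<integral>x. \<bar>g x\<bar> \<partial>M)" by (rule integral_abs_bound)
    also have "\<dots> \<le> (\<integral>x. 1 \<partial>M)"
      using g(1) int by (intro integral_mono) auto
    finally show ?thesis
      using M.prob_space by (simp add: sets_eq_imp_space_eq[OF M.events_eq_borel])
  qed
  from this[OF assms(1)] this[OF assms(2)]
  show "\<bar>(\<integral>x. g x \<partial>P) - (\<integral>x. g x \<partial>Q)\<bar> \<le> 2" by linarith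
qed

text \<open>The limit theorem made uniform. If every \<rho> failed, counterexamples for \<rho> =
  1/(m + 1) would form a sequence that satisfies the hypotheses of the limit theorem and yet stays
  at distance \<eta> from the Gaussian law. The same \<rho> bounds the three moment errors and,
  through \<open>1 / \<rho> \<le> \<nu>\<close>, forces \<nu> to infinity along that sequence. Since
  \<open>k\<close>, \<open>a\<close> and \<open>d\<close> are universally quantified after \<rho>,
  they may later depend on the data.\<close>

lemma dirichlet_linear_d_BL_small:
  assumes v: "0 \<le> v" and \<eta>: "0 < (\<eta>::real)"
  obtains \<rho> where "0 < \<rho>"
    and "\<And>k a d \<nu>. 1 \<le> k \<Longrightarrow> (\<And>j. j \<in> {1..k} \<Longrightarrow> 0 < a j) \<Longrightarrow> (\<And>j. j \<in> {1..k} \<Longrightarrow> \<bar>d j\<bar> \<le> B) \<Longrightarrow>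
      1 / \<rho> \<le> \<nu> \<Longrightarrow> \<bar>(\<Sum>j=1..k. a j) / \<nu> - 1\<bar> \<le> \<rho> \<Longrightarrow> \<bar>(\<Sum>j=1..k. a j * d j) / sqrt \<nu>\<bar> \<le> \<rho> \<Longrightarrow>
      \<bar>(\<Sum>j=1..k. a j * (d j)\<^sup>2) / \<nu> - v\<bar> \<le> \<rho> \<Longrightarrow>
      d_BL (distr (dirichlet k a) borel (\<lambda>\<omega>. sqrt \<nu> * (\<Sum>j=1..k. d j * \<omega> j))) (gaussian 0 v) < \<eta>"
proof -
  define good where "good \<rho> k a d \<nu> \<longleftrightarrow> 1 \<le> k \<and> (\<forall>j\<in>{1..k}. 0 < a j) \<and> (\<forall>j\<in>{1..k}. \<bar>d j\<bar> \<le> B) \<and>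
      1 / \<rho> \<le> \<nu> \<and> \<bar>(\<Sum>j=1..k. a j) / \<nu> - 1\<bar> \<le> \<rho> \<and> \<bar>(\<Sum>j=1..k. a j * d j) / sqrt \<nu>\<bar> \<le> \<rho> \<and>
      \<bar>(\<Sum>j=1..k. a j * (d j)\<^sup>2) / \<nu> - v\<bar> \<le> \<rho>" for \<rho> \<nu> :: real and k :: nat and a d :: "nat \<Rightarrow> real"
  define D where "D k a d \<nu> = distr (dirichlet k a) borel (\<lambda>\<omega>. sqrt \<nu> * (\<Sum>j=1..k. d j * \<omega> j))"
    for k :: nat and a d :: "nat \<Rightarrow> real" and \<nu> :: real
  have "\<exists>\<rho>>0. \<forall>k a d \<nu>. good \<rho> k a d \<nu> \<longrightarrow> d_BL (D k a d \<nu>) (gaussian 0 v) < \<eta>"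
  proof (rule ccontr)
    assume no: "\<not> ?thesis"
    have "\<exists>k a d \<nu>. good (1 / real (Suc m)) k a d \<nu> \<and> \<eta> \<le> d_BL (D k a d \<nu>) (gaussian 0 v)" for m
    proof -
      have "0 < 1 / real (Suc m)" by simp
      with no show ?thesis by (meson not_le)
    qed
    then obtain k a d \<nu> where g: "\<And>m. good (1 / real (Suc m)) (k m) (a m) (d m) (\<nu> m)"
      and bad: "\<And>m. \<eta> \<le> d_BL (D (k m) (a m) (d m) (\<nu> m)) (gaussian 0 v)"
      by metis
    have k: "1 \<le> k m" and a: "j \<in> {1..k m} \<Longrightarrow> 0 < a m j" and d: "j \<in> {1..k m} \<Longrightarrow> \<bar>d m j\<bar> \<le> B"
      and \<nu>: "real (Suc m) \<le> \<nu> m" and s: "\<bar>(\<Sum>j=1..k m. a m j) / \<nu> m - 1\<bar> \<le> 1 / real (Suc m)"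
      "\<bar>(\<Sum>j=1..k m. a m j * d m j) / sqrt (\<nu> m) - 0\<bar> \<le> 1 / real (Suc m)"
      "\<bar>(\<Sum>j=1..k m. a m j * (d m j)\<^sup>2) / \<nu> m - v\<bar> \<le> 1 / real (Suc m)" for m j
      using g[of m] unfolding good_def by (simp_all del: abs_divide)
    have lim: "X \<longlonglongrightarrow> l" if "\<And>m. \<bar>X m - l\<bar> \<le> 1 / real (Suc m)" for X :: "nat \<Rightarrow> real" and l
    proof (rule LIM_zero_cancel, rule Lim_null_comparison)
      show "eventually (\<lambda>m. norm (X m - l) \<le> 1 / real (Suc m)) sequentially" using that by simp
      show "(\<lambda>m. 1 / real (Suc m)) \<longlonglongrightarrow> 0" by (rule LIMSEQ_Suc[OF lim_1_over_n])
    qed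
    have \<nu>_pos: "0 < \<nu> m" for m using \<nu>[of m] by (rule less_le_trans[rotated]) simp
    have \<nu>_top: "filterlim \<nu> at_top sequentially"
    proof (rule filterlim_at_top_mono)
      show "filterlim (\<lambda>m. real (Suc m)) at_top sequentially"
        by (rule filterlim_compose[OF filterlim_real_sequentially filterlim_Suc])
    qed (use \<nu> in simp)
    have "weak_conv_m (\<lambda>m. D (k m) (a m) (d m) (\<nu> m)) (gaussian 0 v)"
      unfolding D_def by (rule weak_conv_dirichlet_linear[OF k a d \<nu>_pos \<nu>_top lim lim lim v]) (rule s | assumption)+
    moreover have "real_distribution (D (k m) (a m) (d m) (\<nu> m))" for m
    proof -
      interpret prob_space "dirichlet (k m) (a m)" by (rule prob_space_dirichlet[OF k a])
      show ?thesis unfolding D_def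
        by (intro real_distribution_distr measurable_dirichletI) measurable
    qed
    ultimately have "(\<lambda>m. d_BL (D (k m) (a m) (d m) (\<nu> m)) (gaussian 0 v)) \<longlonglongrightarrow> 0"
      by (intro weak_conv_imp_d_BL real_distribution_gaussian[OF v])
    then have "\<eta> \<le> 0"
      by (rule LIMSEQ_le_const) (use bad in blast)
    with \<eta> show False by simp
  qed
  then obtain \<rho> where "0 < \<rho>" "\<And>k a d \<nu>. good \<rho> k a d \<nu> \<Longrightarrow> d_BL (D k a d \<nu>) (gaussian 0 v) < \<eta>"
    by blast
  then show thesis
    by (intro that[of \<rho>]) (simp_all add: good_def D_def)
qed

section \<open>Bins, histograms and conjugacy\<close>

lemma bin_subset: "j \<in> {1..k} \<Longrightarrow> bin k j \<subseteq> {0..1}"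
  by (auto simp: bin_def divide_simps of_nat_diff intro: order_trans[rotated])

lemma measure_bin: "1 \<le> k \<Longrightarrow> real k * measure lborel (bin k j) = 1"
  by (simp add: bin_def divide_simps)

lemma bin_sets [measurable]: "bin k j \<in> sets borel"
  by (simp add: bin_def)

text \<open>Closed bins overlap exactly at the inner grid points. Away from the grid, the only bin
  containing \<open>x\<close> has index the ceiling of \<open>k * x\<close>.\<close>

lemma off_grid_bin:
  assumes k: "1 \<le> k" and x: "x \<in> {0..1}" "\<And>m. x \<noteq> real m / real k"
  obtains j where "j \<in> {1..k}" "\<And>i. i \<in> {1..k} \<Longrightarrow> indicator (bin k i) x = (if i = j then 1 else (0::real))"
proof -
  define j where "j = nat \<lceil>real k * x\<rceil>"
  have ne: "real k * x \<noteq> real m" for m using x(2)[of m] k by (auto simp: field_simps)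
  have x0: "0 < x" using x(1) x(2)[of 0] by (simp add: less_le)
  have jx: "real j - 1 < real k * x" "real k * x < real j"
  proof -
    have "0 < real k * x" using x0 k by simp
    then have "real j = of_int \<lceil>real k * x\<rceil>" unfolding j_def by simp
    then show "real j - 1 < real k * x" "real k * x < real j"
      using ceiling_correct[of "real k * x"] ne[of j] by (simp_all add: less_le)
  qed
  have "real k * x \<le> real k" using x(1) k by (simp add: mult_left_le)
  then have "real j < real k + 1" using jx(1) by linarith
  moreover have "0 < real k * x" using x0 k by simp
  then have "0 < real j" using jx(2) by linarith
  ultimately have j: "j \<in> {1..k}" by simp
  have "indicator (bin k i) x = (if i = j then 1 else (0::real))" if "i \<in> {1..k}" for i
  proof -
    have "x \<in> bin k i \<longleftrightarrow> real i - 1 \<le> real k * x \<and> real k * x \<le> real i"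
      using k by (simp add: bin_def divide_le_eq le_divide_eq mult.commute)
    also have "\<dots> \<longleftrightarrow> i = j"
    proof
      assume *: "real i - 1 \<le> real k * x \<and> real k * x \<le> real i"
      have "real k * x \<noteq> real (i - 1)" by (rule ne)
      then have "real i - 1 < real k * x" "real k * x < real i"
        using * ne[of i] that by (auto simp: of_nat_diff less_le)
      then show "i = j" using jx by linarith
    qed (use jx in simp)
    finally show ?thesis by (simp add: indicator_def)
  qed
  with j show thesis by (rule that)
qed

text \<open>The integrand is expanded linearly at every point; a shared endpoint is counted twice on
  both sides, so no exceptional set appears.\<close>

lemma set_integral_histogram:
  assumes h: "set_integrable lborel {0..1} h"
  shows "set_integrable lborel {0..1} (\<lambda>x. h x * histogram k \<omega> x)"
    and "(LINT x:{0..1}|lborel. h x * histogram k \<omega> x) = (\<Sum>j=1..k. real k * (LINT x:bin k j|lborel. h x) * \<omega> j)"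
proof -
  have hj: "set_integrable lborel (bin k j) h" if "j \<in> {1..k}" for j
    by (rule set_integrable_subset[OF h _ bin_subset[OF that]]) simp
  have eq: "indicator {0..1} x *\<^sub>R (h x * histogram k \<omega> x) =
      (\<Sum>j=1..k. real k * \<omega> j * (indicator (bin k j) x *\<^sub>R h x))" for x
  proof -
    have "indicator {0..1} x *\<^sub>R (h x * histogram k \<omega> x) =
        (\<Sum>j=1..k. real k * \<omega> j * h x * (indicator {0..1} x * indicator (bin k j) x))"
      by (simp only: histogram_def real_scaleR_def sum_distrib_left mult_ac)
    also have "\<dots> = (\<Sum>j=1..k. real k * \<omega> j * (indicator (bin k j) x *\<^sub>R h x))"
    proof (rule sum.cong[OF refl])
      fix j assume "j \<in> {1..k}"
      then have "indicator {0..1} x * indicator (bin k j) x = (indicator (bin k j) x :: real)"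
        using bin_subset[of j k] by (auto simp: indicator_def)
      then show "real k * \<omega> j * h x * (indicator {0..1} x * indicator (bin k j) x) =
          real k * \<omega> j * (indicator (bin k j) x *\<^sub>R h x)" by simp
    qed
    finally show ?thesis .
  qed
  show "set_integrable lborel {0..1} (\<lambda>x. h x * histogram k \<omega> x)"
    unfolding set_integrable_def eq using hj[unfolded set_integrable_def]
    by (intro Bochner_Integration.integrable_sum integrable_mult_right) auto
  show "(LINT x:{0..1}|lborel. h x * histogram k \<omega> x) = (\<Sum>j=1..k. real k * (LINT x:bin k j|lborel. h x) * \<omega> j)"
    unfolding set_lebesgue_integral_def eq using hj[unfolded set_integrable_def]
    by (subst Bochner_Integration.integral_sum) (auto intro!: integrable_mult_right simp: mult_ac)
qed

lemma is_density_histogram: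
  assumes k: "1 \<le> k" and \<omega>: "\<omega> \<in> unit_simplex k"
  shows "is_density01 (histogram k \<omega>)"
proof -
  have c: "set_integrable lborel {0..1} (\<lambda>_ :: real. 1 :: real)"
    using integrable_real_indicator[of "{0..1 :: real}" lborel] by (simp add: set_integrable_def)
  have "set_borel_measurable borel {0..1} (histogram k \<omega>)"
    unfolding set_borel_measurable_def histogram_def by measurable
  moreover have "0 \<le> histogram k \<omega> x" for x
    using \<omega> unfolding histogram_def unit_simplex_def by (auto intro!: mult_nonneg_nonneg sum_nonneg)
  moreover have "set_integrable lborel {0..1} (histogram k \<omega>)"
    using set_integral_histogram(1)[OF c, of k \<omega>] by simp
  moreover have "(LINT x:{0..1}|lborel. histogram k \<omega> x) = 1"
  proof -
    have "(LINT x:bin k j|lborel. 1) = measure lborel (bin k j)" for j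
      by (simp add: set_lebesgue_integral_def)
    then have "(LINT x:{0..1}|lborel. histogram k \<omega> x) = (\<Sum>j=1..k. \<omega> j)"
      using set_integral_histogram(2)[OF c, of k \<omega>] measure_bin[OF k] by simp
    then show ?thesis using \<omega> by (simp add: unit_simplex_def)
  qed
  ultimately show ?thesis by (simp add: is_density01_def)
qed

definition bin_counts :: "nat \<Rightarrow> nat \<Rightarrow> (nat \<Rightarrow> real) \<Rightarrow> nat \<Rightarrow> real" where
  "bin_counts k n y j = (\<Sum>i=1..n. indicator (bin k j) (y i))"

text \<open>Each observation selects the weight of its bin, and the double product is regrouped by
  bins. Positive weights matter because \<open>0 powr 0 = 0\<close>: a zero weight on an empty bin
  would annihilate the right-hand side. Such weights carry no Dirichlet mass.\<close>

lemma tempered_likelihood_histogram: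
  assumes k: "1 \<le> k" and y: "\<And>i. i \<in> {1..n} \<Longrightarrow> y i \<in> {0..1}" "\<And>i m. i \<in> {1..n} \<Longrightarrow> y i \<noteq> real m / real k"
    and \<omega>: "\<And>j. j \<in> {1..k} \<Longrightarrow> 0 < \<omega> j"
  shows "tempered_likelihood \<alpha> n y (histogram k \<omega>) =
    (real k powr \<alpha>) ^ n * (\<Prod>j=1..k. \<omega> j powr (\<alpha> * bin_counts k n y j))"
proof -
  have "histogram k \<omega> (y i) powr \<alpha> = real k powr \<alpha> * (\<Prod>j=1..k. \<omega> j powr (\<alpha> * indicator (bin k j) (y i)))"
    if i: "i \<in> {1..n}" for i
  proof -
    obtain j where j: "j \<in> {1..k}" "\<And>i'. i' \<in> {1..k} \<Longrightarrow> indicator (bin k i') (y i) = (if i' = j then 1 else (0::real))"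
      using off_grid_bin[OF k y(1)[OF i] y(2)[OF i]] by metis
    have "(\<Sum>l=1..k. \<omega> l * indicator (bin k l) (y i)) = (\<Sum>l=1..k. if l = j then \<omega> l else 0)"
      by (intro sum.cong refl) (simp add: j)
    moreover have "(\<Prod>l=1..k. \<omega> l powr (\<alpha> * indicator (bin k l) (y i))) = (\<Prod>l=1..k. if l = j then \<omega> l powr \<alpha> else 1)"
      using \<omega> by (intro prod.cong refl) (force simp: j)
    ultimately show ?thesis
      using j(1) k \<omega>[OF j(1)] by (simp add: histogram_def powr_mult)
  qed
  then have "tempered_likelihood \<alpha> n y (histogram k \<omega>) =
      (real k powr \<alpha>) ^ n * (\<Prod>i=1..n. \<Prod>j=1..k. \<omega> j powr (\<alpha> * indicator (bin k j) (y i)))"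
    by (simp add: tempered_likelihood_def prod.distrib)
  also have "(\<Prod>i=1..n. \<Prod>j=1..k. \<omega> j powr (\<alpha> * indicator (bin k j) (y i))) =
      (\<Prod>j=1..k. \<Prod>i=1..n. \<omega> j powr (\<alpha> * indicator (bin k j) (y i)))"
    by (rule prod.swap)
  also have "\<dots> = (\<Prod>j=1..k. \<omega> j powr (\<alpha> * bin_counts k n y j))"
  proof (rule prod.cong[OF refl])
    fix j assume "j \<in> {1..k}"
    then have "\<omega> j \<noteq> 0" using \<omega>[of j] by simp
    then show "(\<Prod>i=1..n. \<omega> j powr (\<alpha> * indicator (bin k j) (y i))) = \<omega> j powr (\<alpha> * bin_counts k n y j)"
      unfolding bin_counts_def sum_distrib_left by (rule powr_sum[symmetric])
  qed
  finally show ?thesis .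
qed

lemma dirichlet_density_eq_complete_weights:
  assumes k: "1 \<le> k" and w: "\<forall>j\<in>{1..<k}. 0 < w j" "(\<Sum>j=1..<k. w j) < 1"
  shows "dirichlet_density k a w =
    Gamma (\<Sum>j=1..k. a j) / (\<Prod>j=1..k. Gamma (a j)) * (\<Prod>j=1..k. complete_weights k w j powr (a j - 1))"
proof -
  have "{1..k} = insert k {1..<k}" using k by auto
  then have "(\<Prod>j=1..k. complete_weights k w j powr (a j - 1)) =
      (1 - (\<Sum>j=1..<k. w j)) powr (a k - 1) * (\<Prod>j=1..<k. w j powr (a j - 1))"
    by (simp add: complete_weights_def)
  then show ?thesis using w by (simp add: dirichlet_density_def)
qed

text \<open>\<open>C\<close> is the evidence, that is the integral of the tempered likelihood under
  the prior: the power of \<open>k\<close> from the histogram heights times the ratio of the two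
  Dirichlet normalizers. Its being positive and finite is what allows the posterior to be
  normalized.\<close>

lemma dirichlet_conjugacy:
  assumes k: "1 \<le> k" and \<delta>: "\<And>j. j \<in> {1..k} \<Longrightarrow> 0 < \<delta> j" and \<alpha>: "0 \<le> \<alpha>"
    and y: "\<And>i. i \<in> {1..n} \<Longrightarrow> y i \<in> {0..1}" "\<And>i m. i \<in> {1..n} \<Longrightarrow> y i \<noteq> real m / real k"
  obtains C where "0 < C" and "\<And>G. G \<in> borel_measurable (PiM {1..k} (\<lambda>_. borel)) \<Longrightarrow>
    (\<integral>\<^sup>+\<omega>. ennreal (tempered_likelihood \<alpha> n y (histogram k \<omega>)) * G \<omega> \<partial>dirichlet k \<delta>) =
    ennreal C * (\<integral>\<^sup>+\<omega>. G \<omega> \<partial>dirichlet k (\<lambda>j. \<delta> j + \<alpha> * bin_counts k n y j))"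
proof -
  define a where "a j = \<delta> j + \<alpha> * bin_counts k n y j" for j
  have "0 \<le> bin_counts k n y j" for j by (simp add: bin_counts_def sum_nonneg)
  then have a: "0 < a j" if "j \<in> {1..k}" for j
    using \<delta>[OF that] \<alpha> by (simp add: a_def add_pos_nonneg)
  define g where "g b = Gamma (\<Sum>j=1..k. b j) / (\<Prod>j=1..k. Gamma (b j))" for b :: "nat \<Rightarrow> real"
  have g: "0 < g b" if "\<And>j. j \<in> {1..k} \<Longrightarrow> 0 < b j" for b
  proof -
    have "0 < (\<Sum>j=1..k. b j)" using that k by (intro sum_pos) auto
    then have "0 < Gamma (\<Sum>j=1..k. b j)" by (rule Gamma_real_pos)
    moreover have "0 < (\<Prod>j=1..k. Gamma (b j))" using that by (intro prod_pos ballI Gamma_real_pos)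
    ultimately show ?thesis by (simp add: g_def)
  qed
  define C where "C = (real k powr \<alpha>) ^ n * g \<delta> / g a"
  have C: "0 < C" using g[where b = \<delta>, OF \<delta>] g[where b = a, OF a] k by (simp add: C_def)
  let ?L = "\<lambda>\<omega>. tempered_likelihood \<alpha> n y (histogram k \<omega>)"
  have Lm [measurable]: "?L \<in> borel_measurable (PiM {1..k} (\<lambda>_. borel))"
    unfolding tempered_likelihood_def histogram_def by measurable
  have key: "dirichlet_density k \<delta> w * ?L (complete_weights k w) = C * dirichlet_density k a w" for w
  proof (cases "(\<forall>j\<in>{1..<k}. 0 < w j) \<and> (\<Sum>j=1..<k. w j) < 1")
    case False
    then have "dirichlet_density k b w = 0" for b
      unfolding dirichlet_density_def by (simp only: if_False)
    then show ?thesis by simp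
  next
    case True
    then have pos: "0 < complete_weights k w j" if "j \<in> {1..k}" for j
      using that by (auto simp: complete_weights_def)
    have "dirichlet_density k \<delta> w * ?L (complete_weights k w) =
        g \<delta> * (real k powr \<alpha>) ^ n * ((\<Prod>j=1..k. complete_weights k w j powr (\<delta> j - 1)) *
        (\<Prod>j=1..k. complete_weights k w j powr (\<alpha> * bin_counts k n y j)))"
      using True tempered_likelihood_histogram[where \<omega> = "complete_weights k w" and \<alpha> = \<alpha>, OF k y pos]
      by (simp add: dirichlet_density_eq_complete_weights[OF k] g_def)
    also have "(\<Prod>j=1..k. complete_weights k w j powr (\<delta> j - 1)) *
        (\<Prod>j=1..k. complete_weights k w j powr (\<alpha> * bin_counts k n y j)) =
        (\<Prod>j=1..k. complete_weights k w j powr (a j - 1))"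
      unfolding prod.distrib[symmetric] by (intro prod.cong refl) (simp add: a_def algebra_simps flip: powr_add)
    also have "g \<delta> * (real k powr \<alpha>) ^ n * (\<Prod>j=1..k. complete_weights k w j powr (a j - 1)) = C * dirichlet_density k a w"
      using True g[where b = a, OF a] by (simp add: dirichlet_density_eq_complete_weights[OF k] C_def flip: g_def)
    finally show ?thesis .
  qed
  have "(\<integral>\<^sup>+\<omega>. ennreal (?L \<omega>) * G \<omega> \<partial>dirichlet k \<delta>) = ennreal C * (\<integral>\<^sup>+\<omega>. G \<omega> \<partial>dirichlet k a)"
    if [measurable]: "G \<in> borel_measurable (PiM {1..k} (\<lambda>_. borel))" for G
  proof -
    have "(\<integral>\<^sup>+\<omega>. ennreal (?L \<omega>) * G \<omega> \<partial>dirichlet k \<delta>) =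
        (\<integral>\<^sup>+w. ennreal (dirichlet_density k \<delta> w) * (ennreal (?L (complete_weights k w)) * G (complete_weights k w)) \<partial>PiM {1..<k} (\<lambda>_. lborel))"
      by (rule nn_integral_dirichlet[OF k]) measurable
    also have "\<dots> = (\<integral>\<^sup>+w. ennreal C * (ennreal (dirichlet_density k a w) * G (complete_weights k w)) \<partial>PiM {1..<k} (\<lambda>_. lborel))"
    proof (rule nn_integral_cong)
      fix w
      have "ennreal (dirichlet_density k \<delta> w) * ennreal (?L (complete_weights k w)) = ennreal C * ennreal (dirichlet_density k a w)"
        using key[of w] C dirichlet_density_nonneg[where a = \<delta> and w = w, OF k \<delta>]
        by (simp add: ennreal_mult'[symmetric])
      then show "ennreal (dirichlet_density k \<delta> w) * (ennreal (?L (complete_weights k w)) * G (complete_weights k w)) =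
          ennreal C * (ennreal (dirichlet_density k a w) * G (complete_weights k w))"
        by (simp only: mult.assoc[symmetric])
    qed
    also have "\<dots> = ennreal C * (\<integral>\<^sup>+w. ennreal (dirichlet_density k a w) * G (complete_weights k w) \<partial>PiM {1..<k} (\<lambda>_. lborel))"
      by (rule nn_integral_cmult) measurable
    also have "(\<integral>\<^sup>+w. ennreal (dirichlet_density k a w) * G (complete_weights k w) \<partial>PiM {1..<k} (\<lambda>_. lborel)) = (\<integral>\<^sup>+\<omega>. G \<omega> \<partial>dirichlet k a)"
      by (rule nn_integral_dirichlet[OF k that, symmetric])
    finally show ?thesis .
  qed
  with C show thesis unfolding a_def by (intro that[of C]) auto
qed

text \<open>Preimages commute with complements and countable unions, so the collection in the
  definition is already a \<sigma>-algebra and generating from it adds nothing.\<close>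

lemma sets_random_histogram:
  "sets (random_histogram k \<delta>) = {B. histogram k -` B \<inter> space (dirichlet k \<delta>) \<in> sets (dirichlet k \<delta>)}"
proof -
  let ?S = "{B. histogram k -` B \<inter> space (dirichlet k \<delta>) \<in> sets (dirichlet k \<delta>)}"
  have "sigma_algebra UNIV ?S"
  proof (rule sigma_algebra_iff2[THEN iffD2], intro conjI ballI allI impI)
    fix B assume "B \<in> ?S"
    moreover have "histogram k -` (UNIV - B) \<inter> space (dirichlet k \<delta>) =
        space (dirichlet k \<delta>) - histogram k -` B \<inter> space (dirichlet k \<delta>)" by auto
    ultimately show "UNIV - B \<in> ?S" by simp
  next
    fix A :: "nat \<Rightarrow> (real \<Rightarrow> real) set" assume "range A \<subseteq> ?S"
    then have "(\<Union>i. histogram k -` A i \<inter> space (dirichlet k \<delta>)) \<in> sets (dirichlet k \<delta>)"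
      by (intro sets.countable_UN) auto
    moreover have "histogram k -` (\<Union>i. A i) \<inter> space (dirichlet k \<delta>) =
        (\<Union>i. histogram k -` A i \<inter> space (dirichlet k \<delta>))" by auto
    ultimately show "(\<Union>i. A i) \<in> ?S" by simp
  qed auto
  then show ?thesis
    unfolding random_histogram_def sets_distr by (simp add: sigma_algebra.sigma_sets_eq)
qed

lemma space_random_histogram: "space (random_histogram k \<delta>) = UNIV"
  by (simp add: random_histogram_def space_measure_of_conv)

lemma measurable_random_histogramI:
  assumes "(\<lambda>\<omega>. \<phi> (histogram k \<omega>)) \<in> dirichlet k \<delta> \<rightarrow>\<^sub>M borel"
  shows "\<phi> \<in> random_histogram k \<delta> \<rightarrow>\<^sub>M borel"
proof (rule measurableI)
  fix A :: "'a set" assume "A \<in> sets borel"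
  from measurable_sets[OF assms this]
  show "\<phi> -` A \<inter> space (random_histogram k \<delta>) \<in> sets (random_histogram k \<delta>)"
    by (simp add: sets_random_histogram space_random_histogram vimage_def)
qed simp

lemma nn_integral_random_histogram:
  assumes "(\<lambda>\<omega>. \<phi> (histogram k \<omega>)) \<in> borel_measurable (dirichlet k \<delta>)"
  shows "(\<integral>\<^sup>+f. \<phi> f \<partial>random_histogram k \<delta>) = (\<integral>\<^sup>+\<omega>. \<phi> (histogram k \<omega>) \<partial>dirichlet k \<delta>)"
proof -
  let ?R = "sigma UNIV {B. histogram k -` B \<inter> space (dirichlet k \<delta>) \<in> sets (dirichlet k \<delta>)}"
  have s: "sets ?R = sets (random_histogram k \<delta>)" by (simp add: random_histogram_def)
  have "histogram k \<in> dirichlet k \<delta> \<rightarrow>\<^sub>M ?R"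
  proof (rule measurableI)
    fix A assume "A \<in> sets ?R"
    then show "histogram k -` A \<inter> space (dirichlet k \<delta>) \<in> sets (dirichlet k \<delta>)"
      unfolding s sets_random_histogram by simp
  qed (simp add: space_measure_of_conv)
  moreover have "\<phi> \<in> borel_measurable ?R"
    using measurable_random_histogramI[OF assms] unfolding measurable_cong_sets[OF s refl] .
  ultimately show ?thesis
    unfolding random_histogram_def by (simp add: nn_integral_distr)
qed

text \<open>The functional \<phi> is linked to a measurable \<theta> only on histograms with weights
  in the simplex. This is enough, as the posterior is an image of a law on the simplex, and it suits
  a \<psi> that is an arbitrary function elsewhere.\<close>

lemma distr_posterior_histogram:
  assumes k: "1 \<le> k" and \<delta>: "\<And>j. j \<in> {1..k} \<Longrightarrow> 0 < \<delta> j" and \<alpha>: "0 \<le> \<alpha>"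
    and y: "\<And>i. i \<in> {1..n} \<Longrightarrow> y i \<in> {0..1}" "\<And>i m. i \<in> {1..n} \<Longrightarrow> y i \<noteq> real m / real k"
    and \<phi>: "\<And>\<omega>. \<omega> \<in> unit_simplex k \<Longrightarrow> \<phi> (histogram k \<omega>) = \<theta> \<omega>"
    and \<theta> [measurable]: "\<theta> \<in> borel_measurable (PiM {1..k} (\<lambda>_. borel))"
  shows "distr (posterior \<alpha> (random_histogram k \<delta>) n y) borel \<phi> =
    distr (dirichlet k (\<lambda>j. \<delta> j + \<alpha> * bin_counts k n y j)) borel (\<theta> :: _ \<Rightarrow> real)"
proof (rule measure_eqI)
  let ?a = "\<lambda>j. \<delta> j + \<alpha> * bin_counts k n y j"
  let ?L = "\<lambda>\<omega>. tempered_likelihood \<alpha> n y (histogram k \<omega>)"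
  let ?P = "PiM {1..k} (\<lambda>_. borel) :: (nat \<Rightarrow> real) measure"
  fix A assume "A \<in> sets (distr (posterior \<alpha> (random_histogram k \<delta>) n y) borel \<phi>)"
  then have A [measurable]: "A \<in> sets borel" by simp
  obtain C where C: "0 < C" and conj: "\<And>G. G \<in> borel_measurable ?P \<Longrightarrow>
      (\<integral>\<^sup>+\<omega>. ennreal (?L \<omega>) * G \<omega> \<partial>dirichlet k \<delta>) = ennreal C * (\<integral>\<^sup>+\<omega>. G \<omega> \<partial>dirichlet k ?a)"
    by (rule dirichlet_conjugacy[where \<delta> = \<delta> and y = y and n = n, OF k \<delta> \<alpha> y]) blast+
  have "0 \<le> bin_counts k n y j" for j by (simp add: bin_counts_def sum_nonneg)
  then have a: "0 < ?a j" if "j \<in> {1..k}" for j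
    using \<delta>[OF that] \<alpha> by (simp add: add_pos_nonneg)
  interpret Da: prob_space "dirichlet k ?a" by (rule prob_space_dirichlet[OF k a])
  have Lm [measurable]: "?L \<in> borel_measurable ?P"
    unfolding tempered_likelihood_def histogram_def by measurable
  have LD: "?L \<in> borel_measurable (dirichlet k \<delta>)" by (rule measurable_dirichletI) measurable
  have \<phi>D: "(\<lambda>\<omega>. \<phi> (histogram k \<omega>)) \<in> borel_measurable (dirichlet k \<delta>)"
    using measurable_dirichletI[OF \<theta>]
    by (rule measurable_cong[THEN iffD1, rotated]) (simp add: space_dirichlet \<phi>)
  have \<phi>m: "\<phi> \<in> borel_measurable (random_histogram k \<delta>)"
    by (rule measurable_random_histogramI[OF \<phi>D])
  have lm: "tempered_likelihood \<alpha> n y \<in> borel_measurable (random_histogram k \<delta>)"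
    by (rule measurable_random_histogramI[OF LD])
  \<comment> \<open>Conjugacy with the constant function 1 identifies the denominator of the
    posterior as \<open>C\<close>; being neither 0 nor infinite, it cancels in the extended
    reals.\<close>
  have Z: "(\<integral>\<^sup>+g. ennreal (tempered_likelihood \<alpha> n y g) \<partial>random_histogram k \<delta>) = ennreal C"
    using conj[of "\<lambda>_. 1"] LD Da.emeasure_space_1 by (subst nn_integral_random_histogram) auto
  have "emeasure (distr (posterior \<alpha> (random_histogram k \<delta>) n y) borel \<phi>) A =
      emeasure (posterior \<alpha> (random_histogram k \<delta>) n y) (\<phi> -` A \<inter> space (random_histogram k \<delta>))"
    using \<phi>m by (subst emeasure_distr) (simp_all add: posterior_def)
  also have "\<dots> = (\<integral>\<^sup>+f. ennreal (tempered_likelihood \<alpha> n y f) / ennreal C * indicator A (\<phi> f) \<partial>random_histogram k \<delta>)"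
    unfolding posterior_def Z using lm \<phi>m
    by (subst emeasure_density) (auto intro!: nn_integral_cong split: split_indicator)
  also have "\<dots> = (\<integral>\<^sup>+\<omega>. ennreal (?L \<omega>) / ennreal C * indicator A (\<phi> (histogram k \<omega>)) \<partial>dirichlet k \<delta>)"
  proof (rule nn_integral_random_histogram)
    note Lm [measurable del] and LD [measurable] and \<phi>D [measurable]
    show "(\<lambda>\<omega>. ennreal (?L \<omega>) / ennreal C * indicator A (\<phi> (histogram k \<omega>))) \<in> borel_measurable (dirichlet k \<delta>)"
      by measurable
  qed
  also have "\<dots> = (\<integral>\<^sup>+\<omega>. ennreal (?L \<omega>) * (indicator A (\<theta> \<omega>) / ennreal C) \<partial>dirichlet k \<delta>)"
    by (intro nn_integral_cong) (simp add: space_dirichlet \<phi> divide_ennreal_def mult_ac)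
  also have "\<dots> = ennreal C * (\<integral>\<^sup>+\<omega>. indicator A (\<theta> \<omega>) / ennreal C \<partial>dirichlet k ?a)"
    by (rule conj) measurable
  also have "\<dots> = ennreal C * ((\<integral>\<^sup>+\<omega>. indicator A (\<theta> \<omega>) \<partial>dirichlet k ?a) / ennreal C)"
    by (subst nn_integral_divide) (auto intro!: measurable_dirichletI)
  also have "\<dots> = (\<integral>\<^sup>+\<omega>. indicator A (\<theta> \<omega>) \<partial>dirichlet k ?a)"
    using C by (simp add: ennreal_times_divide mult.commute[of "ennreal C"] ennreal_mult_divide_eq)
  also have "\<dots> = emeasure (distr (dirichlet k ?a) borel \<theta>) A"
  proof -
    have "\<theta> \<in> borel_measurable (dirichlet k ?a)" by (rule measurable_dirichletI) fact
    then show ?thesis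
      by (subst nn_integral_distr[symmetric, of \<theta> _ borel "indicator A"]) simp_all
  qed
  finally show "emeasure (distr (posterior \<alpha> (random_histogram k \<delta>) n y) borel \<phi>) A =
    emeasure (distr (dirichlet k ?a) borel \<theta>) A" .
qed simp

section \<open>Projections on histograms\<close>

text \<open>All grids are handled together: their union is countable, so a single null set serves
  every number of bins.\<close>

lemma AE_off_grid: "AE x in lborel. \<forall>k m. x \<noteq> real m / real k"
proof -
  have "countable (range (\<lambda>(m, k). real m / real k))" by simp
  then have "range (\<lambda>(m, k). real m / real k) \<in> null_sets lborel"
    by (rule countable_imp_null_set_lborel)
  then have "AE x in lborel. x \<notin> range (\<lambda>(m, k). real m / real k)"
    by (rule AE_not_in)
  then show ?thesis
    by (rule eventually_mono) force
qed

lemma bin_proj_eq_histogram: "bin_proj k h = histogram k (\<lambda>j. LINT u:bin k j|lborel. h u)"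
  by (simp add: bin_proj_def histogram_def fun_eq_iff)

lemma histogram_measurable [measurable]: "histogram k \<omega> \<in> borel_measurable borel"
  unfolding histogram_def by measurable

lemma bin_proj_measurable [measurable]: "bin_proj k h \<in> borel_measurable borel"
  unfolding bin_proj_eq_histogram by measurable

lemma bin_proj_off_grid:
  assumes k: "1 \<le> k" and x: "x \<in> {0..1}" "\<And>m. x \<noteq> real m / real k"
  obtains j where "j \<in> {1..k}" "x \<in> bin k j" "\<And>\<omega>. histogram k \<omega> x = real k * \<omega> j"
    "\<And>h. bin_proj k h x = real k * (LINT u:bin k j|lborel. h u)"
proof -
  obtain j where j: "j \<in> {1..k}" "\<And>i. i \<in> {1..k} \<Longrightarrow> indicator (bin k i) x = (if i = j then 1 else (0::real))"
    using off_grid_bin[OF k x] by metis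
  have "x \<in> bin k j" using j(2)[OF j(1)] by (simp add: indicator_eq_1_iff)
  moreover have *: "histogram k \<omega> x = real k * \<omega> j" for \<omega>
  proof -
    have "(\<Sum>i=1..k. \<omega> i * indicator (bin k i) x) = (\<Sum>i=1..k. if i = j then \<omega> i else 0)"
      by (intro sum.cong refl) (simp add: j)
    then show ?thesis using j(1) by (simp add: histogram_def)
  qed
  ultimately show thesis using j(1) by (intro that) (simp_all add: bin_proj_eq_histogram)
qed

lemma set_integrable_bounded01:
  fixes h :: "real \<Rightarrow> real"
  assumes "set_borel_measurable borel {0..1} h" "\<And>x. x \<in> {0..1} \<Longrightarrow> \<bar>h x\<bar> \<le> B"
  shows "set_integrable lborel {0..1} h"
  unfolding set_integrable_def
proof (rule Bochner_Integration.integrable_bound)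
  show "integrable lborel (\<lambda>x. B * indicator {0..1 :: real} x)"
    by (intro integrable_mult_right integrable_real_indicator) simp_all
  show "(\<lambda>x. indicator {0..1} x *\<^sub>R h x) \<in> borel_measurable lborel"
    using assms(1) by (simp add: set_borel_measurable_def)
  show "AE x in lborel. norm (indicator {0..1} x *\<^sub>R h x) \<le> norm (B * indicator {0..1} x)"
    using assms(2) by (intro AE_I2) (auto simp: indicator_def intro: order_trans[OF _ abs_ge_self])
qed

text \<open>The free centre \<open>c\<close> has two uses: \<open>c = 0\<close> shows that averaging
  preserves a bound, and \<open>c = g x\<close> bounds the error of averaging by the oscillation of
  \<open>g\<close> on one bin.\<close>

lemma bin_average_diff_le:
  assumes k: "1 \<le> k" and j: "j \<in> {1..k}" and h: "set_integrable lborel {0..1} h"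
    and le: "\<And>u. u \<in> bin k j \<Longrightarrow> \<bar>h u - c\<bar> \<le> e"
  shows "\<bar>real k * (LINT u:bin k j|lborel. h u) - c\<bar> \<le> e"
proof -
  have hj: "set_integrable lborel (bin k j) h"
    by (rule set_integrable_subset[OF h _ bin_subset[OF j]]) simp
  have "emeasure lborel (bin k j) < \<infinity>"
    unfolding bin_def by (rule emeasure_bounded_finite) simp
  then have cst: "set_integrable lborel (bin k j) (\<lambda>_. b)" for b :: real
    unfolding set_integrable_def by (intro integrable_scaleR_left integrable_real_indicator) simp_all
  have int_cst: "(LINT u:bin k j|lborel. b) = measure lborel (bin k j) * b" for b :: real
    by (simp add: set_lebesgue_integral_def)
  have "(LINT u:bin k j|lborel. h u) \<le> (LINT u:bin k j|lborel. c + e)"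
    using le by (intro set_integral_mono hj cst) (fastforce simp: abs_le_iff)
  moreover have "(LINT u:bin k j|lborel. c - e) \<le> (LINT u:bin k j|lborel. h u)"
    using le by (intro set_integral_mono hj cst) (fastforce simp: abs_le_iff)
  ultimately have "real k * (measure lborel (bin k j) * (c - e)) \<le> real k * (LINT u:bin k j|lborel. h u)"
    "real k * (LINT u:bin k j|lborel. h u) \<le> real k * (measure lborel (bin k j) * (c + e))"
    unfolding int_cst by (intro mult_left_mono; simp)+
  then show ?thesis
    unfolding mult.assoc[symmetric] measure_bin[OF k] by simp
qed

lemma bin_proj_bounded:
  assumes k: "1 \<le> k" and x: "x \<in> {0..1}" "\<And>m. x \<noteq> real m / real k"
    and h: "set_integrable lborel {0..1} h" "\<And>x. x \<in> {0..1} \<Longrightarrow> \<bar>h x\<bar> \<le> B"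
  shows "\<bar>bin_proj k h x\<bar> \<le> B"
proof -
  obtain j where j: "j \<in> {1..k}" "\<And>h. bin_proj k h x = real k * (LINT u:bin k j|lborel. h u)"
    using bin_proj_off_grid[OF k x] by metis
  show ?thesis
    using bin_average_diff_le[OF k j(1) h(1), of 0 B] h(2)[OF subsetD[OF bin_subset[OF j(1)]]] by (simp add: j(2))
qed

lemma bin_proj_set_integrable: "set_integrable lborel {0..1} (bin_proj k h)"
proof -
  have "set_integrable lborel {0..1} (\<lambda>_ :: real. 1 :: real)"
    by (simp add: set_integrable_def integrable_real_indicator)
  from set_integral_histogram(1)[OF this] show ?thesis
    by (simp add: bin_proj_eq_histogram)
qed

text \<open>On each bin the absolute value of an average is at most the average of the absolute
  value, and integration undoes the averaging.\<close>

lemma bin_proj_L1_contraction: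
  assumes k: "1 \<le> k" and u: "set_integrable lborel {0..1} u"
  shows "(LINT x:{0..1}|lborel. \<bar>bin_proj k u x\<bar>) \<le> (LINT x:{0..1}|lborel. \<bar>u x\<bar>)"
proof -
  let ?v = "\<lambda>j. LINT x:bin k j|lborel. \<bar>u x\<bar>"
  have c: "set_integrable lborel {0..1} (\<lambda>_ :: real. 1 :: real)"
    by (simp add: set_integrable_def integrable_real_indicator)
  have uj: "set_integrable lborel (bin k j) u" if "j \<in> {1..k}" for j
    by (rule set_integrable_subset[OF u _ bin_subset[OF that]]) simp
  have "(LINT x:{0..1}|lborel. \<bar>bin_proj k u x\<bar>) \<le> (LINT x:{0..1}|lborel. 1 * histogram k ?v x)"
  proof (rule set_integral_mono)
    show "set_integrable lborel {0..1} (\<lambda>x. \<bar>bin_proj k u x\<bar>)"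
      by (rule set_integrable_abs[OF bin_proj_set_integrable])
    show "set_integrable lborel {0..1} (\<lambda>x. 1 * histogram k ?v x)"
      by (rule set_integral_histogram(1)[OF c])
    fix x
    have "\<bar>LINT u':bin k j|lborel. u u'\<bar> \<le> ?v j" if "j \<in> {1..k}" for j
      using set_integral_norm_bound[OF uj[OF that]] by simp
    then have "real k * (\<Sum>j=1..k. \<bar>LINT u':bin k j|lborel. u u'\<bar> * indicator (bin k j) x) \<le> histogram k ?v x"
      unfolding histogram_def by (intro mult_left_mono sum_mono mult_right_mono) auto
    moreover have "\<bar>bin_proj k u x\<bar> \<le> real k * (\<Sum>j=1..k. \<bar>LINT u':bin k j|lborel. u u'\<bar> * indicator (bin k j) x)"
      unfolding bin_proj_def abs_mult
      by (intro mult_mono order_trans[OF sum_abs]) (auto simp: abs_mult intro!: sum_mono)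
    ultimately show "\<bar>bin_proj k u x\<bar> \<le> 1 * histogram k ?v x" by simp
  qed
  also have "\<dots> = (\<Sum>j=1..k. real k * (LINT x:bin k j|lborel. 1) * ?v j)"
    by (rule set_integral_histogram(2)[OF c])
  also have "\<dots> = (\<Sum>j=1..k. ?v j)"
  proof -
    have "(LINT x:bin k j|lborel. 1) = measure lborel (bin k j)" for j
      by (simp add: set_lebesgue_integral_def)
    then show ?thesis using measure_bin[OF k] by simp
  qed
  \<comment> \<open>The integrals over the bins are glued together by integrating against the
    histogram with equal weights, which is 1 off the grid; the overlaps of the closed bins are
    absorbed there.\<close>
  also have "\<dots> = (\<Sum>j=1..k. real k * ?v j * (1 / real k))"
    using k by simp
  also have "\<dots> = (LINT x:{0..1}|lborel. \<bar>u x\<bar> * histogram k (\<lambda>_. 1 / real k) x)"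
    by (rule set_integral_histogram(2)[OF set_integrable_abs[OF u], symmetric])
  also have "\<dots> = (LINT x:{0..1}|lborel. \<bar>u x\<bar>)"
    unfolding set_lebesgue_integral_def
  proof (rule integral_cong_AE)
    show "(\<lambda>x. indicator {0..1} x *\<^sub>R (\<bar>u x\<bar> * histogram k (\<lambda>_. 1 / real k) x)) \<in> borel_measurable lborel"
      using set_integral_histogram(1)[OF set_integrable_abs[OF u]] by (auto simp: set_integrable_def)
    show "(\<lambda>x. indicator {0..1} x *\<^sub>R \<bar>u x\<bar>) \<in> borel_measurable lborel"
      using set_integrable_abs[OF u] by (auto simp: set_integrable_def)
    show "AE x in lborel. indicator {0..1} x *\<^sub>R (\<bar>u x\<bar> * histogram k (\<lambda>_. 1 / real k) x) = indicator {0..1} x *\<^sub>R \<bar>u x\<bar>"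
      using AE_off_grid
    proof eventually_elim
      fix x assume x: "\<forall>k m. x \<noteq> real m / real k"
      show "indicator {0..1} x *\<^sub>R (\<bar>u x\<bar> * histogram k (\<lambda>_. 1 / real k) x) = indicator {0..1} x *\<^sub>R \<bar>u x\<bar>"
      proof (cases "x \<in> {0..1}")
        case True
        obtain j where "histogram k (\<lambda>_. 1 / real k) x = real k * (1 / real k)"
          using bin_proj_off_grid[OF k True] x by metis
        then show ?thesis using k by simp
      qed simp
    qed
  qed
  finally show ?thesis .
qed

text \<open>A measurable function is an almost everywhere limit of continuous ones. Truncating these
  at -B and B preserves continuity and the limit, and supplies the dominating function.\<close>

lemma continuous_L1_approx:
  assumes h: "set_borel_measurable borel {0..1} h" "\<And>x. x \<in> {0..1} \<Longrightarrow> \<bar>h x\<bar> \<le> (B :: real)" and e: "0 < e"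
  obtains g where "continuous_on UNIV g" "(LINT x:{0..1::real}|lborel. \<bar>h x - g x\<bar>) < e"
proof -
  define h' where "h' x = indicator {0..1} x * h x" for x :: real
  have h'm: "h' \<in> borel_measurable borel"
    using h(1) by (simp add: set_borel_measurable_def h'_def[abs_def])
  have B: "0 \<le> B" using h(2)[of 0] by simp
  have h'B: "\<bar>h' x\<bar> \<le> B" for x using h(2)[of x] B by (simp add: h'_def indicator_def)
  have "h' measurable_on UNIV"
    using h'm by (intro lebesgue_measurable_imp_measurable_on_real) (auto intro: measurable_completion)
  then obtain N g where N: "negligible N" and g: "\<And>n. continuous_on UNIV (g n)"
    and lim: "\<And>x. x \<notin> N \<Longrightarrow> (\<lambda>n. g n x) \<longlonglongrightarrow> h' x"
    unfolding measurable_on_def by auto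
  define g' where "g' n x = max (- B) (min B (g n x))" for n and x :: real
  have g'c: "continuous_on UNIV (g' n)" for n
    unfolding g'_def by (intro continuous_intros g)
  have g'm [measurable]: "g' n \<in> borel_measurable borel" for n
    by (rule borel_measurable_continuous_onI[OF g'c])
  note [measurable] = h'm
  have g'B: "\<bar>g' n x\<bar> \<le> B" for n x using B by (simp add: g'_def abs_le_iff)
  have ae: "AE x in lborel. x \<notin> N"
  proof -
    have "N \<in> null_sets (completion lborel)" using N by (simp add: negligible_iff_null_sets)
    then have "AE x in completion lborel. x \<notin> N" by (rule AE_not_in)
    then show ?thesis by (simp add: AE_completion_iff)
  qed
  have "(\<lambda>n. \<integral>x. indicator {0..1} x * \<bar>h' x - g' n x\<bar> \<partial>lborel) \<longlonglongrightarrow> (\<integral>x. 0 \<partial>(lborel :: real measure))"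
  proof (rule integral_dominated_convergence[where w = "\<lambda>x. 2 * B * indicator {0..1 :: real} x"])
    show "integrable lborel (\<lambda>x. 2 * B * indicator {0..1 :: real} x)"
      by (intro integrable_mult_right integrable_real_indicator) simp_all
    show "AE x in lborel. (\<lambda>n. indicator {0..1} x * \<bar>h' x - g' n x\<bar>) \<longlonglongrightarrow> 0"
      using ae
    proof eventually_elim
      fix x assume "x \<notin> N"
      then have "(\<lambda>n. indicator {0..1} x * \<bar>h' x - g' n x\<bar>) \<longlonglongrightarrow> indicator {0..1} x * \<bar>h' x - max (- B) (min B (h' x))\<bar>"
        unfolding g'_def by (intro tendsto_intros lim)
      moreover have "max (- B) (min B (h' x)) = h' x" using h'B[of x] by (simp add: abs_le_iff)
      ultimately show "(\<lambda>n. indicator {0..1} x * \<bar>h' x - g' n x\<bar>) \<longlonglongrightarrow> 0" by simp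
    qed
    show "AE x in lborel. norm (indicator {0..1} x * \<bar>h' x - g' n x\<bar>) \<le> 2 * B * indicator {0..1} x" for n
    proof (rule AE_I2)
      fix x
      have "\<bar>h' x - g' n x\<bar> \<le> 2 * B" using h'B[of x] g'B[of n x] by linarith
      then show "norm (indicator {0..1} x * \<bar>h' x - g' n x\<bar>) \<le> 2 * B * indicator {0..1} x"
        by (simp add: indicator_def)
    qed
  qed measurable
  then have "(\<lambda>n. \<integral>x. indicator {0..1} x * \<bar>h' x - g' n x\<bar> \<partial>lborel) \<longlonglongrightarrow> 0" by simp
  from order_tendstoD(2)[OF this e] obtain n where n: "(\<integral>x. indicator {0..1} x * \<bar>h' x - g' n x\<bar> \<partial>lborel) < e"
    by (auto simp: eventually_sequentially)
  have "(LINT x:{0..1}|lborel. \<bar>h x - g' n x\<bar>) = (\<integral>x. indicator {0..1} x * \<bar>h' x - g' n x\<bar> \<partial>lborel)"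
    unfolding set_lebesgue_integral_def
    by (intro Bochner_Integration.integral_cong refl) (simp add: h'_def indicator_def)
  with n g'c show thesis by (intro that[of "g' n"]) simp_all
qed

lemma bin_proj_diff:
  assumes "set_integrable lborel {0..1} h" "set_integrable lborel {0..1} g"
  shows "bin_proj k (\<lambda>u. h u - g u) x = bin_proj k h x - bin_proj k g x"
proof -
  have "(LINT u:bin k j|lborel. h u - g u) = (LINT u:bin k j|lborel. h u) - (LINT u:bin k j|lborel. g u)"
    if j: "j \<in> {1..k}" for j
  proof (rule set_integral_diff)
    show "set_integrable lborel (bin k j) h" "set_integrable lborel (bin k j) g"
      by (rule set_integrable_subset[OF _ _ bin_subset[OF j]], use assms in simp_all)+
  qed
  then have "(\<Sum>j=1..k. (LINT u:bin k j|lborel. h u - g u) * indicator (bin k j) x) =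
      (\<Sum>j=1..k. (LINT u:bin k j|lborel. h u) * indicator (bin k j) x - (LINT u:bin k j|lborel. g u) * indicator (bin k j) x)"
    by (intro sum.cong refl) (simp add: left_diff_distrib)
  then show ?thesis
    unfolding bin_proj_def by (simp add: sum_subtractf right_diff_distrib)
qed

text \<open>With P the projection and g a continuous approximation, Ph - h splits into P(h - g), g -
  h and Pg - g. The first is controlled by the contraction, the second by the choice of g, the third
  by uniform continuity on bins of length 1/k; each contributes at most e/4.\<close>

lemma bin_proj_L1_tendsto:
  assumes h: "set_borel_measurable borel {0..1} h" "\<And>x. x \<in> {0..1} \<Longrightarrow> \<bar>h x\<bar> \<le> B"
  shows "(\<lambda>k. LINT x:{0..1}|lborel. \<bar>bin_proj k h x - h x\<bar>) \<longlonglongrightarrow> 0"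
proof (rule LIMSEQ_I)
  fix e :: real assume e: "0 < e"
  obtain g where g: "continuous_on UNIV g" "(LINT x:{0..1::real}|lborel. \<bar>h x - g x\<bar>) < e / 4"
    using continuous_L1_approx[OF h, of "e / 4"] e by (metis zero_less_divide_iff zero_less_numeral)
  have hi: "set_integrable lborel {0..1} h" by (rule set_integrable_bounded01[OF h])
  have gi: "set_integrable lborel {0..1} g"
    unfolding set_integrable_def
    by (rule borel_integrable_compact) (use g(1) in \<open>auto intro: continuous_on_subset\<close>)
  have di: "set_integrable lborel {0..1} (\<lambda>x. h x - g x)" by (rule set_integral_diff(1)[OF hi gi])
  have "uniformly_continuous_on {0..1} g"
    by (rule compact_uniformly_continuous) (use g(1) in \<open>auto intro: continuous_on_subset\<close>)
  then obtain d where d: "0 < d" "\<And>x y. x \<in> {0..1} \<Longrightarrow> y \<in> {0..1} \<Longrightarrow> dist y x < d \<Longrightarrow> dist (g y) (g x) < e / 4"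
    unfolding uniformly_continuous_on_def using e by (metis zero_less_divide_iff zero_less_numeral)
  obtain k0 where k0: "1 / real (Suc k0) < d" using nat_approx_posE[OF d(1)] by auto
  have "norm ((LINT x:{0..1}|lborel. \<bar>bin_proj k h x - h x\<bar>) - 0) < e" if k: "Suc k0 \<le> k" for k
  proof -
    have k1: "1 \<le> k" using k by simp
    have kd: "1 / real k < d"
    proof -
      have "1 / real k \<le> 1 / real (Suc k0)" using k by (intro divide_left_mono) auto
      then show ?thesis using k0 by linarith
    qed
    have abs_i: "set_integrable lborel {0..1} (\<lambda>x. \<bar>bin_proj k (\<lambda>u. h u - g u) x\<bar>)"
      "set_integrable lborel {0..1} (\<lambda>x. \<bar>h x - g x\<bar>)"
      by (rule set_integrable_abs[OF bin_proj_set_integrable], rule set_integrable_abs[OF di])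
    have c: "set_integrable lborel {0..1} (\<lambda>_ :: real. e / 4)"
      unfolding set_integrable_def by (intro integrable_scaleR_left integrable_real_indicator) simp_all
    have "(LINT x:{0..1}|lborel. \<bar>bin_proj k h x - h x\<bar>) \<le>
        (LINT x:{0..1}|lborel. (\<bar>bin_proj k (\<lambda>u. h u - g u) x\<bar> + \<bar>h x - g x\<bar>) + e / 4)"
      unfolding set_lebesgue_integral_def
    proof (rule integral_mono_AE)
      show "integrable lborel (\<lambda>x. indicator {0..1} x *\<^sub>R \<bar>bin_proj k h x - h x\<bar>)"
        using set_integrable_abs[OF set_integral_diff(1)[OF bin_proj_set_integrable hi]] by (simp add: set_integrable_def)
      show "integrable lborel (\<lambda>x. indicator {0..1} x *\<^sub>R ((\<bar>bin_proj k (\<lambda>u. h u - g u) x\<bar> + \<bar>h x - g x\<bar>) + e / 4))"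
        using set_integral_add(1)[OF set_integral_add(1)[OF abs_i] c] by (simp add: set_integrable_def)
      show "AE x in lborel. indicator {0..1} x *\<^sub>R \<bar>bin_proj k h x - h x\<bar>
          \<le> indicator {0..1} x *\<^sub>R ((\<bar>bin_proj k (\<lambda>u. h u - g u) x\<bar> + \<bar>h x - g x\<bar>) + e / 4)"
        using AE_off_grid
      proof eventually_elim
        fix x assume x: "\<forall>k m. x \<noteq> real m / real k"
        have pg: "\<bar>bin_proj k g x - g x\<bar> \<le> e / 4" if x01: "x \<in> {0..1}"
        proof -
          obtain j where j: "j \<in> {1..k}" "x \<in> bin k j" "bin_proj k g x = real k * (LINT u:bin k j|lborel. g u)"
            using bin_proj_off_grid[OF k1 x01] x by metis
          have "\<bar>g u - g x\<bar> \<le> e / 4" if u: "u \<in> bin k j" for u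
          proof -
            have "dist u x \<le> 1 / real k"
              using u j(2) by (auto simp: bin_def dist_real_def abs_le_iff diff_divide_distrib)
            then have "dist (g u) (g x) < e / 4"
              using d(2)[OF x01, of u] u bin_subset[OF j(1)] kd by auto
            then show ?thesis by (simp add: dist_real_def)
          qed
          then show ?thesis unfolding j(3) by (rule bin_average_diff_le[OF k1 j(1) gi])
        qed
        show "indicator {0..1} x *\<^sub>R \<bar>bin_proj k h x - h x\<bar>
            \<le> indicator {0..1} x *\<^sub>R ((\<bar>bin_proj k (\<lambda>u. h u - g u) x\<bar> + \<bar>h x - g x\<bar>) + e / 4)"
        proof (cases "x \<in> {0..1}")
          case True
          have "\<bar>bin_proj k g x - g x\<bar> \<le> e / 4" by (rule pg[OF True])
          then have "\<bar>bin_proj k h x - h x\<bar> \<le> (\<bar>bin_proj k (\<lambda>u. h u - g u) x\<bar> + \<bar>h x - g x\<bar>) + e / 4"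
            unfolding bin_proj_diff[OF hi gi] by linarith
          then show ?thesis unfolding indicator_simps(1)[OF True] real_scaleR_def mult_1 .
        qed simp
      qed
    qed
    also have "\<dots> = (LINT x:{0..1}|lborel. \<bar>bin_proj k (\<lambda>u. h u - g u) x\<bar>) + (LINT x:{0..1}|lborel. \<bar>h x - g x\<bar>) + (LINT x:{0..1::real}|lborel. e / 4)"
      by (subst set_integral_add(2)[OF set_integral_add(1)[OF abs_i] c], subst set_integral_add(2)[OF abs_i]) simp
    also have "(LINT x:{0..1::real}|lborel. e / 4) = e / 4"
      by (simp add: set_lebesgue_integral_def)
    finally have "(LINT x:{0..1}|lborel. \<bar>bin_proj k h x - h x\<bar>) < e"
      using bin_proj_L1_contraction[OF k1 di] g(2) e by linarith
    moreover have "0 \<le> (LINT x:{0..1}|lborel. \<bar>bin_proj k h x - h x\<bar>)"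
      unfolding set_lebesgue_integral_def by (intro integral_nonneg_AE AE_I2) simp
    ultimately show ?thesis by simp
  qed
  then show "\<exists>k0. \<forall>k\<ge>k0. norm ((LINT x:{0..1}|lborel. \<bar>bin_proj k h x - h x\<bar>) - 0) < e" by blast
qed

text \<open>A difference of squares is a sum times a difference. The sum is at most 2B off the grid
  and the density at most C, which leaves the L1 distance. This is where boundedness of the true
  density enters.\<close>

lemma bin_proj_second_moment_tendsto:
  assumes h: "set_borel_measurable borel {0..1} h" "\<And>x. x \<in> {0..1} \<Longrightarrow> \<bar>h x\<bar> \<le> B"
    and f: "set_borel_measurable borel {0..1} f" "\<And>x. x \<in> {0..1} \<Longrightarrow> 0 \<le> f x" "\<And>x. x \<in> {0..1} \<Longrightarrow> f x \<le> C"
  shows "(\<lambda>k. LINT x:{0..1}|lborel. f x * (bin_proj k h x)\<^sup>2) \<longlonglongrightarrow> (LINT x:{0..1}|lborel. f x * (h x)\<^sup>2)"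
proof (rule LIM_zero_cancel, rule Lim_null_comparison)
  have hi: "set_integrable lborel {0..1} h" by (rule set_integrable_bounded01[OF h])
  have fm: "(\<lambda>x. indicator {0..1} x * f x) \<in> borel_measurable borel"
    and hm: "(\<lambda>x. indicator {0..1} x * h x) \<in> borel_measurable borel"
    using f(1) h(1) by (simp_all add: set_borel_measurable_def)
  show "eventually (\<lambda>k. norm ((LINT x:{0..1}|lborel. f x * (bin_proj k h x)\<^sup>2) - (LINT x:{0..1}|lborel. f x * (h x)\<^sup>2))
      \<le> 2 * B * C * (LINT x:{0..1}|lborel. \<bar>bin_proj k h x - h x\<bar>)) sequentially"
  proof (rule eventually_sequentiallyI)
    fix k :: nat assume k: "1 \<le> k"
    have p: "\<bar>bin_proj k h x\<bar> \<le> B" if "x \<in> {0..1}" "\<forall>k m. x \<noteq> real m / real k" for x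
      using that by (intro bin_proj_bounded[OF k _ _ hi h(2)]) auto
    have C: "0 \<le> C" using f(2,3)[of 0] by simp
    have B: "0 \<le> B" using h(2)[of 0] by simp
    have i0: "integrable lborel (\<lambda>x. C * B\<^sup>2 * indicator {0..1 :: real} x)"
      by (intro integrable_mult_right integrable_real_indicator) simp_all
    have sq: "f x * q\<^sup>2 \<le> C * B\<^sup>2" if "x \<in> {0..1}" "\<bar>q\<bar> \<le> B" for x q
      using f(2,3)[OF that(1)] that(2) C power_mono[OF that(2) abs_ge_zero, of 2] by (intro mult_mono) simp_all
    have i1: "set_integrable lborel {0..1} (\<lambda>x. f x * (bin_proj k h x)\<^sup>2)"
      unfolding set_integrable_def
    proof (rule Bochner_Integration.integrable_bound[OF i0])
      have "(\<lambda>x. (indicator {0..1} x * f x) * (bin_proj k h x)\<^sup>2) \<in> borel_measurable borel"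
        using fm by measurable
      then show "(\<lambda>x. indicator {0..1} x *\<^sub>R (f x * (bin_proj k h x)\<^sup>2)) \<in> borel_measurable lborel"
        by (simp add: mult.assoc)
      show "AE x in lborel. norm (indicator {0..1} x *\<^sub>R (f x * (bin_proj k h x)\<^sup>2)) \<le> norm (C * B\<^sup>2 * indicator {0..1} x)"
        using AE_off_grid
      proof eventually_elim
        fix x assume x: "\<forall>k m. x \<noteq> real m / real k"
        show "norm (indicator {0..1} x *\<^sub>R (f x * (bin_proj k h x)\<^sup>2)) \<le> norm (C * B\<^sup>2 * indicator {0..1} x)"
          using sq[of x "bin_proj k h x"] p[of x] x f(2)[of x] C by (cases "x \<in> {0..1}") simp_all
      qed
    qed
    have i2: "set_integrable lborel {0..1} (\<lambda>x. f x * (h x)\<^sup>2)"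
      unfolding set_integrable_def
    proof (rule Bochner_Integration.integrable_bound[OF i0])
      have "(\<lambda>x. (indicator {0..1} x * f x) * (indicator {0..1} x * h x)\<^sup>2) \<in> borel_measurable borel"
        using fm hm by measurable
      also have "(\<lambda>x. (indicator {0..1} x * f x) * (indicator {0..1} x * h x)\<^sup>2) = (\<lambda>x. indicator {0..1} x *\<^sub>R (f x * (h x)\<^sup>2))"
        by (auto simp: indicator_def fun_eq_iff)
      finally show "(\<lambda>x. indicator {0..1} x *\<^sub>R (f x * (h x)\<^sup>2)) \<in> borel_measurable lborel" by simp
      show "AE x in lborel. norm (indicator {0..1} x *\<^sub>R (f x * (h x)\<^sup>2)) \<le> norm (C * B\<^sup>2 * indicator {0..1} x)"
      proof (rule AE_I2)
        fix x :: real
        show "norm (indicator {0..1} x *\<^sub>R (f x * (h x)\<^sup>2)) \<le> norm (C * B\<^sup>2 * indicator {0..1} x)"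
          using sq[of x "h x"] h(2)[of x] f(2)[of x] C by (cases "x \<in> {0..1}") simp_all
      qed
    qed
    have i3: "set_integrable lborel {0..1} (\<lambda>x. 2 * B * C * \<bar>bin_proj k h x - h x\<bar>)"
      by (intro set_integrable_mult_right set_integrable_abs set_integral_diff(1) bin_proj_set_integrable hi)
    have "\<bar>(LINT x:{0..1}|lborel. f x * (bin_proj k h x)\<^sup>2) - (LINT x:{0..1}|lborel. f x * (h x)\<^sup>2)\<bar> =
        \<bar>LINT x:{0..1}|lborel. f x * (bin_proj k h x)\<^sup>2 - f x * (h x)\<^sup>2\<bar>"
      by (simp only: set_integral_diff(2)[OF i1 i2])
    also have "\<dots> \<le> (LINT x:{0..1}|lborel. \<bar>f x * (bin_proj k h x)\<^sup>2 - f x * (h x)\<^sup>2\<bar>)"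
      using set_integral_norm_bound[OF set_integral_diff(1)[OF i1 i2]] by simp
    also have "\<dots> \<le> (LINT x:{0..1}|lborel. 2 * B * C * \<bar>bin_proj k h x - h x\<bar>)"
      unfolding set_lebesgue_integral_def
    proof (rule integral_mono_AE)
      show "integrable lborel (\<lambda>x. indicator {0..1} x *\<^sub>R \<bar>f x * (bin_proj k h x)\<^sup>2 - f x * (h x)\<^sup>2\<bar>)"
        using set_integrable_abs[OF set_integral_diff(1)[OF i1 i2]] by (simp add: set_integrable_def)
      show "integrable lborel (\<lambda>x. indicator {0..1} x *\<^sub>R (2 * B * C * \<bar>bin_proj k h x - h x\<bar>))"
        using i3 by (simp add: set_integrable_def)
      show "AE x in lborel. indicator {0..1} x *\<^sub>R \<bar>f x * (bin_proj k h x)\<^sup>2 - f x * (h x)\<^sup>2\<bar> \<le>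
          indicator {0..1} x *\<^sub>R (2 * B * C * \<bar>bin_proj k h x - h x\<bar>)"
        using AE_off_grid
      proof eventually_elim
        fix x assume x: "\<forall>k m. x \<noteq> real m / real k"
        have "\<bar>f x * (bin_proj k h x)\<^sup>2 - f x * (h x)\<^sup>2\<bar> \<le> 2 * B * C * \<bar>bin_proj k h x - h x\<bar>" if x01: "x \<in> {0..1}"
        proof -
          have "f x * (bin_proj k h x)\<^sup>2 - f x * (h x)\<^sup>2 = f x * ((bin_proj k h x + h x) * (bin_proj k h x - h x))"
            by (simp add: power2_eq_square algebra_simps)
          then have "\<bar>f x * (bin_proj k h x)\<^sup>2 - f x * (h x)\<^sup>2\<bar> = f x * (\<bar>bin_proj k h x + h x\<bar> * \<bar>bin_proj k h x - h x\<bar>)"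
            using f(2)[OF x01] by (simp add: abs_mult)
          also have "\<dots> \<le> C * ((2 * B) * \<bar>bin_proj k h x - h x\<bar>)"
            using f(2,3)[OF x01] C p[OF x01 x] h(2)[OF x01] by (intro mult_mono) auto
          finally show ?thesis by (simp add: mult_ac)
        qed
        then show "indicator {0..1} x *\<^sub>R \<bar>f x * (bin_proj k h x)\<^sup>2 - f x * (h x)\<^sup>2\<bar> \<le>
          indicator {0..1} x *\<^sub>R (2 * B * C * \<bar>bin_proj k h x - h x\<bar>)"
          by (cases "x \<in> {0..1}") simp_all
      qed
    qed
    also have "\<dots> = 2 * B * C * (LINT x:{0..1}|lborel. \<bar>bin_proj k h x - h x\<bar>)"
      by (simp add: set_lebesgue_integral_def mult.left_commute)
    finally show "norm ((LINT x:{0..1}|lborel. f x * (bin_proj k h x)\<^sup>2) - (LINT x:{0..1}|lborel. f x * (h x)\<^sup>2))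
      \<le> 2 * B * C * (LINT x:{0..1}|lborel. \<bar>bin_proj k h x - h x\<bar>)" by simp
  qed
  have "(\<lambda>k. 2 * B * C * (LINT x:{0..1}|lborel. \<bar>bin_proj k h x - h x\<bar>)) \<longlonglongrightarrow> 2 * B * C * 0"
    by (intro tendsto_intros bin_proj_L1_tendsto[OF h])
  then show "(\<lambda>k. 2 * B * C * (LINT x:{0..1}|lborel. \<bar>bin_proj k h x - h x\<bar>)) \<longlonglongrightarrow> 0" by simp
qed

section \<open>Law of large numbers for arrays and the posterior at fixed data\<close>

text \<open>The summands change with \<open>n\<close>, as the projection does through the number of
  bins, so a law for one fixed sequence would not apply. Hoeffding's inequality depends only on the
  range of the summands, which is uniform in \<open>n\<close>.\<close>

lemma (in prob_space) bounded_array_lln: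
  fixes Y :: "nat \<Rightarrow> 'a \<Rightarrow> real" and g :: "nat \<Rightarrow> real \<Rightarrow> real"
  assumes indep: "indep_vars (\<lambda>_. borel) Y {1..}" and g: "\<And>n. g n \<in> borel_measurable borel"
    and bound: "\<And>n i. 1 \<le> n \<Longrightarrow> 1 \<le> i \<Longrightarrow> AE w in M. \<bar>g n (Y i w)\<bar> \<le> B"
    and mean: "\<And>n i. 1 \<le> n \<Longrightarrow> 1 \<le> i \<Longrightarrow> expectation (\<lambda>w. g n (Y i w)) = \<mu> n" and e: "0 < e"
  shows "(\<lambda>n. emeasure M {w \<in> space M. e \<le> \<bar>(1 / real n) * (\<Sum>i=1..n. g n (Y i w)) - \<mu> n\<bar>}) \<longlonglongrightarrow> 0"
proof -
  \<comment> \<open>Adding 1 makes the range \<open>{- b..b}\<close> nondegenerate for every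
    \<open>B\<close>, as the division by \<open>b\<close> squared in the exponent requires.\<close>
  define b where "b = \<bar>B\<bar> + 1"
  have b: "0 < b" by (simp add: b_def)
  let ?p = "\<lambda>n. prob {w \<in> space M. e \<le> \<bar>(1 / real n) * (\<Sum>i=1..n. g n (Y i w)) - \<mu> n\<bar>}"
  have hoeffding: "?p n \<le> 2 * exp (- (e\<^sup>2 / (2 * b\<^sup>2)) * real n)" if n: "1 \<le> n" for n
  proof -
    have "indep_vars (\<lambda>_. borel) (\<lambda>i w. g n (Y i w)) {1..n}"
      by (rule indep_vars_compose2[OF indep_vars_subset[OF indep]]) (use g in auto)
    moreover have "AE w in M. g n (Y i w) \<in> {- b..b}" if "i \<in> {1..n}" for i
      using bound[OF n, of i] that by (auto simp: b_def elim!: eventually_mono)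
    ultimately interpret H: Hoeffding_ineq M "{1..n}" "\<lambda>i w. g n (Y i w)" "\<lambda>_. - b" "\<lambda>_. b"
        "\<Sum>i=1..n. expectation (\<lambda>w. g n (Y i w))"
      by unfold_locales simp_all
    have m: "(\<Sum>i=1..n. expectation (\<lambda>w. g n (Y i w))) = real n * \<mu> n"
      using n by (simp add: mean)
    have s: "(\<Sum>i=1..n. (b - - b)\<^sup>2) = real n * (4 * b\<^sup>2)"
      by (simp add: power2_eq_square)
    have "prob {w \<in> space M. real n * e \<le> \<bar>(\<Sum>i=1..n. g n (Y i w)) - real n * \<mu> n\<bar>} \<le>
        2 * exp (- 2 * (real n * e)\<^sup>2 / (real n * (4 * b\<^sup>2)))"
      using H.Hoeffding_ineq_abs_ge[of "real n * e"] n b e unfolding m s by simp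
    also have "- 2 * (real n * e)\<^sup>2 / (real n * (4 * b\<^sup>2)) = - (e\<^sup>2 / (2 * b\<^sup>2)) * real n"
      using n b by (simp add: power2_eq_square field_simps)
    also have "{w \<in> space M. real n * e \<le> \<bar>(\<Sum>i=1..n. g n (Y i w)) - real n * \<mu> n\<bar>} =
        {w \<in> space M. e \<le> \<bar>(1 / real n) * (\<Sum>i=1..n. g n (Y i w)) - \<mu> n\<bar>}"
    proof -
      have "real n * e \<le> \<bar>S - real n * \<mu> n\<bar> \<longleftrightarrow> e \<le> \<bar>(1 / real n) * S - \<mu> n\<bar>" for S
      proof -
        have "\<bar>S - real n * \<mu> n\<bar> = real n * \<bar>(1 / real n) * S - \<mu> n\<bar>"
          using n by (simp add: abs_mult[symmetric, of "real n", simplified] right_diff_distrib)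
        then show ?thesis using n by simp
      qed
      then show ?thesis by simp
    qed
    finally show ?thesis .
  qed
  have lim: "(\<lambda>n. 2 * exp (- (e\<^sup>2 / (2 * b\<^sup>2)) * real n)) \<longlonglongrightarrow> 0"
  proof -
    have "filterlim (\<lambda>n. - (e\<^sup>2 / (2 * b\<^sup>2)) * real n) at_bot sequentially"
      by (rule filterlim_tendsto_neg_mult_at_bot[OF tendsto_const _ filterlim_real_sequentially]) (use e b in simp)
    from tendsto_mult_right_zero[OF filterlim_compose[OF exp_at_bot this], of 2] show ?thesis .
  qed
  have "?p \<longlonglongrightarrow> 0"
  proof (rule tendsto_sandwich[OF _ _ tendsto_const lim])
    show "eventually (\<lambda>n. ?p n \<le> 2 * exp (- (e\<^sup>2 / (2 * b\<^sup>2)) * real n)) sequentially"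
      by (rule eventually_sequentiallyI[of 1]) (rule hoeffding)
  qed simp
  then have "(\<lambda>n. ennreal (?p n)) \<longlonglongrightarrow> ennreal 0" by (rule tendsto_ennrealI)
  then show ?thesis by (simp add: emeasure_eq_measure)
qed

lemma sum_bin_counts:
  "(\<Sum>j=1..k. bin_counts k n y j * F j) = (\<Sum>i=1..n. \<Sum>j=1..k. F j * indicator (bin k j) (y i))"
  unfolding bin_counts_def sum_distrib_right by (subst sum.swap) (simp only: mult.commute)

text \<open>The centring is a constant for fixed data, and the weights sum to 1; it can therefore be
  subtracted from each coefficient, leaving a homogeneous linear functional of the weights.\<close>

lemma posterior_functional_eq_dirichlet:
  fixes \<psi>t :: "real \<Rightarrow> real"
  assumes k: "1 \<le> k" and \<delta>: "\<And>j. j \<in> {1..k} \<Longrightarrow> 0 < \<delta> j" and \<alpha>: "0 \<le> \<alpha>"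
    and y: "\<And>i. i \<in> {1..n} \<Longrightarrow> y i \<in> {0..1}" "\<And>i m. i \<in> {1..n} \<Longrightarrow> y i \<noteq> real m / real k"
    and \<psi>t: "set_integrable lborel {0..1} \<psi>t"
    and \<psi>: "\<And>f. is_density01 f \<Longrightarrow> \<psi> f - c = (LINT x:{0..1}|lborel. \<psi>t x * f x)"
  shows "distr (posterior \<alpha> (random_histogram k \<delta>) n y) borel (\<lambda>f. s * (\<psi> f - linear_estimator c h n y)) =
    distr (dirichlet k (\<lambda>j. \<delta> j + \<alpha> * bin_counts k n y j)) borel
      (\<lambda>\<omega>. s * (\<Sum>j=1..k. (real k * (LINT u:bin k j|lborel. \<psi>t u) - (1 / real n) * (\<Sum>i=1..n. h (y i))) * \<omega> j))"
proof (rule distr_posterior_histogram[where \<delta> = \<delta>, OF k \<delta> \<alpha> y])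
  fix \<omega> assume \<omega>: "\<omega> \<in> unit_simplex k"
  let ?e = "(1 / real n) * (\<Sum>i=1..n. h (y i))"
  have "\<psi> (histogram k \<omega>) - c = (\<Sum>j=1..k. real k * (LINT u:bin k j|lborel. \<psi>t u) * \<omega> j)"
    unfolding \<psi>[OF is_density_histogram[OF k \<omega>]] by (rule set_integral_histogram(2)[OF \<psi>t])
  moreover have "?e = (\<Sum>j=1..k. ?e * \<omega> j)"
    using \<omega> unfolding sum_distrib_left[symmetric] by (simp add: unit_simplex_def)
  ultimately have "\<psi> (histogram k \<omega>) - linear_estimator c h n y =
      (\<Sum>j=1..k. real k * (LINT u:bin k j|lborel. \<psi>t u) * \<omega> j) - (\<Sum>j=1..k. ?e * \<omega> j)"
    by (simp only: linear_estimator_def diff_diff_add[symmetric])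
  then show "s * (\<psi> (histogram k \<omega>) - linear_estimator c h n y) =
      s * (\<Sum>j=1..k. (real k * (LINT u:bin k j|lborel. \<psi>t u) - ?e) * \<omega> j)"
    by (simp only: left_diff_distrib sum_subtractf)
qed auto

text \<open>A statement about fixed data: randomness will enter only through the last three
  numerical hypotheses and the position of the observations. The bound \<open>2 * B\<close> on the
  coefficients adds one B for the bin average and one for the empirical mean.\<close>

lemma posterior_d_BL_small:
  fixes \<psi>t :: "real \<Rightarrow> real"
  assumes v: "0 \<le> v" and \<eta>: "0 < (\<eta> :: real)" and B: "0 < B"
    and \<psi>t: "set_borel_measurable borel {0..1} \<psi>t" "\<And>x. x \<in> {0..1} \<Longrightarrow> \<bar>\<psi>t x\<bar> \<le> B"
    and \<psi>: "\<And>f. is_density01 f \<Longrightarrow> \<psi> f - c = (LINT x:{0..1}|lborel. \<psi>t x * f x)"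
  obtains \<rho> where "0 < \<rho>"
    and "\<And>k n \<alpha> \<delta> y. 1 \<le> k \<Longrightarrow> 1 \<le> n \<Longrightarrow> 0 < \<alpha> \<Longrightarrow> (\<And>j. j \<in> {1..k} \<Longrightarrow> 0 < \<delta> j) \<Longrightarrow>
      (\<And>i. i \<in> {1..n} \<Longrightarrow> y i \<in> {0..1}) \<Longrightarrow> (\<And>i m. i \<in> {1..n} \<Longrightarrow> y i \<noteq> real m / real k) \<Longrightarrow>
      1 / \<rho> \<le> real n * \<alpha> \<Longrightarrow> (\<Sum>j=1..k. \<delta> j) / (real n * \<alpha>) \<le> \<rho> \<Longrightarrow>
      2 * B * ((\<Sum>j=1..k. \<delta> j) / sqrt (real n * \<alpha>)) \<le> \<rho> / 2 \<Longrightarrow>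
      4 * B\<^sup>2 * ((\<Sum>j=1..k. \<delta> j) / (real n * \<alpha>)) \<le> \<rho> / 4 \<Longrightarrow>
      \<bar>sqrt (real n * \<alpha>) * (linear_estimator c (bin_proj k \<psi>t) n y - linear_estimator c \<psi>t n y)\<bar> \<le> \<rho> / 2 \<Longrightarrow>
      \<bar>(1 / real n) * (\<Sum>i=1..n. \<psi>t (y i))\<bar> \<le> \<rho> / (12 * B) \<Longrightarrow>
      \<bar>(1 / real n) * (\<Sum>i=1..n. (bin_proj k \<psi>t (y i))\<^sup>2) - v\<bar> \<le> \<rho> / 2 \<Longrightarrow>
      0 \<le> d_BL (distr (posterior \<alpha> (random_histogram k \<delta>) n y) borel
        (\<lambda>f. sqrt (real n * \<alpha>) * (\<psi> f - linear_estimator c \<psi>t n y))) (gaussian 0 v) \<and>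
      d_BL (distr (posterior \<alpha> (random_histogram k \<delta>) n y) borel
        (\<lambda>f. sqrt (real n * \<alpha>) * (\<psi> f - linear_estimator c \<psi>t n y))) (gaussian 0 v) < \<eta>"
proof -
  obtain \<rho> where \<rho>: "0 < \<rho>"
    and small: "\<And>k a d \<nu>. 1 \<le> k \<Longrightarrow> (\<And>j. j \<in> {1..k} \<Longrightarrow> 0 < a j) \<Longrightarrow> (\<And>j. j \<in> {1..k} \<Longrightarrow> \<bar>d j\<bar> \<le> 2 * B) \<Longrightarrow>
      1 / \<rho> \<le> \<nu> \<Longrightarrow> \<bar>(\<Sum>j=1..k. a j) / \<nu> - 1\<bar> \<le> \<rho> \<Longrightarrow> \<bar>(\<Sum>j=1..k. a j * d j) / sqrt \<nu>\<bar> \<le> \<rho> \<Longrightarrow>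
      \<bar>(\<Sum>j=1..k. a j * (d j)\<^sup>2) / \<nu> - v\<bar> \<le> \<rho> \<Longrightarrow>
      d_BL (distr (dirichlet k a) borel (\<lambda>\<omega>. sqrt \<nu> * (\<Sum>j=1..k. d j * \<omega> j))) (gaussian 0 v) < \<eta>"
    using dirichlet_linear_d_BL_small[OF v \<eta>, of "2 * B"] by blast
  have \<psi>i: "set_integrable lborel {0..1} \<psi>t" by (rule set_integrable_bounded01[OF \<psi>t])
  show thesis
  proof (rule that[OF \<rho>])
    fix k n :: nat and \<alpha> :: real and \<delta> y :: "nat \<Rightarrow> real"
    assume k: "1 \<le> k" and n: "1 \<le> n" and \<alpha>: "0 < \<alpha>" and \<delta>: "\<And>j. j \<in> {1..k} \<Longrightarrow> 0 < \<delta> j"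
      and y: "\<And>i. i \<in> {1..n} \<Longrightarrow> y i \<in> {0..1}" "\<And>i m. i \<in> {1..n} \<Longrightarrow> y i \<noteq> real m / real k"
      and \<nu>\<rho>: "1 / \<rho> \<le> real n * \<alpha>" and s0: "(\<Sum>j=1..k. \<delta> j) / (real n * \<alpha>) \<le> \<rho>"
      and s1: "2 * B * ((\<Sum>j=1..k. \<delta> j) / sqrt (real n * \<alpha>)) \<le> \<rho> / 2"
      and s2: "4 * B\<^sup>2 * ((\<Sum>j=1..k. \<delta> j) / (real n * \<alpha>)) \<le> \<rho> / 4"
      and x1: "\<bar>sqrt (real n * \<alpha>) * (linear_estimator c (bin_proj k \<psi>t) n y - linear_estimator c \<psi>t n y)\<bar> \<le> \<rho> / 2"
      and x2: "\<bar>(1 / real n) * (\<Sum>i=1..n. \<psi>t (y i))\<bar> \<le> \<rho> / (12 * B)"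
      and x3: "\<bar>(1 / real n) * (\<Sum>i=1..n. (bin_proj k \<psi>t (y i))\<^sup>2) - v\<bar> \<le> \<rho> / 2"
    define \<nu> where "\<nu> = real n * \<alpha>"
    define e where "e = (1 / real n) * (\<Sum>i=1..n. \<psi>t (y i))"
    define q where "q i = bin_proj k \<psi>t (y i)" for i
    define d where "d j = real k * (LINT u:bin k j|lborel. \<psi>t u) - e" for j
    define a where "a j = \<delta> j + \<alpha> * bin_counts k n y j" for j
    define D where "D = (\<Sum>j=1..k. \<delta> j)"
    have n0: "0 < real n" using n by simp
    have \<nu>: "0 < \<nu>" using n \<alpha> by (simp add: \<nu>_def)
    have "0 \<le> bin_counts k n y j" for j by (simp add: bin_counts_def sum_nonneg)
    then have a: "0 < a j" if "j \<in> {1..k}" for j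
      using \<delta>[OF that] \<alpha> by (simp add: a_def add_pos_nonneg)
    have q: "\<bar>q i\<bar> \<le> B" if "i \<in> {1..n}" for i
      unfolding q_def by (rule bin_proj_bounded[OF k y(1)[OF that] y(2)[OF that] \<psi>i \<psi>t(2)])
    have avg: "\<bar>(1 / real n) * (\<Sum>i=1..n. g i)\<bar> \<le> B" if "\<And>i. i \<in> {1..n} \<Longrightarrow> \<bar>g i\<bar> \<le> B" for g
    proof -
      have "\<bar>\<Sum>i=1..n. g i\<bar> \<le> (\<Sum>i=1..n. \<bar>g i\<bar>)" by (rule sum_abs)
      also have "\<dots> \<le> (\<Sum>i=1..n. B)" by (rule sum_mono) (rule that)
      finally have "\<bar>\<Sum>i=1..n. g i\<bar> \<le> real n * B" by simp
      then show ?thesis using n0 by (simp add: abs_mult divide_le_eq mult.commute)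
    qed
    have eB: "\<bar>e\<bar> \<le> B" unfolding e_def by (rule avg) (rule \<psi>t(2)[OF y(1)])
    have d: "\<bar>d j\<bar> \<le> 2 * B" if "j \<in> {1..k}" for j
    proof -
      have "\<bar>real k * (LINT u:bin k j|lborel. \<psi>t u) - 0\<bar> \<le> B"
      proof (rule bin_average_diff_le[OF k that \<psi>i])
        fix u assume "u \<in> bin k j"
        then have "u \<in> {0..1}" using bin_subset[OF that] by (rule rev_subsetD)
        then show "\<bar>\<psi>t u - 0\<bar> \<le> B" using \<psi>t(2)[of u] by simp
      qed
      then show ?thesis using eB unfolding d_def by linarith
    qed
    have sum_a: "(\<Sum>j=1..k. a j * F j) = (\<Sum>j=1..k. \<delta> j * F j) + \<alpha> * (\<Sum>i=1..n. \<Sum>j=1..k. F j * indicator (bin k j) (y i))" for F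
    proof -
      have "(\<Sum>j=1..k. a j * F j) = (\<Sum>j=1..k. \<delta> j * F j + \<alpha> * (bin_counts k n y j * F j))"
        by (simp only: a_def distrib_right mult.assoc)
      also have "\<dots> = (\<Sum>j=1..k. \<delta> j * F j) + \<alpha> * (\<Sum>j=1..k. bin_counts k n y j * F j)"
        by (simp only: sum.distrib sum_distrib_left)
      finally show ?thesis unfolding sum_bin_counts .
    qed
    \<comment> \<open>Off the grid exactly one indicator is 1, and the average over that bin is the
      value of the projection at the observation. The cases used are F constant, the identity and
      the square, one for each moment condition.\<close>
    have at_obs: "(\<Sum>j=1..k. F (d j) * indicator (bin k j) (y i)) = F (q i - e)" if i: "i \<in> {1..n}" for F :: "real \<Rightarrow> real" and i
    proof -
      obtain j where j: "j \<in> {1..k}" "\<And>\<omega>. histogram k \<omega> (y i) = real k * \<omega> j"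
        "\<And>h. bin_proj k h (y i) = real k * (LINT u:bin k j|lborel. h u)"
        using bin_proj_off_grid[OF k y(1)[OF i] y(2)[OF i]] by metis
      have "real k * (\<Sum>j=1..k. F (d j) * indicator (bin k j) (y i)) = real k * F (d j)"
        using j(2)[of "\<lambda>j. F (d j)"] by (simp only: histogram_def)
      then have "(\<Sum>j=1..k. F (d j) * indicator (bin k j) (y i)) = F (d j)" using k by simp
      then show ?thesis unfolding q_def j(3) d_def .
    qed
    have D0: "0 \<le> D" unfolding D_def by (rule sum_nonneg) (rule less_imp_le[OF \<delta>])
    have m0: "\<bar>(\<Sum>j=1..k. a j) / \<nu> - 1\<bar> \<le> \<rho>"
    proof -
      have "(\<Sum>j=1..k. a j) = D + \<nu>"
        using sum_a[of "\<lambda>_. 1"] at_obs[of _ "\<lambda>_. 1"] by (simp add: D_def \<nu>_def mult.commute)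
      then have "(\<Sum>j=1..k. a j) / \<nu> - 1 = D / \<nu>" using \<nu> by (simp add: add_divide_distrib)
      then show ?thesis using s0 D0 \<nu> by (simp add: D_def \<nu>_def)
    qed
    \<comment> \<open>The observations contribute exactly \<open>sqrt \<nu>\<close> times the
      difference of the projected and the plain estimator, so here the no-bias condition is used. It
      takes half of \<rho>; the prior weights take the other half.\<close>
    have m1: "\<bar>(\<Sum>j=1..k. a j * d j) / sqrt \<nu>\<bar> \<le> \<rho>"
    proof -
      have "(\<Sum>j=1..k. a j * d j) = (\<Sum>j=1..k. \<delta> j * d j) + \<alpha> * (\<Sum>i=1..n. q i - e)"
        using sum_a[of d] at_obs[of _ "\<lambda>x. x"] by simp
      also have "(\<Sum>i=1..n. q i - e) = real n * ((1 / real n) * (\<Sum>i=1..n. q i) - e)"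
        using n0 by (simp add: sum_subtractf right_diff_distrib)
      also have "(1 / real n) * (\<Sum>i=1..n. q i) - e = linear_estimator c (bin_proj k \<psi>t) n y - linear_estimator c \<psi>t n y"
        by (simp add: linear_estimator_def q_def e_def)
      finally have "(\<Sum>j=1..k. a j * d j) / sqrt \<nu> = (\<Sum>j=1..k. \<delta> j * d j) / sqrt \<nu> +
          (\<nu> / sqrt \<nu>) * (linear_estimator c (bin_proj k \<psi>t) n y - linear_estimator c \<psi>t n y)"
        by (simp add: add_divide_distrib \<nu>_def mult_ac)
      also have "\<nu> / sqrt \<nu> = sqrt \<nu>" using \<nu> by (simp add: real_div_sqrt)
      finally have eq: "(\<Sum>j=1..k. a j * d j) / sqrt \<nu> = (\<Sum>j=1..k. \<delta> j * d j) / sqrt \<nu> +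
          sqrt \<nu> * (linear_estimator c (bin_proj k \<psi>t) n y - linear_estimator c \<psi>t n y)" .
      have "\<bar>\<Sum>j=1..k. \<delta> j * d j\<bar> \<le> (\<Sum>j=1..k. \<delta> j * (2 * B))"
      proof (rule order_trans[OF sum_abs], rule sum_mono)
        fix j assume j: "j \<in> {1..k}"
        show "\<bar>\<delta> j * d j\<bar> \<le> \<delta> j * (2 * B)"
          using \<delta>[OF j] d[OF j] by (simp add: abs_mult)
      qed
      also have "\<dots> = 2 * B * D" by (simp add: D_def sum_distrib_left mult_ac)
      finally have "\<bar>(\<Sum>j=1..k. \<delta> j * d j) / sqrt \<nu>\<bar> \<le> 2 * B * D / sqrt \<nu>"
        using \<nu> by (simp add: divide_right_mono)
      also have "\<dots> \<le> \<rho> / 2" using s1 by (simp add: D_def \<nu>_def)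
      finally show ?thesis using x1 unfolding \<nu>_def eq[unfolded \<nu>_def] by linarith
    qed
    \<comment> \<open>The budget for \<rho> is 1/4 for the prior weights, 1/2 for the empirical
      second moment, 1/6 for the mixed term and 1/12 for the squared empirical mean, adding up to 1.
      The last two fix the constant 12 in the hypothesis on the empirical mean.\<close>
    have m2: "\<bar>(\<Sum>j=1..k. a j * (d j)\<^sup>2) / \<nu> - v\<bar> \<le> \<rho>"
    proof -
      define A where "A = (1 / real n) * (\<Sum>i=1..n. (q i)\<^sup>2)"
      define m where "m = (1 / real n) * (\<Sum>i=1..n. q i)"
      have "(\<Sum>j=1..k. a j * (d j)\<^sup>2) = (\<Sum>j=1..k. \<delta> j * (d j)\<^sup>2) + \<alpha> * (\<Sum>i=1..n. (q i - e)\<^sup>2)"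
        using sum_a[of "\<lambda>j. (d j)\<^sup>2"] at_obs[of _ "\<lambda>x. x\<^sup>2"] by simp
      also have "(\<Sum>i=1..n. (q i - e)\<^sup>2) = (\<Sum>i=1..n. (q i)\<^sup>2) - 2 * e * (\<Sum>i=1..n. q i) + real n * e\<^sup>2"
        by (simp add: power2_diff sum.distrib sum_subtractf sum_distrib_left mult_ac)
      also have "\<dots> = real n * (A - 2 * e * m + e\<^sup>2)"
        using n0 by (simp add: A_def m_def distrib_left right_diff_distrib)
      finally have "(\<Sum>j=1..k. a j * (d j)\<^sup>2) / \<nu> = (\<Sum>j=1..k. \<delta> j * (d j)\<^sup>2) / \<nu> + (A - 2 * e * m + e\<^sup>2)"
        using n0 \<alpha> by (simp add: \<nu>_def add_divide_distrib)
      moreover have "\<bar>(\<Sum>j=1..k. \<delta> j * (d j)\<^sup>2) / \<nu>\<bar> \<le> \<rho> / 4"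
      proof -
        have "(\<Sum>j=1..k. \<delta> j * (d j)\<^sup>2) \<le> (\<Sum>j=1..k. \<delta> j * (2 * B)\<^sup>2)"
        proof (rule sum_mono)
          fix j assume j: "j \<in> {1..k}"
          have "(d j)\<^sup>2 \<le> (2 * B)\<^sup>2" using power_mono[OF d[OF j] abs_ge_zero, of 2] by simp
          then show "\<delta> j * (d j)\<^sup>2 \<le> \<delta> j * (2 * B)\<^sup>2" using \<delta>[OF j] by simp
        qed
        also have "\<dots> = D * (2 * B)\<^sup>2" by (simp only: D_def sum_distrib_right)
        also have "\<dots> = 4 * B\<^sup>2 * D" by (simp add: power_mult_distrib)
        finally have "(\<Sum>j=1..k. \<delta> j * (d j)\<^sup>2) / \<nu> \<le> 4 * B\<^sup>2 * D / \<nu>"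
          using \<nu> by (intro divide_right_mono) simp_all
        moreover have "0 \<le> (\<Sum>j=1..k. \<delta> j * (d j)\<^sup>2) / \<nu>"
          using \<nu> \<delta> by (intro divide_nonneg_pos sum_nonneg mult_nonneg_nonneg) (simp_all add: less_imp_le)
        ultimately show ?thesis
          using s2 unfolding D_def \<nu>_def times_divide_eq_right by linarith
      qed
      moreover have "\<bar>2 * e * m\<bar> \<le> \<rho> / 6"
      proof -
        have "\<bar>m\<bar> \<le> B" unfolding m_def by (rule avg) (rule q)
        then have "\<bar>2 * e * m\<bar> \<le> 2 * \<bar>e\<bar> * B" by (simp add: abs_mult mult_left_mono)
        also have "\<dots> \<le> 2 * (\<rho> / (12 * B)) * B"
          using x2 B by (intro mult_right_mono mult_left_mono) (simp_all add: e_def)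
        finally show ?thesis using B by simp
      qed
      moreover have "\<bar>e\<^sup>2\<bar> \<le> \<rho> / 12"
      proof -
        have "\<bar>e\<^sup>2\<bar> = \<bar>e\<bar> * \<bar>e\<bar>" by (simp add: power2_eq_square abs_mult)
        also have "\<dots> \<le> (\<rho> / (12 * B)) * B"
          using x2 eB \<rho> B by (intro mult_mono) (simp_all add: e_def)
        finally show ?thesis using B by simp
      qed
      moreover have "\<bar>A - v\<bar> \<le> \<rho> / 2" using x3 by (simp only: A_def q_def)
      ultimately show ?thesis using \<rho> by linarith
    qed
    have eq: "distr (posterior \<alpha> (random_histogram k \<delta>) n y) borel
        (\<lambda>f. sqrt (real n * \<alpha>) * (\<psi> f - linear_estimator c \<psi>t n y)) =
        distr (dirichlet k a) borel (\<lambda>\<omega>. sqrt \<nu> * (\<Sum>j=1..k. d j * \<omega> j))"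
      unfolding \<nu>_def d_def[abs_def] e_def a_def[abs_def]
      by (rule posterior_functional_eq_dirichlet[OF k \<delta> less_imp_le[OF \<alpha>] y \<psi>i \<psi>])
    have "real_distribution (distr (dirichlet k a) borel (\<lambda>\<omega>. sqrt \<nu> * (\<Sum>j=1..k. d j * \<omega> j)))"
    proof -
      interpret prob_space "dirichlet k a" by (rule prob_space_dirichlet[OF k a])
      show ?thesis by (intro real_distribution_distr measurable_dirichletI) measurable
    qed
    then have "0 \<le> d_BL (distr (dirichlet k a) borel (\<lambda>\<omega>. sqrt \<nu> * (\<Sum>j=1..k. d j * \<omega> j))) (gaussian 0 v)"
      by (rule d_BL_nonneg[OF _ real_distribution_gaussian[OF v]])
    moreover have "d_BL (distr (dirichlet k a) borel (\<lambda>\<omega>. sqrt \<nu> * (\<Sum>j=1..k. d j * \<omega> j))) (gaussian 0 v) < \<eta>"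
      using \<nu>\<rho> by (intro small[where a = a and d = d, OF k a d _ m0 m1 m2]) (simp_all add: \<nu>_def)
    ultimately show "0 \<le> d_BL (distr (posterior \<alpha> (random_histogram k \<delta>) n y) borel
        (\<lambda>f. sqrt (real n * \<alpha>) * (\<psi> f - linear_estimator c \<psi>t n y))) (gaussian 0 v) \<and>
      d_BL (distr (posterior \<alpha> (random_histogram k \<delta>) n y) borel
        (\<lambda>f. sqrt (real n * \<alpha>) * (\<psi> f - linear_estimator c \<psi>t n y))) (gaussian 0 v) < \<eta>"
      unfolding eq by blast
  qed
qed

section \<open>From fixed data to convergence in probability\<close>

text \<open>Deviation events in \<open>is_o_P1\<close> need not be measurable, so subadditivity is
  obtained through a measurable hull of \<open>A'\<close>.\<close>

lemma outer_measure_of_le_Un: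
  assumes "A \<subseteq> A' \<union> C" "A' \<subseteq> space M" "C \<in> sets M"
  shows "outer_measure_of M A \<le> outer_measure_of M A' + emeasure M C"
proof -
  obtain E where E: "E \<in> sets M" "A' \<subseteq> E" "outer_measure_of M A' = emeasure M E"
    using outer_measure_of_attain[OF assms(2)] by blast
  have "outer_measure_of M A \<le> outer_measure_of M (E \<union> C)"
    using assms(1) E(2) by (intro outer_measure_of_mono) blast
  also have "\<dots> = emeasure M (E \<union> C)"
    using E(1) assms(3) by simp
  also have "\<dots> \<le> emeasure M E + emeasure M C"
    by (rule emeasure_subadditive[OF E(1) assms(3)])
  finally show ?thesis unfolding E(3) .
qed

text \<open>Almost sure statements pass through the law of \<open>X\<close>, so only points of
  positive density have to be inspected.\<close>

lemma distributed_AE_transfer: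
  assumes "distributed M lborel X (\<lambda>x. ennreal (f x))" and "AE x in lborel. 0 < f x \<longrightarrow> P x"
  shows "AE w in M. P (X w)"
proof -
  have "AE x in density lborel (\<lambda>x. ennreal (f x)). P x"
    using assms distributed_borel_measurable[OF assms(1)] by (simp add: AE_density)
  then have "AE x in distr M lborel X. P x"
    unfolding distributed_distr_eq_density[OF assms(1)] .
  then show ?thesis
    by (rule AE_distrD[OF distributed_measurable[OF assms(1)]])
qed

theorem proposition2p5:
  fixes M :: "'w measure" and Y :: "nat \<Rightarrow> 'w \<Rightarrow> real"
    and f0 \<psi>t :: "real \<Rightarrow> real" and \<psi> :: "(real \<Rightarrow> real) \<Rightarrow> real"
    and \<alpha> \<epsilon> :: "nat \<Rightarrow> real" and K :: "nat \<Rightarrow> nat" and \<delta> :: "nat \<Rightarrow> nat \<Rightarrow> real"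
  assumes "prob_space M"
    and "is_density01 f0"
    and "prob_space.indep_vars M (\<lambda>_. borel) Y {1..}"
    and "\<And>i. 1 \<le> i \<Longrightarrow> distributed M lborel (Y i) (\<lambda>x. ennreal (indicator {0..1} x * f0 x))"
    and "\<And>n. 1 \<le> n \<Longrightarrow> 0 < \<alpha> n \<and> \<alpha> n \<le> 1"
    and "filterlim (\<lambda>n. real n * \<alpha> n) at_top sequentially"
    and "set_borel_measurable borel {0..1} \<psi>t"
    and "\<exists>B. \<forall>x\<in>{0..1}. \<bar>\<psi>t x\<bar> \<le> B"
    and "(LINT x:{0..1}|lborel. \<psi>t x * f0 x) = 0"
    and "linear_functional01 \<psi>"
    and "\<And>f. is_density01 f \<Longrightarrow> \<psi> f - \<psi> f0 = (LINT x:{0..1}|lborel. \<psi>t x * f x)"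
    and "\<And>n. 1 \<le> n \<Longrightarrow> 1 \<le> K n"
    and "filterlim K at_top sequentially"
    and "\<And>n j. 1 \<le> n \<Longrightarrow> j \<in> {1..K n} \<Longrightarrow> 0 < \<delta> n j"
    and "(\<lambda>n. \<Sum>j=1..K n. \<delta> n j) \<in> o(\<lambda>n. sqrt (real n * \<alpha> n))"
    and "\<exists>C. \<forall>x\<in>{0..1}. f0 x \<le> C"
    and "\<epsilon> \<longlonglongrightarrow> 0"
    and "is_o_P1 M (\<lambda>n w.
         measure (posterior (\<alpha> n) (random_histogram (K n) (\<delta> n)) n (\<lambda>i. Y i w))
           {f. L1_dist01 f (bin_proj (K n) f0) \<le> \<epsilon> n} - 1)"
    and "is_o_P1 M (\<lambda>n w. sqrt (real n * \<alpha> n) *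
         (linear_estimator (\<psi> f0) (bin_proj (K n) \<psi>t) n (\<lambda>i. Y i w)
           - linear_estimator (\<psi> f0) \<psi>t n (\<lambda>i. Y i w)))"
  shows "weakly_converges_in_prob M
      (\<lambda>n w.
         distr (posterior (\<alpha> n) (random_histogram (K n) (\<delta> n)) n (\<lambda>i. Y i w)) borel
           (\<lambda>f. sqrt (real n * \<alpha> n) * (\<psi> f - linear_estimator (\<psi> f0) \<psi>t n (\<lambda>i. Y i w))))
      (gaussian 0 (LINT x:{0..1}|lborel. f0 x * (\<psi>t x)\<^sup>2))"
proof -
  interpret prob_space M by fact
  note f0 = assms(2) and indep = assms(3) and distrY = assms(4) and \<alpha> = assms(5) and \<nu>_top = assms(6)
    and \<psi>t_meas = assms(7) and \<psi>t_mean = assms(9) and \<psi>_rep = assms(11) and K1 = assms(12)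
    and K_top = assms(13) and \<delta>_pos = assms(14) and \<delta>_small = assms(15) and X_small = assms(19)
  obtain B0 where B0: "\<And>x. x \<in> {0..1} \<Longrightarrow> \<bar>\<psi>t x\<bar> \<le> B0" using assms(8) by blast
  \<comment> \<open>The maximum with 1 makes the bound strictly positive, since one threshold is
    divided by it.\<close>
  define B where "B = max 1 B0"
  have B: "0 < B" "\<And>x. x \<in> {0..1} \<Longrightarrow> \<bar>\<psi>t x\<bar> \<le> B"
    unfolding B_def using B0 by (auto simp: le_max_iff_disj)
  obtain C where C: "\<And>x. x \<in> {0..1} \<Longrightarrow> f0 x \<le> C" using assms(16) by blast
  have f0_nonneg: "\<And>x. x \<in> {0..1} \<Longrightarrow> 0 \<le> f0 x" and f0_meas: "set_borel_measurable borel {0..1} f0"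
    using f0 by (auto simp: is_density01_def)
  define v where "v = (LINT x:{0..1}|lborel. f0 x * (\<psi>t x)\<^sup>2)"
  have v: "0 \<le> v"
    unfolding v_def set_lebesgue_integral_def using f0_nonneg
    by (intro integral_nonneg_AE AE_I2) (simp add: indicator_def)
  define \<nu> where "\<nu> n = real n * \<alpha> n" for n
  define D where "D n = (\<Sum>j=1..K n. \<delta> n j)" for n
  define X where "X n w = sqrt (\<nu> n) * (linear_estimator (\<psi> f0) (bin_proj (K n) \<psi>t) n (\<lambda>i. Y i w)
      - linear_estimator (\<psi> f0) \<psi>t n (\<lambda>i. Y i w))" for n w
  define \<mu> where "\<mu> n = (LINT x:{0..1}|lborel. f0 x * (bin_proj (K n) \<psi>t x)\<^sup>2)" for n
  \<comment> \<open>Outside the unit interval \<open>\<psi>t\<close> is unconstrained and possibly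
    not measurable. Its extension by 0 is measurable on the whole line and agrees with it at almost
    every observation.\<close>
  define h where "h x = indicator {0..1} x * \<psi>t x" for x :: real
  have h_meas: "h \<in> borel_measurable borel"
    using \<psi>t_meas by (simp add: set_borel_measurable_def h_def[abs_def])
  have \<psi>t_int: "set_integrable lborel {0..1} \<psi>t" by (rule set_integrable_bounded01[OF \<psi>t_meas B(2)])
  have AE_Y: "AE w in M. Y i w \<in> {0..1} \<and> (\<forall>k m. Y i w \<noteq> real m / real k)" if i: "1 \<le> i" for i
  proof (rule distributed_AE_transfer[OF distrY[OF i]])
    show "AE x in lborel. 0 < indicator {0..1} x * f0 x \<longrightarrow> x \<in> {0..1} \<and> (\<forall>k m. x \<noteq> real m / real k)"
      using AE_off_grid by eventually_elim (auto simp: indicator_def split: if_splits)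
  qed
  have mean: "expectation (\<lambda>w. g (Y i w)) = (LINT x:{0..1}|lborel. f0 x * g x)"
    if i: "1 \<le> i" and g: "g \<in> borel_measurable borel" for i and g :: "real \<Rightarrow> real"
  proof -
    have "expectation (\<lambda>w. g (Y i w)) = (\<integral>x. (indicator {0..1} x * f0 x) * g x \<partial>lborel)"
      using distributed_integral[OF distrY[OF i], of g] g f0_nonneg by (simp add: indicator_def)
    then show ?thesis by (simp add: set_lebesgue_integral_def mult.assoc)
  qed
  have mean_h: "expectation (\<lambda>w. h (Y i w)) = 0" if "1 \<le> i" for i
  proof -
    have "(LINT x:{0..1}|lborel. f0 x * h x) = (LINT x:{0..1}|lborel. \<psi>t x * f0 x)"
      unfolding set_lebesgue_integral_def
      by (intro Bochner_Integration.integral_cong refl) (simp add: h_def indicator_def mult.commute)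
    then show ?thesis using mean[OF that h_meas] \<psi>t_mean by simp
  qed
  have S1: "(\<lambda>n. emeasure M {w \<in> space M. e \<le> \<bar>(1 / real n) * (\<Sum>i=1..n. h (Y i w)) - 0\<bar>}) \<longlonglongrightarrow> 0"
    if "0 < e" for e
  proof (rule bounded_array_lln[where g = "\<lambda>_. h" and B = B, OF indep h_meas _ mean_h that])
    show "AE w in M. \<bar>h (Y i w)\<bar> \<le> B" for i
      using B by (intro AE_I2) (auto simp: h_def indicator_def)
  qed
  \<comment> \<open>The averaged function depends on \<open>n\<close> through \<open>K n\<close>,
    which is why the law of large numbers for arrays is required.\<close>
  have S2: "(\<lambda>n. emeasure M {w \<in> space M. e \<le> \<bar>(1 / real n) * (\<Sum>i=1..n. (bin_proj (K n) \<psi>t (Y i w))\<^sup>2) - \<mu> n\<bar>}) \<longlonglongrightarrow> 0"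
    if "0 < e" for e
  proof (rule bounded_array_lln[where g = "\<lambda>n x. (bin_proj (K n) \<psi>t x)\<^sup>2" and B = "B\<^sup>2", OF indep _ _ _ that])
    show m: "(\<lambda>x. (bin_proj (K n) \<psi>t x)\<^sup>2) \<in> borel_measurable borel" for n by measurable
    fix n i :: nat assume n: "1 \<le> n" and i: "1 \<le> i"
    show "expectation (\<lambda>w. (bin_proj (K n) \<psi>t (Y i w))\<^sup>2) = \<mu> n"
      unfolding \<mu>_def by (rule mean[OF i m])
    show "AE w in M. \<bar>(bin_proj (K n) \<psi>t (Y i w))\<^sup>2\<bar> \<le> B\<^sup>2"
      using AE_Y[OF i]
    proof eventually_elim
      fix w assume w: "Y i w \<in> {0..1} \<and> (\<forall>k m. Y i w \<noteq> real m / real k)"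
      have "\<bar>bin_proj (K n) \<psi>t (Y i w)\<bar> \<le> B"
        using w by (intro bin_proj_bounded[OF K1[OF n] _ _ \<psi>t_int B(2)]) auto
      then show "\<bar>(bin_proj (K n) \<psi>t (Y i w))\<^sup>2\<bar> \<le> B\<^sup>2"
        using power_mono[of "\<bar>bin_proj (K n) \<psi>t (Y i w)\<bar>" B 2] by simp
    qed
  qed
  have \<mu>_lim: "\<mu> \<longlonglongrightarrow> v"
    unfolding \<mu>_def[abs_def] v_def
    by (rule filterlim_compose[OF bin_proj_second_moment_tendsto[OF \<psi>t_meas B(2) f0_meas f0_nonneg C] K_top])
  have D_lim: "(\<lambda>n. D n / sqrt (\<nu> n)) \<longlonglongrightarrow> 0"
    using smalloD_tendsto[OF \<delta>_small] by (simp add: D_def[abs_def] \<nu>_def[abs_def])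
  have \<nu>_lim: "filterlim \<nu> at_top sequentially" using \<nu>_top by (simp add: \<nu>_def[abs_def])
  have D\<nu>_lim: "(\<lambda>n. D n / \<nu> n) \<longlonglongrightarrow> 0"
  proof -
    have "(\<lambda>n. 1 / sqrt (\<nu> n)) \<longlonglongrightarrow> 0"
      by (rule real_tendsto_divide_at_top[OF tendsto_const filterlim_compose[OF sqrt_at_top \<nu>_lim]])
    from tendsto_mult[OF D_lim this] have "(\<lambda>n. D n / sqrt (\<nu> n) * (1 / sqrt (\<nu> n))) \<longlonglongrightarrow> 0" by simp
    moreover have "eventually (\<lambda>n. D n / sqrt (\<nu> n) * (1 / sqrt (\<nu> n)) = D n / \<nu> n) sequentially"
      using filterlim_at_top_dense[THEN iffD1, OF \<nu>_lim, rule_format, of 0] by (auto elim!: eventually_mono)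
    ultimately show ?thesis by (rule Lim_transform_eventually)
  qed
  define Q where "Q n w = d_BL (distr (posterior (\<alpha> n) (random_histogram (K n) (\<delta> n)) n (\<lambda>i. Y i w)) borel
           (\<lambda>f. sqrt (real n * \<alpha> n) * (\<psi> f - linear_estimator (\<psi> f0) \<psi>t n (\<lambda>i. Y i w)))) (gaussian 0 v)" for n w
  have "is_o_P1 M Q"
    unfolding is_o_P1_def
  proof (intro allI impI)
    fix \<eta> :: real assume \<eta>: "0 < \<eta>"
    obtain \<rho> where \<rho>: "0 < \<rho>"
      and small: "\<And>k n \<alpha> \<delta> y. 1 \<le> k \<Longrightarrow> 1 \<le> n \<Longrightarrow> 0 < \<alpha> \<Longrightarrow> (\<And>j. j \<in> {1..k} \<Longrightarrow> 0 < \<delta> j) \<Longrightarrow>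
      (\<And>i. i \<in> {1..n} \<Longrightarrow> y i \<in> {0..1}) \<Longrightarrow> (\<And>i m. i \<in> {1..n} \<Longrightarrow> y i \<noteq> real m / real k) \<Longrightarrow>
      1 / \<rho> \<le> real n * \<alpha> \<Longrightarrow> (\<Sum>j=1..k. \<delta> j) / (real n * \<alpha>) \<le> \<rho> \<Longrightarrow>
      2 * B * ((\<Sum>j=1..k. \<delta> j) / sqrt (real n * \<alpha>)) \<le> \<rho> / 2 \<Longrightarrow>
      4 * B\<^sup>2 * ((\<Sum>j=1..k. \<delta> j) / (real n * \<alpha>)) \<le> \<rho> / 4 \<Longrightarrow>
      \<bar>sqrt (real n * \<alpha>) * (linear_estimator (\<psi> f0) (bin_proj k \<psi>t) n y - linear_estimator (\<psi> f0) \<psi>t n y)\<bar> \<le> \<rho> / 2 \<Longrightarrow>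
      \<bar>(1 / real n) * (\<Sum>i=1..n. \<psi>t (y i))\<bar> \<le> \<rho> / (12 * B) \<Longrightarrow>
      \<bar>(1 / real n) * (\<Sum>i=1..n. (bin_proj k \<psi>t (y i))\<^sup>2) - v\<bar> \<le> \<rho> / 2 \<Longrightarrow>
      0 \<le> d_BL (distr (posterior \<alpha> (random_histogram k \<delta>) n y) borel
        (\<lambda>f. sqrt (real n * \<alpha>) * (\<psi> f - linear_estimator (\<psi> f0) \<psi>t n y))) (gaussian 0 v) \<and>
      d_BL (distr (posterior \<alpha> (random_histogram k \<delta>) n y) borel
        (\<lambda>f. sqrt (real n * \<alpha>) * (\<psi> f - linear_estimator (\<psi> f0) \<psi>t n y))) (gaussian 0 v) < \<eta>"
      by (rule posterior_d_BL_small[where \<psi>t = \<psi>t and \<psi> = \<psi> and c = "\<psi> f0" and B = B, OF v \<eta> B(1) \<psi>t_meas B(2) \<psi>_rep]) blast+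
    define e1 where "e1 = \<rho> / (12 * B)"
    have e1: "0 < e1" using \<rho> B(1) by (simp add: e1_def)
    define E where "E n = {w \<in> space M. \<rho> / 2 < \<bar>X n w\<bar>}" for n
    define F1 where "F1 n = {w \<in> space M. e1 \<le> \<bar>(1 / real n) * (\<Sum>i=1..n. h (Y i w)) - 0\<bar>}" for n
    \<comment> \<open>The second moment may deviate by \<open>\<rho> / 2\<close>. Half of this is
      given to the fluctuation around \<open>\<mu> n\<close>, the other half to the deterministic
      gap between \<open>\<mu> n\<close> and \<open>v\<close>.\<close>
    define F2 where "F2 n = {w \<in> space M. \<rho> / 4 \<le> \<bar>(1 / real n) * (\<Sum>i=1..n. (bin_proj (K n) \<psi>t (Y i w))\<^sup>2) - \<mu> n\<bar>}" for n
    \<comment> \<open>One null set for all observations and all grids: off it, at each sample size,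
      every observation lies in exactly one bin.\<close>
    have "AE w in M. \<forall>i\<in>{1..}. Y i w \<in> {0..1} \<and> (\<forall>k m. Y i w \<noteq> real m / real k)"
      using AE_Y by (intro AE_ball_countable[THEN iffD2] ballI) auto
    then obtain N where N: "{w \<in> space M. \<not> (\<forall>i\<in>{1..}. Y i w \<in> {0..1} \<and> (\<forall>k m. Y i w \<noteq> real m / real k))} \<subseteq> N"
      "emeasure M N = 0" "N \<in> sets M"
      by (rule AE_E)
    have Y_meas: "Y i \<in> borel_measurable M" if "1 \<le> i" for i
      using distributed_measurable[OF distrY[OF that]] by simp
    have F1_sets: "F1 n \<in> sets M" for n
    proof -
      have "(\<lambda>w. \<Sum>i=1..n. h (Y i w)) \<in> borel_measurable M"
        by (intro borel_measurable_sum measurable_compose[OF Y_meas h_meas]) simp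
      then show ?thesis unfolding F1_def by measurable
    qed
    have F2_sets: "F2 n \<in> sets M" for n
    proof -
      have "(\<lambda>w. \<Sum>i=1..n. (bin_proj (K n) \<psi>t (Y i w))\<^sup>2) \<in> borel_measurable M"
        by (intro borel_measurable_sum borel_measurable_power measurable_compose[OF Y_meas bin_proj_measurable]) simp
      then show ?thesis unfolding F2_def by measurable
    qed
    have ev1: "eventually (\<lambda>n. 1 / \<rho> \<le> \<nu> n) sequentially"
      using \<nu>_lim by (simp add: filterlim_at_top)
    have ev2: "eventually (\<lambda>n. D n / \<nu> n < \<rho>) sequentially"
      by (rule order_tendstoD(2)[OF D\<nu>_lim \<rho>])
    have ev3: "eventually (\<lambda>n. 2 * B * (D n / sqrt (\<nu> n)) < \<rho> / 2) sequentially"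
      by (rule order_tendstoD(2)[OF tendsto_mult_right_zero[OF D_lim]]) (use \<rho> in simp)
    have ev4: "eventually (\<lambda>n. 4 * B\<^sup>2 * (D n / \<nu> n) < \<rho> / 4) sequentially"
      by (rule order_tendstoD(2)[OF tendsto_mult_right_zero[OF D\<nu>_lim]]) (use \<rho> in simp)
    have ev5: "eventually (\<lambda>n. \<bar>\<mu> n - v\<bar> < \<rho> / 4) sequentially"
      using tendstoD[OF \<mu>_lim, of "\<rho> / 4"] \<rho> by (simp add: dist_real_def)
    \<comment> \<open>Once \<open>n\<close> is large the deterministic requirements hold, and
      outside the exceptional sets the bound for fixed data applies to each outcome. The value
      \<open>n = 0\<close> is left out because positivity of \<alpha>, K and \<delta> is assumed
      from 1 on.\<close>
    have bad: "eventually (\<lambda>n. {w \<in> space M. \<eta> < \<bar>Q n w\<bar>} \<subseteq> E n \<union> (F1 n \<union> F2 n \<union> N)) sequentially"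
      using ev1 ev2 ev3 ev4 ev5 eventually_ge_at_top[of 1]
    proof eventually_elim
      fix n assume evs: "1 / \<rho> \<le> \<nu> n" "D n / \<nu> n < \<rho>" "2 * B * (D n / sqrt (\<nu> n)) < \<rho> / 2"
        "4 * B\<^sup>2 * (D n / \<nu> n) < \<rho> / 4" "\<bar>\<mu> n - v\<bar> < \<rho> / 4" and n: "1 \<le> n"
      show "{w \<in> space M. \<eta> < \<bar>Q n w\<bar>} \<subseteq> E n \<union> (F1 n \<union> F2 n \<union> N)"
      proof
        fix w assume w: "w \<in> {w \<in> space M. \<eta> < \<bar>Q n w\<bar>}"
        show "w \<in> E n \<union> (F1 n \<union> F2 n \<union> N)"
        proof (rule ccontr)
          assume no: "w \<notin> E n \<union> (F1 n \<union> F2 n \<union> N)"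
          have wM: "w \<in> space M" using w by simp
          have y: "Y i w \<in> {0..1}" "\<And>k m. Y i w \<noteq> real m / real k" if "1 \<le> i" for i
            using no N(1) wM that by blast+
          have x1: "\<bar>X n w\<bar> \<le> \<rho> / 2" using no wM by (simp add: E_def)
          have "\<bar>(1 / real n) * (\<Sum>i=1..n. h (Y i w)) - 0\<bar> \<le> e1"
            using no wM by (simp add: F1_def)
          moreover have "(\<Sum>i=1..n. h (Y i w)) = (\<Sum>i=1..n. \<psi>t (Y i w))"
            using y(1) by (intro sum.cong refl) (simp add: h_def)
          ultimately have x2: "\<bar>(1 / real n) * (\<Sum>i=1..n. \<psi>t (Y i w))\<bar> \<le> \<rho> / (12 * B)"
            by (simp only: e1_def diff_0_right)
          have "\<bar>(1 / real n) * (\<Sum>i=1..n. (bin_proj (K n) \<psi>t (Y i w))\<^sup>2) - \<mu> n\<bar> \<le> \<rho> / 4"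
            using no wM by (simp add: F2_def)
          then have x3: "\<bar>(1 / real n) * (\<Sum>i=1..n. (bin_proj (K n) \<psi>t (Y i w))\<^sup>2) - v\<bar> \<le> \<rho> / 2"
            using evs(5) by linarith
          have "0 \<le> Q n w \<and> Q n w < \<eta>"
            unfolding Q_def
          proof (rule small[OF K1[OF n] n _ \<delta>_pos[OF n]])
            show "0 < \<alpha> n" using \<alpha>[OF n] by simp
            show "Y i w \<in> {0..1}" "Y i w \<noteq> real m / real (K n)" if "i \<in> {1..n}" for i m
              using y that by simp_all
          qed (use evs x1 x2 x3 in \<open>simp_all only: D_def \<nu>_def X_def less_imp_le\<close>)
          then show False using w by simp
        qed
      qed
    qed
    have upper: "eventually (\<lambda>n. outer_measure_of M {w \<in> space M. \<eta> < \<bar>Q n w\<bar>} \<le>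
        outer_measure_of M (E n) + (emeasure M (F1 n) + emeasure M (F2 n))) sequentially"
      using bad
    proof eventually_elim
      fix n assume "{w \<in> space M. \<eta> < \<bar>Q n w\<bar>} \<subseteq> E n \<union> (F1 n \<union> F2 n \<union> N)"
      then have "outer_measure_of M {w \<in> space M. \<eta> < \<bar>Q n w\<bar>} \<le> outer_measure_of M (E n) + emeasure M (F1 n \<union> F2 n \<union> N)"
        by (rule outer_measure_of_le_Un) (use F1_sets F2_sets N(3) in \<open>auto simp: E_def\<close>)
      also have "emeasure M (F1 n \<union> F2 n \<union> N) \<le> emeasure M (F1 n \<union> F2 n) + emeasure M N"
        using F1_sets F2_sets N(3) by (intro emeasure_subadditive) auto
      also have "emeasure M (F1 n \<union> F2 n) + emeasure M N \<le> emeasure M (F1 n) + emeasure M (F2 n)"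
        using emeasure_subadditive[OF F1_sets F2_sets] N(2) by simp
      finally show "outer_measure_of M {w \<in> space M. \<eta> < \<bar>Q n w\<bar>} \<le>
        outer_measure_of M (E n) + (emeasure M (F1 n) + emeasure M (F2 n))" by (simp add: add_left_mono)
    qed
    have "(\<lambda>n. outer_measure_of M (E n) + (emeasure M (F1 n) + emeasure M (F2 n))) \<longlonglongrightarrow> 0 + (0 + 0)"
    proof (intro tendsto_add)
      show "(\<lambda>n. outer_measure_of M (E n)) \<longlonglongrightarrow> 0"
        using X_small[unfolded is_o_P1_def, rule_format, OF half_gt_zero[OF \<rho>]]
        unfolding E_def X_def \<nu>_def .
      show "(\<lambda>n. emeasure M (F1 n)) \<longlonglongrightarrow> 0" unfolding F1_def by (rule S1[OF e1])
      show "(\<lambda>n. emeasure M (F2 n)) \<longlonglongrightarrow> 0" unfolding F2_def by (rule S2) (use \<rho> in simp)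
    qed
    then have lim: "(\<lambda>n. outer_measure_of M (E n) + (emeasure M (F1 n) + emeasure M (F2 n))) \<longlonglongrightarrow> 0" by simp
    show "(\<lambda>n. outer_measure_of M {w \<in> space M. \<eta> < \<bar>Q n w\<bar>}) \<longlonglongrightarrow> 0"
      by (rule tendsto_sandwich[OF _ upper tendsto_const lim]) simp
  qed
  then show ?thesis
    unfolding weakly_converges_in_prob_def Q_def v_def .
qed

end
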